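(* Let $\Omega\subset D_m$ be a generic set of paths which contains a path $x\in Q^\pi_m$ with $[x]_\pi$ continuous and strictly increasing, and which also contains, for this $x$ and for some $N\in\mathbb{N}$, the piecewise-linear approximations $x^{(n)}$ of $x$ along $\pi_n$ for all $n\ge N$. Let $\Lambda=\{(t,x_t): t\in\mathbb{R}_+,\,x\in\Omega\}$. Then, for functionals $F:\Lambda\to\mathbb{R}$: (i) Every $J_1$-continuous functional is continuous (with respect to the $\pi$-topology). (ii) There exists a continuous functional (with respect to the $\pi$-topology) which is not $U$-continuous. (iii) There exist $U$-continuous functionals which are not continuous (with respect to the $\pi$-topology).
   Context: Partitions: $\pi=(\pi_n)_{n\ge1}$ is a fixed sequence of partitions $\pi_n=(0=t^n_0<\dots<t^n_{k_n}<\infty)$ of $[0,\infty)$ with $t^n_{k_n}\to\infty$ and mesh vanishing on compacts; the superscript $n$ is dropped and sums involving $t_{i+1}$ run over $i<k_n$. Paths: $D_m$ is the space of càdlàg functions $[0,\infty)\to\mathbb{R}^m$, $x(0-):=x(0)$, $\Delta x(t):=x(t)-x(t-)$; $x_t(s):=x(s\wedge t)$, $x_{t-}(s):=x(s)1_{s<t}+x(t-)1_{s\ge t}$. $x^n:=\sum_{t_i\in\pi_n}x(t_{i+1})1_{[t_i,t_{i+1})}$, and $x^n_t,x^n_{t-}$ are the stopped versions of $x^n$. $x^{(n)}$ is the continuous piecewise-linear interpolation of $x$ along $\pi_n$. $Q^\pi_m$ is the set of $x\in D_m$ for which $q_n(t):=\sum_{\pi_n\ni t_i\le t}(x(t_{i+1})-x(t_i))(x(t_{i+1})-x(t_i))'$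 converges in the Skorokhod $J_1$ topology; the limit is $[x]_\pi$. Generic sets: a nonempty $\Omega\subset D_m$ is generic if (i) for every $x\in\Omega$, $T>0$ there is $N$ with $x^n_T\in\Omega$ for all $n\ge N$; (ii) for every $x\in\Omega$, $t\ge0$ there is a convex neighbourhood $\mathcal{U}$ of $0$ in $\mathbb{R}^m$ with $-\Delta x(t)\in\mathcal{U}$ and $x_t+e1_{[t,\infty)}\in\Omega$ for all $e\in\mathcal{U}$. Topologies on $\Lambda$: the $U$ (resp. $J_1$) topology is the one induced on $\Lambda\subset\mathbb{R}_+\times D_m$ by the product of the usual topology of $\mathbb{R}_+$ with the local uniform (resp. Skorokhod $J_1$) topology of $D_m$. The $\pi$-topology is the initial topology on $\Lambda$ generated by the set $\mathfrak{X}$ of all $F:\Lambda\to\mathbb{R}$ satisfying, for all $(t,x_t)\in\Lambda$ ($x\in\Omega$), with $t'_n:=\max\{t_i<t: t_i\in\pi_n\}$ (and $t'_n:=0$ if there is no such $t_i$): 1(a) $\lim_{s\uparrow t,\,s\le t}F(s,x_{s-})=F(t,x_{t-})$; 1(b) $\lim_{s\uparrow t,\,s<t}F(s,x_s)=F(t,x_{t-})$; 1(c) $t_n\to t$, $t_n\le t'_n$ implies $F(t_n,x^n_{t_n-})\to F(t,x_{t-})$; 1(d) $t_n\to t$, $t_n<t'_n$ implies $F(t_n,x^n_{t_n})\to F(t,x_{t-})$; 2(a) $\lim_{s\downarrow t,\,s\ge t}F(s,x_s)=F(t,x_t)$; 2(b) $\lim_{s\downarrow t,\,s>t}F(s,x_{s-})=F(t,x_t)$;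 2(c) $t_n\to t$, $t_n\ge t'_n$ implies $F(t_n,x^n_{t_n})\to F(t,x_t)$; 2(d) $t_n\to t$, $t_n>t'_n$ implies $F(t_n,x^n_{t_n-})\to F(t,x_t)$. A functional is continuous with respect to the $\pi$-topology if and only if it belongs to $\mathfrak{X}$. *)

theory Defs
  imports "HOL-Analysis.Analysis"
begin

section \<open>Right-continuous paths with left limits\<close>

text \<open>
  A path on \<open>[0,\<infinity>)\<close> is represented by the function on \<open>real\<close> that extends it by \<open>0\<close> to
  \<open>(-\<infinity>,0)\<close>. With this normalisation equality of functions is equality of paths, and sums of
  paths and the functions \<open>e 1\<^bsub>[t,\<infinity>)\<^esub>\<close> (\<open>t \<ge> 0\<close>) need no further truncation.
\<close>

definition cadlag_paths :: "(real \<Rightarrow> 'a::real_normed_vector) set" where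
  "cadlag_paths = {x. (\<forall>s<0. x s = 0)
     \<and> (\<forall>t\<ge>0. continuous (at_right t) x)
     \<and> (\<forall>t>0. \<exists>l. (x \<longlongrightarrow> l) (at_left t))}"

text \<open>The case distinction is the convention \<open>x(0-) := x(0)\<close>.\<close>

definition left_lim :: "(real \<Rightarrow> 'a::real_normed_vector) \<Rightarrow> real \<Rightarrow> 'a" where
  "left_lim x t = (if t = 0 then x 0 else Lim (at_left t) x)"

definition jump :: "(real \<Rightarrow> 'a::real_normed_vector) \<Rightarrow> real \<Rightarrow> 'a" where
  "jump x t = x t - left_lim x t"

definition stop :: "(real \<Rightarrow> 'a::real_normed_vector) \<Rightarrow> real \<Rightarrow> (real \<Rightarrow> 'a)" where
  "stop x t = (\<lambda>s. x (min s t))"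

definition stop_left :: "(real \<Rightarrow> 'a::real_normed_vector) \<Rightarrow> real \<Rightarrow> (real \<Rightarrow> 'a)" where
  "stop_left x t = (\<lambda>s. if s < t then x s else left_lim x t)"


section \<open>The local uniform and the Skorokhod topology\<close>

definition lu_nbhd ::
    "(real \<Rightarrow> 'a::real_normed_vector) \<Rightarrow> real \<Rightarrow> real \<Rightarrow> (real \<Rightarrow> 'a) set" where
  "lu_nbhd x T e = {y \<in> cadlag_paths. \<exists>d<e. \<forall>s\<in>{0..T}. norm (y s - x s) \<le> d}"

definition local_uniform_topology :: "(real \<Rightarrow> 'a::real_normed_vector) topology" where
  "local_uniform_topology = topology (\<lambda>U. U \<subseteq> cadlag_paths
     \<and> (\<forall>x\<in>U. \<exists>T. \<exists>e>0. lu_nbhd x T e \<subseteq> U))"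

definition time_change :: "(real \<Rightarrow> real) \<Rightarrow> bool" where
  "time_change l \<longleftrightarrow>
     continuous_on {0..} l \<and> strict_mono_on {0..} l \<and> l ` {0..} = {0..}"

definition J1_nbhd ::
    "(real \<Rightarrow> 'a::real_normed_vector) \<Rightarrow> real \<Rightarrow> real \<Rightarrow> (real \<Rightarrow> 'a) set" where
  "J1_nbhd x T e = {y \<in> cadlag_paths. \<exists>l. time_change l \<and> (\<exists>d<e.
     (\<forall>s\<ge>0. \<bar>l s - s\<bar> \<le> d) \<and> (\<forall>s\<in>{0..T}. norm (y (l s) - x s) \<le> d))}"

text \<open>
  The sets \<open>J1_nbhd x T e\<close> form a base of open neighbourhoods of \<open>x\<close>. The resulting convergence of
  sequences is the usual description of \<open>J\<^sub>1\<close>-convergence by time changes; see \<open>limitin_J1_iff\<close>.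
\<close>

definition J1_topology :: "(real \<Rightarrow> 'a::real_normed_vector) topology" where
  "J1_topology = topology (\<lambda>U. U \<subseteq> cadlag_paths
     \<and> (\<forall>x\<in>U. \<exists>T. \<exists>e>0. J1_nbhd x T e \<subseteq> U))"

lemma lu_nbhd_mono:
  assumes "T \<le> T'" "e' \<le> e"
  shows "lu_nbhd x T' e' \<subseteq> lu_nbhd x T e"
  using assms unfolding lu_nbhd_def by force

lemma J1_nbhd_mono:
  assumes "T \<le> T'" "e' \<le> e"
  shows "J1_nbhd x T' e' \<subseteq> J1_nbhd x T e"
proof
  fix y assume "y \<in> J1_nbhd x T' e'"
  then obtain l d where "y \<in> cadlag_paths" "time_change l" "d < e'"
     "\<forall>s\<ge>0. \<bar>l s - s\<bar> \<le> d" "\<forall>s\<in>{0..T'}. norm (y (l s) - x s) \<le> d"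
    unfolding J1_nbhd_def by blast
  moreover from this assms have "\<forall>s\<in>{0..T}. norm (y (l s) - x s) \<le> d" "d < e" by auto
  ultimately show "y \<in> J1_nbhd x T e" unfolding J1_nbhd_def by blast
qed

lemma istopology_nbhds:
  fixes N :: "'p \<Rightarrow> real \<Rightarrow> real \<Rightarrow> 'p set"
  assumes "\<And>x T T' e e'. T \<le> T' \<Longrightarrow> e' \<le> e \<Longrightarrow> N x T' e' \<subseteq> N x T e"
  shows "istopology (\<lambda>U. U \<subseteq> D \<and> (\<forall>x\<in>U. \<exists>T. \<exists>e>0. N x T e \<subseteq> U))"
  unfolding istopology_def
proof (intro conjI allI impI ballI)
  fix S U x
  assume S: "S \<subseteq> D \<and> (\<forall>x\<in>S. \<exists>T. \<exists>e>0. N x T e \<subseteq> S)"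
    and U: "U \<subseteq> D \<and> (\<forall>x\<in>U. \<exists>T. \<exists>e>0. N x T e \<subseteq> U)" and x: "x \<in> S \<inter> U"
  from S x obtain T e where 1: "e > 0" "N x T e \<subseteq> S" by blast
  from U x obtain T' e' where 2: "e' > 0" "N x T' e' \<subseteq> U" by blast
  have "N x (max T T') (min e e') \<subseteq> N x T e" "N x (max T T') (min e e') \<subseteq> N x T' e'"
    by (rule assms; simp)+
  with 1 2 show "\<exists>T. \<exists>e>0. N x T e \<subseteq> S \<inter> U"
    by (intro exI[of _ "max T T'"] exI[of _ "min e e'"]) auto
next
  fix S U assume "S \<subseteq> D \<and> (\<forall>x\<in>S. \<exists>T. \<exists>e>0. N x T e \<subseteq> S)"
  then show "S \<inter> U \<subseteq> D" by blast
next
  fix K assume "\<forall>S\<in>K. S \<subseteq> D \<and> (\<forall>x\<in>S. \<exists>T. \<exists>e>0. N x T e \<subseteq> S)"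
  then show "\<Union>K \<subseteq> D" by blast
next
  fix K x assume K: "\<forall>S\<in>K. S \<subseteq> D \<and> (\<forall>x\<in>S. \<exists>T. \<exists>e>0. N x T e \<subseteq> S)" and "x \<in> \<Union>K"
  then obtain S where "S \<in> K" "x \<in> S" by blast
  with K obtain T e where "e > 0" "N x T e \<subseteq> S" by blast
  with \<open>S \<in> K\<close> show "\<exists>T. \<exists>e>0. N x T e \<subseteq> \<Union>K" by blast
qed

lemma openin_local_uniform:
  "openin local_uniform_topology U \<longleftrightarrow>
     U \<subseteq> cadlag_paths \<and> (\<forall>x\<in>U. \<exists>T. \<exists>e>0. lu_nbhd x T e \<subseteq> U)"
  unfolding local_uniform_topology_def
  by (subst topology_inverse') (simp_all add: istopology_nbhds lu_nbhd_mono)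

lemma openin_J1:
  "openin J1_topology U \<longleftrightarrow>
     U \<subseteq> cadlag_paths \<and> (\<forall>x\<in>U. \<exists>T. \<exists>e>0. J1_nbhd x T e \<subseteq> U)"
  unfolding J1_topology_def
  by (subst topology_inverse') (simp_all add: istopology_nbhds J1_nbhd_mono)

lemma topspace_local_uniform: "topspace local_uniform_topology = cadlag_paths"
proof -
  have "openin local_uniform_topology cadlag_paths"
    unfolding openin_local_uniform lu_nbhd_def using zero_less_one[where 'a=real] by blast
  then show ?thesis
    by (meson openin_local_uniform openin_subset openin_topspace subset_antisym)
qed

lemma topspace_J1: "topspace J1_topology = cadlag_paths"
proof -
  have "openin J1_topology cadlag_paths"
    unfolding openin_J1 J1_nbhd_def using zero_less_one[where 'a=real] by blast
  then show ?thesis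
    by (meson openin_J1 openin_subset openin_topspace subset_antisym)
qed

lemma openin_J1_nbhd: "openin J1_topology (J1_nbhd x T e)"
  unfolding openin_J1
proof (intro conjI ballI)
  show "J1_nbhd x T e \<subseteq> cadlag_paths" by (auto simp: J1_nbhd_def)
next
  fix y assume "y \<in> J1_nbhd x T e"
  then obtain l d where l: "time_change l" and d: "d < e"
      and ld: "\<And>s. s \<ge> 0 \<Longrightarrow> \<bar>l s - s\<bar> \<le> d"
      and yd: "\<And>s. s \<in> {0..T} \<Longrightarrow> norm (y (l s) - x s) \<le> d"
    unfolding J1_nbhd_def by blast
  have l0: "l s \<ge> 0" if "s \<ge> 0" for s using l that unfolding time_change_def by auto
  have lmono: "l s \<le> l T" if "0 \<le> s" "s \<le> T" for s
    using l that strict_mono_on_leD[of "{0..}" l s T] unfolding time_change_def by auto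
  have "J1_nbhd y (l T) (e - d) \<subseteq> J1_nbhd x T e"
  proof
    fix z assume "z \<in> J1_nbhd y (l T) (e - d)"
    then obtain m c where z: "z \<in> cadlag_paths" and m: "time_change m" and c: "c < e - d"
      and mc: "\<And>s. s \<ge> 0 \<Longrightarrow> \<bar>m s - s\<bar> \<le> c"
      and zc: "\<And>s. s \<in> {0..l T} \<Longrightarrow> norm (z (m s) - y s) \<le> c"
      unfolding J1_nbhd_def by blast
    have tc: "time_change (m \<circ> l)"
      unfolding time_change_def
    proof (intro conjI)
      show "continuous_on {0..} (m \<circ> l)"
        using l m unfolding time_change_def by (intro continuous_on_compose) auto
      show "strict_mono_on {0..} (m \<circ> l)"
        using l m l0 unfolding time_change_def strict_mono_on_def by auto
      show "(m \<circ> l) ` {0..} = {0..}"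
        using l m unfolding time_change_def by (metis image_comp)
    qed
    have "\<bar>(m \<circ> l) s - s\<bar> \<le> c + d" if "s \<ge> 0" for s
      using mc[OF l0[OF that]] ld[OF that] by auto
    moreover have "norm (z ((m \<circ> l) s) - x s) \<le> c + d" if "s \<in> {0..T}" for s
      using norm_triangle_ineq[of "z (m (l s)) - y (l s)" "y (l s) - x s"]
        zc[of "l s"] yd[OF that] l0[of s] lmono[of s] that by auto
    moreover have "c + d < e" using c by simp
    ultimately show "z \<in> J1_nbhd x T e"
      unfolding J1_nbhd_def using z tc by blast
  qed
  then show "\<exists>T'. \<exists>e'>0. J1_nbhd y T' e' \<subseteq> J1_nbhd x T e"
    using d by (intro exI[of _ "l T"] exI[of _ "e - d"]) auto
qed

lemma J1_nbhd_self:
  assumes "x \<in> cadlag_paths" "e > 0" shows "x \<in> J1_nbhd x T e"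
proof -
  have "time_change (\<lambda>s. s)" by (auto simp: time_change_def strict_mono_on_def)
  with assms show ?thesis
    unfolding J1_nbhd_def by (auto intro!: exI[of _ "\<lambda>s::real. s"] exI[of _ "0::real"])
qed

lemma limitin_J1_nbhd:
  "limitin J1_topology X x F \<longleftrightarrow>
     x \<in> cadlag_paths \<and> (\<forall>T. \<forall>e>0. eventually (\<lambda>n. X n \<in> J1_nbhd x T e) F)"
proof
  assume "limitin J1_topology X x F"
  then show "x \<in> cadlag_paths \<and> (\<forall>T. \<forall>e>0. eventually (\<lambda>n. X n \<in> J1_nbhd x T e) F)"
    unfolding limitin_def topspace_J1 by (simp add: openin_J1_nbhd J1_nbhd_self)
next
  assume R: "x \<in> cadlag_paths \<and> (\<forall>T. \<forall>e>0. eventually (\<lambda>n. X n \<in> J1_nbhd x T e) F)"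
  show "limitin J1_topology X x F"
    unfolding limitin_def topspace_J1
  proof (intro conjI allI impI)
    fix U assume "openin J1_topology U \<and> x \<in> U"
    then obtain T e where "e > 0" "J1_nbhd x T e \<subseteq> U" unfolding openin_J1 by blast
    with R show "eventually (\<lambda>n. X n \<in> U) F" by (meson eventually_mono subsetD)
  qed (use R in blast)
qed

lemma limitin_J1_iff:
  "limitin J1_topology X x sequentially \<longleftrightarrow>
     x \<in> cadlag_paths \<and> (\<forall>\<^sub>F n in sequentially. X n \<in> cadlag_paths) \<and>
     (\<exists>l. (\<forall>n. time_change (l n)) \<and> uniform_limit {0..} l (\<lambda>s. s) sequentially \<and>
        (\<forall>T. uniform_limit {0..T} (\<lambda>n s. X n (l n s)) x sequentially))"
    (is "?L \<longleftrightarrow> ?R")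
proof
  assume ?R
  then obtain l where x: "x \<in> cadlag_paths" and X: "\<forall>\<^sub>F n in sequentially. X n \<in> cadlag_paths"
    and l: "\<And>n. time_change (l n)" and u: "uniform_limit {0..} l (\<lambda>s. s) sequentially"
    and v: "\<And>T. uniform_limit {0..T} (\<lambda>n s. X n (l n s)) x sequentially" by blast
  show ?L
    unfolding limitin_J1_nbhd
  proof (intro conjI allI impI x)
    fix T e :: real assume "e > 0"
    then have "e / 2 > 0" by simp
    have "\<forall>\<^sub>F n in sequentially. \<forall>s\<in>{0..}. dist (l n s) s < e / 2"
      using u \<open>e / 2 > 0\<close> unfolding uniform_limit_iff by blast
    moreover have "\<forall>\<^sub>F n in sequentially. \<forall>s\<in>{0..T}. dist (X n (l n s)) (x s) < e / 2"
      using v \<open>e / 2 > 0\<close> unfolding uniform_limit_iff by blast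
    ultimately show "\<forall>\<^sub>F n in sequentially. X n \<in> J1_nbhd x T e"
      using X
    proof eventually_elim
      case (elim n)
      then show ?case
        unfolding J1_nbhd_def dist_norm real_norm_def using l[of n] \<open>e > 0\<close>
        by (intro CollectI conjI exI[of _ "l n"] exI[of _ "e / 2"]) (auto intro: less_imp_le)
    qed
  qed
next
  assume ?L
  then have x: "x \<in> cadlag_paths"
    and ev: "\<And>T e. e > 0 \<Longrightarrow> \<forall>\<^sub>F n in sequentially. X n \<in> J1_nbhd x T e"
    unfolding limitin_J1_nbhd by blast+
  define P where "P n j \<longleftrightarrow> X n \<in> J1_nbhd x (real j) (1 / real (Suc j))" for n j
  define J where "J n = Max {j. j \<le> n \<and> (j = 0 \<or> P n j)}" for n
  have fin: "finite {j. j \<le> n \<and> (j = 0 \<or> P n j)}" for n by simp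
  have Jin: "J n = 0 \<or> P n (J n)" for n
    using Max_in[OF fin[of n]] unfolding J_def by blast
  have Jge: "j \<le> J n" if "P n j" "j \<le> n" for n j
    unfolding J_def using that by (intro Max_ge fin) auto
  have evJ: "\<forall>\<^sub>F n in sequentially. J n \<ge> j" for j
  proof -
    have "\<forall>\<^sub>F n in sequentially. P n j" unfolding P_def by (rule ev) simp
    with eventually_ge_at_top[of j] show ?thesis by eventually_elim (rule Jge)
  qed
  have "\<exists>l. time_change l \<and> (P n (J n) \<longrightarrow> (\<forall>s\<ge>0. \<bar>l s - s\<bar> < 1 / real (Suc (J n)))
      \<and> (\<forall>s\<in>{0..real (J n)}. norm (X n (l s) - x s) < 1 / real (Suc (J n))))" for n
  proof (cases "P n (J n)")
    case True
    then obtain l d where *: "time_change l" "d < 1 / real (Suc (J n))" "\<forall>s\<ge>0. \<bar>l s - s\<bar> \<le> d"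
       "\<forall>s\<in>{0..real (J n)}. norm (X n (l s) - x s) \<le> d"
      unfolding P_def J1_nbhd_def by blast
    then show ?thesis by (intro exI[of _ l]) (meson le_less_trans)
  next
    case False
    have "time_change (\<lambda>s. s)" by (auto simp: time_change_def strict_mono_on_def)
    with False show ?thesis by blast
  qed
  then have "\<exists>l. \<forall>n. time_change (l n)
      \<and> (P n (J n) \<longrightarrow> (\<forall>s\<ge>0. \<bar>l n s - s\<bar> < 1 / real (Suc (J n)))
      \<and> (\<forall>s\<in>{0..real (J n)}. norm (X n (l n s) - x s) < 1 / real (Suc (J n))))"
    by (intro choice allI)
  then obtain l where l: "\<And>n. time_change (l n)"
    and l1: "\<And>n s. P n (J n) \<Longrightarrow> s \<ge> 0 \<Longrightarrow> \<bar>l n s - s\<bar> < 1 / real (Suc (J n))"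
    and l2: "\<And>n s. P n (J n) \<Longrightarrow> s \<in> {0..real (J n)} \<Longrightarrow>
        norm (X n (l n s) - x s) < 1 / real (Suc (J n))"
    by blast
  have key: "\<forall>\<^sub>F n in sequentially. P n (J n) \<and> 1 / real (Suc (J n)) < e \<and> T \<le> real (J n)"
    if "e > 0" for e T
  proof -
    obtain j where j: "1 / real (Suc j) < e"
      by (rule nat_approx_posE[OF \<open>e > 0\<close>])
    obtain j' :: nat where j': "T \<le> real j'" using real_arch_simple by blast
    from evJ[of "max 1 (max j j')"] show ?thesis
    proof eventually_elim
      case (elim n)
      then have "1 / real (Suc (J n)) \<le> 1 / real (Suc j)"
        by (intro divide_left_mono) auto
      moreover have "P n (J n)" using Jin[of n] elim by linarith
      moreover have "T \<le> real (J n)" using elim j' by linarith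
      ultimately show ?case using j by linarith
    qed
  qed
  have "uniform_limit {0..} l (\<lambda>s. s) sequentially"
    unfolding uniform_limit_iff
  proof (intro allI impI)
    fix e :: real assume "e > 0"
    from key[OF this, of 0] show "\<forall>\<^sub>F n in sequentially. \<forall>s\<in>{0..}. dist (l n s) s < e"
    proof eventually_elim
      case (elim n)
      then have "dist (l n s) s < e" if "s \<ge> 0" for s
        using l1[of n s] that unfolding dist_real_def by linarith
      then show ?case by simp
    qed
  qed
  moreover have "uniform_limit {0..T} (\<lambda>n s. X n (l n s)) x sequentially" for T
    unfolding uniform_limit_iff
  proof (intro allI impI)
    fix e :: real assume "e > 0"
    from key[OF this, of T] show "\<forall>\<^sub>F n in sequentially. \<forall>s\<in>{0..T}. dist (X n (l n s)) (x s) < e"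
    proof eventually_elim
      case (elim n)
      then have "dist (X n (l n s)) (x s) < e" if "s \<in> {0..T}" for s
        using l2[of n s] that unfolding dist_norm by simp
      then show ?case by simp
    qed
  qed
  moreover have "\<forall>\<^sub>F n in sequentially. X n \<in> cadlag_paths"
    by (rule eventually_mono[OF ev[OF zero_less_one, of 0]]) (simp add: J1_nbhd_def)
  ultimately show ?R using x l by blast
qed


section \<open>Partitions, approximations and quadratic variation\<close>

text \<open>
  The list \<open>\<pi> n\<close> enumerates the points \<open>0 = t\<^sub>0 < \<dots> < t\<^sub>k\<close> of the \<open>n\<close>-th partition; the sums over
  \<open>i < k\<close> below are sums over \<open>i < length (\<pi> n) - 1\<close>.
\<close>

definition partition_sequence :: "(nat \<Rightarrow> real list) \<Rightarrow> bool" where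
  "partition_sequence \<pi> \<longleftrightarrow>
     (\<forall>n. \<pi> n \<noteq> [] \<and> hd (\<pi> n) = 0 \<and> sorted_wrt (<) (\<pi> n))
     \<and> filterlim (\<lambda>n. last (\<pi> n)) at_top sequentially
     \<and> (\<forall>T. \<forall>e>0. \<forall>\<^sub>F n in sequentially. \<forall>i<length (\<pi> n) - 1.
            \<pi> n ! i \<le> T \<longrightarrow> \<pi> n ! Suc i - \<pi> n ! i < e)"

definition step_approx ::
    "(nat \<Rightarrow> real list) \<Rightarrow> nat \<Rightarrow> (real \<Rightarrow> 'a::real_normed_vector) \<Rightarrow> (real \<Rightarrow> 'a)" where
  "step_approx \<pi> n x = (\<lambda>s. \<Sum>i<length (\<pi> n) - 1.
     indicator {\<pi> n ! i..<\<pi> n ! Suc i} s *\<^sub>R x (\<pi> n ! Suc i))"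

text \<open>The interpolation is continued by a constant after the last partition point.\<close>

definition linear_interpolation ::
    "(nat \<Rightarrow> real list) \<Rightarrow> nat \<Rightarrow> (real \<Rightarrow> 'a::real_normed_vector) \<Rightarrow> (real \<Rightarrow> 'a)" where
  "linear_interpolation \<pi> n x = (\<lambda>s.
     (\<Sum>i<length (\<pi> n) - 1. indicator {\<pi> n ! i..<\<pi> n ! Suc i} s *\<^sub>R
        (x (\<pi> n ! i) + ((s - \<pi> n ! i) / (\<pi> n ! Suc i - \<pi> n ! i)) *\<^sub>R
           (x (\<pi> n ! Suc i) - x (\<pi> n ! i))))
     + indicator {last (\<pi> n)..} s *\<^sub>R x (last (\<pi> n)))"

definition qv_approx ::
    "(nat \<Rightarrow> real list) \<Rightarrow> nat \<Rightarrow> (real \<Rightarrow> real^'m) \<Rightarrow> (real \<Rightarrow> real^'m^'m)" where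
  "qv_approx \<pi> n x = (\<lambda>t. \<Sum>i | i < length (\<pi> n) - 1 \<and> \<pi> n ! i \<le> t.
     let v = x (\<pi> n ! Suc i) - x (\<pi> n ! i) in (columnvector v :: real^1^'m) ** (rowvector v :: real^'m^1))"

definition qv_paths :: "(nat \<Rightarrow> real list) \<Rightarrow> (real \<Rightarrow> real^'m) set" where
  "qv_paths \<pi> = {x \<in> cadlag_paths.
     \<exists>q. limitin J1_topology (\<lambda>n. qv_approx \<pi> n x) q sequentially}"

definition qv :: "(nat \<Rightarrow> real list) \<Rightarrow> (real \<Rightarrow> real^'m) \<Rightarrow> (real \<Rightarrow> real^'m^'m)" where
  "qv \<pi> x = (THE q. limitin J1_topology (\<lambda>n. qv_approx \<pi> n x) q sequentially)"

definition positive_semidefinite :: "real^'m^'m \<Rightarrow> bool" where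
  "positive_semidefinite A \<longleftrightarrow> transpose A = A \<and> (\<forall>v. 0 \<le> v \<bullet> (A *v v))"

text \<open>Strict monotonicity with respect to the Loewner order on symmetric matrices.\<close>

definition strictly_increasing :: "(real \<Rightarrow> real^'m^'m) \<Rightarrow> bool" where
  "strictly_increasing A \<longleftrightarrow>
     (\<forall>s t. 0 \<le> s \<and> s < t \<longrightarrow> positive_semidefinite (A t - A s) \<and> A s \<noteq> A t)"


section \<open>Generic sets of paths and continuity of functionals\<close>

definition generic_set :: "(nat \<Rightarrow> real list) \<Rightarrow> (real \<Rightarrow> real^'m) set \<Rightarrow> bool" where
  "generic_set \<pi> \<Omega> \<longleftrightarrow> \<Omega> \<noteq> {} \<and> \<Omega> \<subseteq> cadlag_paths
     \<and> (\<forall>x\<in>\<Omega>. \<forall>T>0. \<exists>N. \<forall>n\<ge>N. stop (step_approx \<pi> n x) T \<in> \<Omega>)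
     \<and> (\<forall>x\<in>\<Omega>. \<forall>t\<ge>0. \<exists>U. convex U \<and> 0 \<in> interior U \<and> - jump x t \<in> U
          \<and> (\<forall>e\<in>U. (\<lambda>s. stop x t s + indicator {t..} s *\<^sub>R e) \<in> \<Omega>))"

definition stopped_paths :: "(real \<Rightarrow> real^'m) set \<Rightarrow> (real \<times> (real \<Rightarrow> real^'m)) set" where
  "stopped_paths \<Omega> = {(t, stop x t) | t x. 0 \<le> t \<and> x \<in> \<Omega>}"

definition U_topology :: "(real \<Rightarrow> real^'m) set \<Rightarrow> (real \<times> (real \<Rightarrow> real^'m)) topology" where
  "U_topology \<Omega> =
     subtopology (prod_topology (top_of_set {0..}) local_uniform_topology) (stopped_paths \<Omega>)"

definition J_topology :: "(real \<Rightarrow> real^'m) set \<Rightarrow> (real \<times> (real \<Rightarrow> real^'m)) topology" where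
  "J_topology \<Omega> =
     subtopology (prod_topology (top_of_set {0..}) J1_topology) (stopped_paths \<Omega>)"

definition last_before :: "(nat \<Rightarrow> real list) \<Rightarrow> nat \<Rightarrow> real \<Rightarrow> real" where
  "last_before \<pi> n t =
     (if \<exists>s\<in>set (\<pi> n). s < t then Max {s \<in> set (\<pi> n). s < t} else 0)"

text \<open>
  Functionals on \<open>stopped_paths \<Omega>\<close> are represented by functions on the whole product type; only their
  values on \<open>stopped_paths \<Omega>\<close> matter below. In particular, for a generic \<open>\<Omega>\<close> and a convergent
  sequence \<open>\<tau>\<close> of times, the pairs \<open>(\<tau> n, stop (step_approx \<pi> n x) (\<tau> n))\<close> and
  \<open>(\<tau> n, stop_left (step_approx \<pi> n x) (\<tau> n))\<close> lie in \<open>stopped_paths \<Omega>\<close> for all large \<open>n\<close>. In the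
  limits over \<open>s \<le> t\<close> and \<open>s \<ge> t\<close> nothing is required at \<open>s = t\<close>, where the functional takes the
  limit value.
\<close>

definition pi_functionals ::
    "(nat \<Rightarrow> real list) \<Rightarrow> (real \<Rightarrow> real^'m) set \<Rightarrow> (real \<times> (real \<Rightarrow> real^'m) \<Rightarrow> real) set" where
  "pi_functionals \<pi> \<Omega> = {F. \<forall>x\<in>\<Omega>. \<forall>t\<ge>0.
     ((\<lambda>s. F (s, stop_left x s)) \<longlongrightarrow> F (t, stop_left x t)) (at t within {0..t})
   \<and> ((\<lambda>s. F (s, stop x s)) \<longlongrightarrow> F (t, stop_left x t)) (at t within {0..<t})
   \<and> (\<forall>\<tau>. (\<forall>n. 0 \<le> \<tau> n) \<and> \<tau> \<longlonglongrightarrow> t \<and> (\<forall>n. \<tau> n \<le> last_before \<pi> n t) \<longrightarrow>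
        (\<lambda>n. F (\<tau> n, stop_left (step_approx \<pi> n x) (\<tau> n))) \<longlonglongrightarrow> F (t, stop_left x t))
   \<and> (\<forall>\<tau>. (\<forall>n. 0 \<le> \<tau> n) \<and> \<tau> \<longlonglongrightarrow> t \<and> (\<forall>n. \<tau> n < last_before \<pi> n t) \<longrightarrow>
        (\<lambda>n. F (\<tau> n, stop (step_approx \<pi> n x) (\<tau> n))) \<longlonglongrightarrow> F (t, stop_left x t))
   \<and> ((\<lambda>s. F (s, stop x s)) \<longlongrightarrow> F (t, stop x t)) (at t within {t..})
   \<and> ((\<lambda>s. F (s, stop_left x s)) \<longlongrightarrow> F (t, stop x t)) (at t within {t<..})
   \<and> (\<forall>\<tau>. (\<forall>n. 0 \<le> \<tau> n) \<and> \<tau> \<longlonglongrightarrow> t \<and> (\<forall>n. \<tau> n \<ge> last_before \<pi> n t) \<longrightarrow>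
        (\<lambda>n. F (\<tau> n, stop (step_approx \<pi> n x) (\<tau> n))) \<longlonglongrightarrow> F (t, stop x t))
   \<and> (\<forall>\<tau>. (\<forall>n. 0 \<le> \<tau> n) \<and> \<tau> \<longlonglongrightarrow> t \<and> (\<forall>n. \<tau> n > last_before \<pi> n t) \<longrightarrow>
        (\<lambda>n. F (\<tau> n, stop_left (step_approx \<pi> n x) (\<tau> n))) \<longlonglongrightarrow> F (t, stop x t))}"

text \<open>The initial topology generated by \<open>pi_functionals \<pi> \<Omega>\<close>.\<close>

definition pi_topology ::
    "(nat \<Rightarrow> real list) \<Rightarrow> (real \<Rightarrow> real^'m) set \<Rightarrow> (real \<times> (real \<Rightarrow> real^'m)) topology" where
  "pi_topology \<pi> \<Omega> = topology_generated_by
     {F -` V \<inter> stopped_paths \<Omega> | F V. F \<in> pi_functionals \<pi> \<Omega> \<and> open V}"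

end

(*
  (i) A time change that sends t to the last partition point before t matches the step
  approximations of a path with the path itself, because on the image of [a, b) the step
  approximation only takes values of the path on [a, b). Hence all eight nets that define the
  pi-topology converge in J1.

  (ii) Continuity of [x] forces x to be continuous, and strict monotonicity forces x not to be
  affine on any interval. So x^(n) tends to x locally uniformly, while x^(n) differs from x and,
  being continuous and not constant, from every step path. Summing J1-continuous bumps around the
  x^(n), with radii so small that no bump meets x or a step approximation of x, gives a functional
  that vanishes along all nets approaching x but is at least 1 at each x^(n).

  (iii) The left limit at a fixed time is a U-continuous functional, but step approximations make
  the jumps of the path before the path does.
*)

theory Submission
  imports Defs
begin

section \<open>Partitions\<close>

text \<open>Each of the eight conditions says that a functional \<open>F\<close> tends to
  \<open>F p\<close> along one filter on pairs, so the argument runs over filters with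
  \<open>approaching G p\<close>. In (ii) the sum is harmless away from x, because only finitely
  many bumps reach points at distance at least a fixed positive constant from x. The delicate points
  are those agreeing with x on [0,2), and for them the two horizons 1 and 2 are needed. Since x is
  not constant on any interval [t,2), such a point has a stopping time of at least 2. A net
  approaching it therefore consists, on [0,1), of x itself or of step approximations of x, which
  read x only one mesh width ahead and so still before time 2. This is why the radii come from a
  separation on [0,1), where the truncation level 2 - s of the distance is at least 1. That level
  has to fall to 0 continuously, since a J1 time change also shifts the weight.\<close>

definition next_after :: "(nat \<Rightarrow> real list) \<Rightarrow> nat \<Rightarrow> real \<Rightarrow> real" where
  "next_after \<pi> n s = Min {p \<in> set (\<pi> n). s < p}"

locale partitions =
  fixes \<pi> :: "nat \<Rightarrow> real list"
  assumes part: "partition_sequence \<pi>"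
begin

lemma partition_nonempty: "\<pi> n \<noteq> []"
  using part by (simp add: partition_sequence_def)

lemma partition_nth_0: "\<pi> n ! 0 = 0"
  using part by (metis hd_conv_nth partition_nonempty partition_sequence_def)

lemma partition_nth_less: "i < j \<Longrightarrow> j < length (\<pi> n) \<Longrightarrow> \<pi> n ! i < \<pi> n ! j"
  using part by (auto simp: partition_sequence_def intro: sorted_wrt_nth_less)

lemma partition_nth_le: "i \<le> j \<Longrightarrow> j < length (\<pi> n) \<Longrightarrow> \<pi> n ! i \<le> \<pi> n ! j"
  using partition_nth_less[of i j n] by (cases "i = j") auto

lemma partition_last: "last (\<pi> n) = \<pi> n ! (length (\<pi> n) - 1)"
  using partition_nonempty by (rule last_conv_nth)

lemma partition_nth_le_last: "i < length (\<pi> n) \<Longrightarrow> \<pi> n ! i \<le> last (\<pi> n)"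
  using partition_nth_le[of i "length (\<pi> n) - 1" n] partition_last[of n] by simp

lemma zero_in_partition: "0 \<in> set (\<pi> n)"
  using partition_nth_0[of n] partition_nonempty[of n] by (metis length_greater_0_conv nth_mem)

lemma partition_nonneg: "p \<in> set (\<pi> n) \<Longrightarrow> 0 \<le> p"
  using partition_nth_le[of 0 _ n] partition_nth_0[of n] by (auto simp: in_set_conv_nth)

lemma partition_index:
  assumes "0 \<le> s" "s < last (\<pi> n)"
  obtains i where "Suc i < length (\<pi> n)" "\<pi> n ! i \<le> s" "s < \<pi> n ! Suc i"
proof -
  have "\<exists>k<length (\<pi> n) - 1. (\<forall>i\<le>k. \<not> s < \<pi> n ! i) \<and> s < \<pi> n ! Suc k"
    using assms partition_last[of n] partition_nth_0[of n]
    by (intro ex_least_nat_less) auto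
  then obtain k where "k < length (\<pi> n) - 1" "\<not> s < \<pi> n ! k" "s < \<pi> n ! Suc k"
    by blast
  then show ?thesis by (intro that[of k]) auto
qed

lemma partition_index_unique:
  assumes "Suc i < length (\<pi> n)" "\<pi> n ! i \<le> s" "s < \<pi> n ! Suc i"
    and "Suc j < length (\<pi> n)" "\<pi> n ! j \<le> s" "s < \<pi> n ! Suc j"
  shows "i = j"
proof (rule ccontr)
  assume "i \<noteq> j"
  then consider "Suc i \<le> j" | "Suc j \<le> i" by linarith
  then show False
    using assms partition_nth_le[of "Suc i" j n] partition_nth_le[of "Suc j" i n] by cases auto
qed

text \<open>The half-open cells are disjoint, so at most one indicator is nonzero. Both
  \<open>step_approx\<close> and \<open>linear_interpolation\<close> are evaluated in this
  way.\<close>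

lemma partition_sum:
  fixes f :: "nat \<Rightarrow> 'b::real_vector"
  assumes "Suc i < length (\<pi> n)" "\<pi> n ! i \<le> s" "s < \<pi> n ! Suc i"
  shows "(\<Sum>j<length (\<pi> n) - 1. indicator {\<pi> n ! j..<\<pi> n ! Suc j} s *\<^sub>R f j) = f i"
proof -
  have "(\<Sum>j<length (\<pi> n) - 1. indicator {\<pi> n ! j..<\<pi> n ! Suc j} s *\<^sub>R f j)
      = (\<Sum>j<length (\<pi> n) - 1. if j = i then f j else 0)"
  proof (rule sum.cong[OF refl])
    fix j assume "j \<in> {..<length (\<pi> n) - 1}"
    then have j: "Suc j < length (\<pi> n)" by auto
    show "indicator {\<pi> n ! j..<\<pi> n ! Suc j} s *\<^sub>R f j = (if j = i then f j else 0)"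
      using partition_index_unique[OF assms j] assms by (cases "j = i") (auto simp: indicator_def)
  qed
  also have "\<dots> = f i"
  proof -
    have "i < length (\<pi> n) - 1" using assms(1) by linarith
    then show ?thesis by simp
  qed
  finally show ?thesis .
qed

lemma next_after_nth:
  assumes "Suc i < length (\<pi> n)" "\<pi> n ! i \<le> s" "s < \<pi> n ! Suc i"
  shows "next_after \<pi> n s = \<pi> n ! Suc i"
  unfolding next_after_def
proof (rule Min_eqI)
  fix p assume "p \<in> {p \<in> set (\<pi> n). s < p}"
  then obtain j where j: "j < length (\<pi> n)" "p = \<pi> n ! j" "s < p"
    by (auto simp: in_set_conv_nth)
  then have "\<not> j \<le> i" using partition_nth_le[of j i n] assms by force
  then show "\<pi> n ! Suc i \<le> p" using j partition_nth_le[of "Suc i" j n] by auto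
qed (use assms in auto)

lemma step_approx_eq:
  assumes "0 \<le> s" "s < last (\<pi> n)"
  shows "step_approx \<pi> n x s = x (next_after \<pi> n s)"
proof -
  obtain i where i: "Suc i < length (\<pi> n)" "\<pi> n ! i \<le> s" "s < \<pi> n ! Suc i"
    using partition_index[OF assms] .
  then show ?thesis
    unfolding step_approx_def next_after_nth[OF i] by (rule partition_sum)
qed

lemma finite_range_step_approx: "finite (range (step_approx \<pi> n x))"
proof -
  \<comment> \<open>The extra value 0 accounts for times before 0 or from the last partition point
    on, where all indicators vanish.\<close>
  have "step_approx \<pi> n x s \<in> insert 0 (x ` set (\<pi> n))" for s
  proof (cases "0 \<le> s \<and> s < last (\<pi> n)")
    case True
    then obtain i where i: "Suc i < length (\<pi> n)" "\<pi> n ! i \<le> s" "s < \<pi> n ! Suc i"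
      using partition_index by blast
    then have "step_approx \<pi> n x s = x (\<pi> n ! Suc i)"
      unfolding step_approx_def by (rule partition_sum)
    then show ?thesis using i(1) by auto
  next
    case False
    have "indicator {\<pi> n ! i..<\<pi> n ! Suc i} s = (0::real)" if "i < length (\<pi> n) - 1" for i
    proof -
      have "0 \<le> \<pi> n ! i" using that partition_nth_le[of 0 i n] partition_nth_0[of n] by simp
      moreover have "\<pi> n ! Suc i \<le> last (\<pi> n)"
        using that by (intro partition_nth_le_last) simp
      ultimately show ?thesis using False by (auto simp: indicator_def)
    qed
    then show ?thesis unfolding step_approx_def by simp
  qed
  then have "range (step_approx \<pi> n x) \<subseteq> insert 0 (x ` set (\<pi> n))" by blast
  then show ?thesis by (rule finite_subset) simp
qed

lemma next_after_in:
  assumes "s < last (\<pi> n)"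
  shows "next_after \<pi> n s \<in> set (\<pi> n)" "s < next_after \<pi> n s"
proof -
  have "next_after \<pi> n s \<in> {p \<in> set (\<pi> n). s < p}"
    unfolding next_after_def using assms last_in_set[OF partition_nonempty[of n]]
    by (intro Min_in) auto
  then show "next_after \<pi> n s \<in> set (\<pi> n)" "s < next_after \<pi> n s" by auto
qed

lemma next_after_le: "p \<in> set (\<pi> n) \<Longrightarrow> s < p \<Longrightarrow> next_after \<pi> n s \<le> p"
  unfolding next_after_def by simp

text \<open>No partition point lies strictly before 0, so the default value applies. Hence
  nonnegative times bounded by \<open>last_before \<pi> n 0\<close> are all 0, which settles the
  left-hand nets at time 0.\<close>

lemma last_before_0: "last_before \<pi> n 0 = 0"
  using partition_nonneg[of _ n] by (fastforce simp: last_before_def)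

lemma last_before_in:
  assumes "0 < t"
  shows "last_before \<pi> n t \<in> set (\<pi> n)" "last_before \<pi> n t < t"
proof -
  have "last_before \<pi> n t = Max {s \<in> set (\<pi> n). s < t}"
    using assms zero_in_partition[of n] by (auto simp: last_before_def)
  moreover have "Max {s \<in> set (\<pi> n). s < t} \<in> {s \<in> set (\<pi> n). s < t}"
    using assms zero_in_partition[of n] by (intro Max_in) auto
  ultimately show "last_before \<pi> n t \<in> set (\<pi> n)" "last_before \<pi> n t < t" by auto
qed

lemma last_before_nonneg: "0 \<le> last_before \<pi> n t"
proof (cases "0 < t")
  case True
  then show ?thesis using last_before_in(1)[of t n] partition_nonneg[of _ n] by blast
next
  case False
  then have "\<not> (\<exists>s\<in>set (\<pi> n). s < t)" using partition_nonneg[of _ n] by fastforce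
  then show ?thesis by (simp add: last_before_def)
qed

lemma last_before_le: "0 \<le> t \<Longrightarrow> last_before \<pi> n t \<le> t"
  using last_before_in(2)[of t n] last_before_0[of n] by (cases "t = 0") auto

lemma last_before_greatest:
  assumes "0 \<le> t" "p \<in> set (\<pi> n)" "p < t"
  shows "p \<le> last_before \<pi> n t"
  using assms by (auto simp: last_before_def)

text \<open>There is no partition point strictly between \<open>last_before \<pi> n t\<close> and
  \<open>t\<close>. This is why a step approximation reads x only from time \<open>t\<close> on as
  soon as \<open>last_before \<pi> n t\<close> is reached.\<close>

lemma last_before_less_imp: "0 \<le> t \<Longrightarrow> p \<in> set (\<pi> n) \<Longrightarrow> last_before \<pi> n t < p \<Longrightarrow> t \<le> p"
  using last_before_greatest[of t p n] by linarith

lemma eventually_next_after: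
  assumes "0 < e"
  shows "\<forall>\<^sub>F n in sequentially. T < last (\<pi> n) \<and> (\<forall>s\<in>{0..T}. next_after \<pi> n s < s + e)"
proof -
  have "\<forall>\<^sub>F n in sequentially. T < last (\<pi> n)"
    using part unfolding partition_sequence_def filterlim_at_top_dense by blast
  moreover have "\<forall>\<^sub>F n in sequentially. \<forall>i<length (\<pi> n) - 1.
      \<pi> n ! i \<le> T \<longrightarrow> \<pi> n ! Suc i - \<pi> n ! i < e"
    using part assms unfolding partition_sequence_def by blast
  ultimately show ?thesis
  proof eventually_elim
    case (elim n)
    have "next_after \<pi> n s < s + e" if "s \<in> {0..T}" for s
    proof -
      from that elim have "0 \<le> s" "s < last (\<pi> n)" by auto
      then obtain i where i: "Suc i < length (\<pi> n)" "\<pi> n ! i \<le> s" "s < \<pi> n ! Suc i"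
        by (rule partition_index)
      with elim that have "\<pi> n ! Suc i - \<pi> n ! i < e" by auto
      then show ?thesis using next_after_nth[OF i] i by linarith
    qed
    with elim show ?case by blast
  qed
qed

text \<open>The partition point following \<open>last_before \<pi> n t\<close> is at least
  \<open>t\<close>, so the gap to \<open>t\<close> is at most one mesh width.\<close>

lemma eventually_last_before:
  assumes "0 < e"
  shows "\<forall>\<^sub>F n in sequentially. T < last (\<pi> n) \<and> (\<forall>t\<in>{0..T}. t - e < last_before \<pi> n t)"
  using eventually_next_after[OF assms, of T]
proof eventually_elim
  case (elim n)
  have "t - e < last_before \<pi> n t" if "t \<in> {0..T}" for t
  proof -
    have b: "0 \<le> last_before \<pi> n t" "last_before \<pi> n t \<le> t"
      using that last_before_nonneg last_before_le by auto
    then have "next_after \<pi> n (last_before \<pi> n t) < last_before \<pi> n t + e"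
      using elim that by auto
    moreover have "t \<le> next_after \<pi> n (last_before \<pi> n t)"
      using b that elim next_after_in[of "last_before \<pi> n t" n]
      by (intro last_before_less_imp[of t _ n]) auto
    ultimately show ?thesis by linarith
  qed
  with elim show ?case by blast
qed

lemma last_before_tendsto: "0 \<le> t \<Longrightarrow> (\<lambda>n. last_before \<pi> n t) \<longlonglongrightarrow> t"
  unfolding LIMSEQ_def
proof (intro allI impI)
  fix e :: real assume t: "0 \<le> t" and "0 < e"
  from eventually_last_before[OF \<open>0 < e\<close>, of t]
  have "\<forall>\<^sub>F n in sequentially. dist (last_before \<pi> n t) t < e"
  proof eventually_elim
    case (elim n)
    then have "t - e < last_before \<pi> n t" using t by auto
    then show ?case using last_before_le[OF t, of n] by (auto simp: dist_real_def)
  qed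
  then show "\<exists>no. \<forall>n\<ge>no. dist (last_before \<pi> n t) t < e"
    by (simp add: eventually_sequentially)
qed

lemma next_after_tendsto:
  assumes "\<And>n. 0 \<le> \<tau> n" "\<tau> \<longlonglongrightarrow> t"
  shows "(\<lambda>n. next_after \<pi> n (\<tau> n)) \<longlonglongrightarrow> t"
  unfolding tendsto_iff
proof (intro allI impI)
  fix e :: real assume "0 < e"
  then have "0 < e / 2" by simp
  have "\<forall>\<^sub>F n in sequentially. dist (\<tau> n) t < min 1 (e / 2)"
    using assms(2) \<open>0 < e / 2\<close> unfolding tendsto_iff by (metis min_less_iff_conj zero_less_one)
  with eventually_next_after[OF \<open>0 < e / 2\<close>, of "t + 1"]
  show "\<forall>\<^sub>F n in sequentially. dist (next_after \<pi> n (\<tau> n)) t < e"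
  proof eventually_elim
    case (elim n)
    then have "\<tau> n \<in> {0..t + 1}" using assms(1)[of n] by (auto simp: dist_real_def)
    then have "next_after \<pi> n (\<tau> n) < \<tau> n + e / 2" "\<tau> n < next_after \<pi> n (\<tau> n)"
      using elim next_after_in[of "\<tau> n" n] by auto
    then show ?case using elim unfolding dist_real_def min_less_iff_conj by linarith
  qed
qed

end

section \<open>Stopped paths and one-sided limits\<close>

text \<open>A common form for \<open>stop\<close>, \<open>stop_left\<close> and the paths with an
  appended jump in \<open>generic_set\<close>: they differ only in the value \<open>c\<close>, so
  each convergence proof covers stopping at a time and stopping just before it.\<close>

definition freeze :: "(real \<Rightarrow> 'a) \<Rightarrow> real \<Rightarrow> 'a \<Rightarrow> (real \<Rightarrow> 'a)" where
  "freeze x t c = (\<lambda>s. if s < t then x s else c)"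

lemma stop_eq_freeze: "stop x t = freeze x t (x t)"
  by (auto simp: stop_def freeze_def min_def)

lemma stop_left_eq_freeze: "stop_left x t = freeze x t (left_lim x t)"
  by (simp add: stop_left_def freeze_def)

lemma left_lim_0: "left_lim x 0 = x 0"
  by (simp add: left_lim_def)

lemma stop_left_0: "stop_left x 0 = stop x 0"
  by (simp add: stop_left_eq_freeze stop_eq_freeze left_lim_0)

lemma left_lim_eqI:
  assumes "(x \<longlongrightarrow> l) (at_left t)" "t \<noteq> 0"
  shows "left_lim x t = l"
  using assms tendsto_Lim[OF trivial_limit_at_left_real assms(1)] by (simp add: left_lim_def)

lemma left_lim_tendsto:
  assumes "x \<in> cadlag_paths" "0 < t"
  shows "(x \<longlongrightarrow> left_lim x t) (at_left t)"
proof -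
  obtain l where "(x \<longlongrightarrow> l) (at_left t)"
    using assms unfolding cadlag_paths_def by blast
  then show ?thesis using left_lim_eqI[of x l t] assms(2) by simp
qed

lemma left_lim_cong:
  assumes "\<And>s. 0 \<le> s \<Longrightarrow> s < t \<Longrightarrow> x s = y s" "0 \<le> t" "x 0 = y 0"
  shows "left_lim x t = left_lim y t"
proof (cases "t = 0")
  case False
  then have "eventually (\<lambda>s. s \<in> {0<..<t}) (at_left t)"
    using assms(2) by (intro eventually_at_left_real) auto
  then have "eventually (\<lambda>s. x s = y s) (at_left t)"
    by eventually_elim (use assms(1) in auto)
  then have "Lim (at_left t) x = Lim (at_left t) y" by (intro Lim_cong) auto
  then show ?thesis using False by (simp add: left_lim_def)
qed (simp add: left_lim_0 assms)

lemma left_lim_freeze: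
  assumes "0 < s" "s \<le> t"
  shows "left_lim (freeze x t c) s = left_lim x s"
  using assms by (intro left_lim_cong) (auto simp: freeze_def)

lemma cadlag_right:
  assumes "x \<in> cadlag_paths" "0 \<le> t" "0 < e"
  obtains d where "0 < d" "\<And>r. t \<le> r \<Longrightarrow> r < t + d \<Longrightarrow> norm (x r - x t) < e"
proof -
  have "(x \<longlongrightarrow> x t) (at_right t)"
    using assms unfolding cadlag_paths_def by (auto simp: continuous_within)
  then have "\<forall>\<^sub>F r in at_right t. dist (x r) (x t) < e"
    using assms(3) unfolding tendsto_iff by blast
  then obtain b where "b > t" "\<And>r. t < r \<Longrightarrow> r < b \<Longrightarrow> dist (x r) (x t) < e"
    using eventually_at_right[of t "t + 1"] by auto
  then show ?thesis
    using assms(3) by (intro that[of "b - t"]) (auto simp: dist_norm le_less)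
qed

lemma cadlag_left:
  assumes "x \<in> cadlag_paths" "0 < t" "0 < e"
  obtains d where "0 < d" "d \<le> t" "\<And>r. t - d < r \<Longrightarrow> r < t \<Longrightarrow> norm (x r - left_lim x t) < e"
proof -
  have "\<forall>\<^sub>F r in at_left t. dist (x r) (left_lim x t) < e"
    using left_lim_tendsto[OF assms(1,2)] assms(3) unfolding tendsto_iff by blast
  then obtain b where "b < t" "\<And>r. b < r \<Longrightarrow> r < t \<Longrightarrow> dist (x r) (left_lim x t) < e"
    using eventually_at_left[of "t - 1" t] by auto
  then show ?thesis
    using assms(2) by (intro that[of "min t (t - b)"]) (auto simp: dist_norm)
qed

lemma cadlag_tendsto_right:
  assumes "x \<in> cadlag_paths" "0 \<le> t" "(v \<longlongrightarrow> t) G" "\<forall>\<^sub>F n in G. t \<le> v n"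
  shows "((\<lambda>n. x (v n)) \<longlongrightarrow> x t) G"
  unfolding tendsto_iff
proof (intro allI impI)
  fix e :: real assume "0 < e"
  with assms obtain d where d: "0 < d" "\<And>r. t \<le> r \<Longrightarrow> r < t + d \<Longrightarrow> norm (x r - x t) < e"
    using cadlag_right by blast
  have "\<forall>\<^sub>F n in G. dist (v n) t < d" using assms(3) d(1) unfolding tendsto_iff by blast
  with assms(4) show "\<forall>\<^sub>F n in G. dist (x (v n)) (x t) < e"
    by eventually_elim (use d(2) in \<open>auto simp: dist_norm\<close>)
qed

lemma cadlag_tendsto_left:
  assumes "x \<in> cadlag_paths" "0 < t" "(v \<longlongrightarrow> t) G" "\<forall>\<^sub>F n in G. v n < t"
  shows "((\<lambda>n. x (v n)) \<longlongrightarrow> left_lim x t) G"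
  unfolding tendsto_iff
proof (intro allI impI)
  fix e :: real assume "0 < e"
  with assms obtain d where d: "0 < d"
      "\<And>r. t - d < r \<Longrightarrow> r < t \<Longrightarrow> norm (x r - left_lim x t) < e"
    using cadlag_left by metis
  have "\<forall>\<^sub>F n in G. dist (v n) t < d" using assms(3) d(1) unfolding tendsto_iff by blast
  with assms(4) show "\<forall>\<^sub>F n in G. dist (x (v n)) (left_lim x t) < e"
    by eventually_elim (use d(2) in \<open>auto simp: dist_norm\<close>)
qed

text \<open>Only a non-strict bound survives the passage to a left limit; the next two lemmas apply
  this with \<open>e / 2\<close> to regain a strict one.\<close>

lemma left_lim_near:
  assumes "x \<in> cadlag_paths" "0 < t" "a < t" "\<And>r. a < r \<Longrightarrow> r < t \<Longrightarrow> 0 \<le> r \<Longrightarrow> norm (x r - c) \<le> e"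
  shows "norm (left_lim x t - c) \<le> e"
proof (rule tendsto_upperbound)
  show "((\<lambda>r. norm (x r - c)) \<longlongrightarrow> norm (left_lim x t - c)) (at_left t)"
    by (intro tendsto_intros left_lim_tendsto assms)
  have "eventually (\<lambda>r. r \<in> {max 0 a<..<t}) (at_left t)"
    using assms(2,3) by (intro eventually_at_left_real) auto
  then show "\<forall>\<^sub>F r in at_left t. norm (x r - c) \<le> e"
    by eventually_elim (use assms(4) in auto)
qed simp

text \<open>For \<open>t < v n\<close> the left limit at \<open>v n\<close> is formed by values at
  times in (t, v n), where right continuity at \<open>t\<close> applies. At \<open>v n = t\<close>
  it would be the left limit at \<open>t\<close> instead.\<close>

lemma left_lim_tendsto_right:
  assumes x: "x \<in> cadlag_paths" and "0 \<le> t" "(v \<longlongrightarrow> t) G" "\<forall>\<^sub>F n in G. t < v n"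
  shows "((\<lambda>n. left_lim x (v n)) \<longlongrightarrow> x t) G"
  unfolding tendsto_iff
proof (intro allI impI)
  fix e :: real assume "0 < e"
  then have "0 < e / 2" by simp
  with assms obtain d where d: "0 < d" "\<And>r. t \<le> r \<Longrightarrow> r < t + d \<Longrightarrow> norm (x r - x t) < e / 2"
    using cadlag_right by blast
  have "\<forall>\<^sub>F n in G. dist (v n) t < d" using assms(3) d(1) unfolding tendsto_iff by blast
  with assms(4) show "\<forall>\<^sub>F n in G. dist (left_lim x (v n)) (x t) < e"
  proof eventually_elim
    case (elim n)
    have "norm (left_lim x (v n) - x t) \<le> e / 2"
    proof (rule left_lim_near[OF x _ elim(1)])
      show "0 < v n" using elim(1) assms(2) by linarith
      fix r assume "t < r" "r < v n"
      then show "norm (x r - x t) \<le> e / 2"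
        using d(2)[of r] elim by (auto simp: dist_real_def)
    qed
    then show ?case using \<open>0 < e\<close> by (simp add: dist_norm)
  qed
qed

lemma left_lim_tendsto_left:
  assumes x: "x \<in> cadlag_paths" and "0 < t" "(v \<longlongrightarrow> t) G" "\<forall>\<^sub>F n in G. v n \<le> t"
  shows "((\<lambda>n. left_lim x (v n)) \<longlongrightarrow> left_lim x t) G"
  unfolding tendsto_iff
proof (intro allI impI)
  fix e :: real assume "0 < e"
  then have "0 < e / 2" by simp
  with assms obtain d where d: "0 < d" "d \<le> t"
      "\<And>r. t - d < r \<Longrightarrow> r < t \<Longrightarrow> norm (x r - left_lim x t) < e / 2"
    using cadlag_left by metis
  have "\<forall>\<^sub>F n in G. dist (v n) t < d" using assms(3) d(1) unfolding tendsto_iff by blast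
  with assms(4) show "\<forall>\<^sub>F n in G. dist (left_lim x (v n)) (left_lim x t) < e"
  proof eventually_elim
    case (elim n)
    have "norm (left_lim x (v n) - left_lim x t) \<le> e / 2"
    proof (rule left_lim_near[OF x, where a = "t - d"])
      show "0 < v n" "t - d < v n" using elim d(2) by (auto simp: dist_real_def)
      fix r assume "t - d < r" "r < v n"
      then show "norm (x r - left_lim x t) \<le> e / 2"
        using d(3)[of r] elim by auto
    qed
    then show ?case using \<open>0 < e\<close> by (simp add: dist_norm)
  qed
qed


section \<open>Skorokhod convergence of the approximations\<close>

lemma time_change_0: "time_change l \<Longrightarrow> l 0 = 0"
  unfolding time_change_def
proof safe
  assume mono: "strict_mono_on {0..} l" and im: "l ` {0..} = {0..}"
  obtain s where "0 \<le> s" "l s = 0" using im by (metis atLeast_iff imageE order_refl)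
  moreover have "l 0 \<in> {0..}" using im by auto
  ultimately show "l 0 = 0"
    using strict_mono_onD[OF mono, of 0 s] by (cases "s = 0") auto
qed

lemma time_change_id: "time_change (\<lambda>s. s)"
  by (auto simp: time_change_def strict_mono_on_def)

lemma time_change_less: "time_change l \<Longrightarrow> 0 \<le> s \<Longrightarrow> s < t \<Longrightarrow> l s < l t"
  unfolding time_change_def by (auto intro: strict_mono_onD)

lemma time_change_le: "time_change l \<Longrightarrow> 0 \<le> s \<Longrightarrow> s \<le> t \<Longrightarrow> l s \<le> l t"
  using time_change_less[of l s t] by (cases "s = t") auto

lemma time_change_nonneg: "time_change l \<Longrightarrow> 0 \<le> s \<Longrightarrow> 0 \<le> l s"
  using time_change_le[of l 0 s] time_change_0[of l] by simp

lemma time_change_surj: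
  assumes "time_change l" "0 \<le> u"
  obtains s where "0 \<le> s" "l s = u"
  using assms unfolding time_change_def by (metis atLeast_iff imageE)

text \<open>The gluing step from which time changes are built interval by interval; the slope 1 is
  used for the final, unbounded piece.\<close>

lemma time_change_append_affine:
  assumes l: "time_change l" and b: "0 \<le> b" and c: "0 < c"
  shows "time_change (\<lambda>s. if s \<le> b then l s else l b + c * (s - b))" (is "time_change ?m")
  unfolding time_change_def
proof (intro conjI)
  have "continuous_on ({0..b} \<union> {b..}) ?m"
  proof (rule continuous_on_If)
    show "continuous_on {0..b} l"
      using l unfolding time_change_def by (auto intro: continuous_on_subset)
    show "continuous_on {b..} (\<lambda>s. l b + c * (s - b))" by (intro continuous_intros)
  qed auto
  moreover have "{0..b} \<union> {b..} = {0..}" using b by auto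
  ultimately show "continuous_on {0..} ?m" by simp
  show "strict_mono_on {0..} ?m"
  proof (rule strict_mono_onI)
    fix r s :: real assume *: "r \<in> {0..}" "s \<in> {0..}" "r < s"
    show "?m r < ?m s"
    proof (cases "r \<le> b \<and> \<not> s \<le> b")
      case True
      then have "l r \<le> l b" "0 < c * (s - b)" using * l c by (auto intro: time_change_le)
      with True show ?thesis by auto
    next
      case False
      with * c show ?thesis by (auto intro: time_change_less[OF l])
    qed
  qed
  show "?m ` {0..} = {0..}"
  proof (intro equalityI subsetI)
    fix v assume "v \<in> ?m ` {0..}"
    then obtain s where "0 \<le> s" "v = ?m s" by auto
    then show "v \<in> {0..}"
      using time_change_nonneg[OF l, of s] time_change_nonneg[OF l b] c by auto
  next
    fix v :: real assume "v \<in> {0..}"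
    show "v \<in> ?m ` {0..}"
    proof (cases "v \<le> l b")
      case True
      obtain s where s: "0 \<le> s" "l s = v" using time_change_surj[OF l] \<open>v \<in> {0..}\<close> by auto
      then have "s \<le> b" using True time_change_less[OF l b, of s] by force
      with s show ?thesis by (intro image_eqI[of _ _ s]) auto
    next
      case False
      \<comment> \<open>The preimage of \<open>v\<close> under the affine piece.\<close>
      then have "b + (v - l b) / c > b" using c by simp
      then show ?thesis using b c by (intro image_eqI[of _ _ "b + (v - l b) / c"]) auto
    qed
  qed
qed

lemma J1_nbhdI:
  assumes "y \<in> cadlag_paths" "time_change l" "d < e"
    and "\<And>s. 0 \<le> s \<Longrightarrow> \<bar>l s - s\<bar> \<le> d" "\<And>s. 0 \<le> s \<Longrightarrow> norm (y (l s) - x s) \<le> d"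
  shows "y \<in> J1_nbhd x T e"
  using assms unfolding J1_nbhd_def by (intro CollectI conjI exI[of _ l] exI[of _ d]) auto

lemma J1_nbhd_uniformI:
  assumes "y \<in> cadlag_paths" "0 < e" "\<And>s. 0 \<le> s \<Longrightarrow> norm (y s - x s) \<le> e / 2"
  shows "y \<in> J1_nbhd x T e"
  using assms by (intro J1_nbhdI[OF _ time_change_id, where d = "e / 2"]) auto

text \<open>The identity serves as time change. The two paths differ only from
  \<open>\<tau> i\<close> on, where both are near \<open>left_lim x t\<close>: on [\<tau> i, t) the
  values of x and the constant \<open>c i\<close> are each within e/4 of it.\<close>

lemma limitin_J1_freeze_left:
  assumes x: "x \<in> cadlag_paths" and "0 < t" and \<tau>: "(\<tau> \<longlongrightarrow> t) G" "\<forall>\<^sub>F i in G. \<tau> i \<le> t"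
    and c: "(c \<longlongrightarrow> left_lim x t) G"
    and "stop_left x t \<in> cadlag_paths" "\<forall>\<^sub>F i in G. freeze x (\<tau> i) (c i) \<in> cadlag_paths"
  shows "limitin J1_topology (\<lambda>i. freeze x (\<tau> i) (c i)) (stop_left x t) G"
  unfolding limitin_J1_nbhd
proof (intro conjI allI impI)
  fix T e :: real assume e: "0 < e"
  then have "0 < e / 4" by simp
  obtain d where d: "0 < d" "\<And>r. t - d < r \<Longrightarrow> r < t \<Longrightarrow> norm (x r - left_lim x t) < e / 4"
    using cadlag_left[OF x \<open>0 < t\<close> \<open>0 < e / 4\<close>] by metis
  have "\<forall>\<^sub>F i in G. dist (\<tau> i) t < d" using \<tau>(1) d(1) unfolding tendsto_iff by blast
  moreover have "\<forall>\<^sub>F i in G. dist (c i) (left_lim x t) < e / 4"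
    using c \<open>0 < e / 4\<close> unfolding tendsto_iff by blast
  ultimately show "\<forall>\<^sub>F i in G. freeze x (\<tau> i) (c i) \<in> J1_nbhd (stop_left x t) T e"
    using assms(4,7)
  proof eventually_elim
    case (elim i)
    show ?case
    proof (rule J1_nbhd_uniformI[OF elim(4) e])
      fix s :: real
      consider "s < \<tau> i" | "\<tau> i \<le> s" "s < t" | "t \<le> s" by linarith
      then show "norm (freeze x (\<tau> i) (c i) s - stop_left x t s) \<le> e / 2"
      proof cases
        case 2
        then have "norm (x s - left_lim x t) < e / 4"
          using d(2)[of s] elim by (auto simp: dist_real_def)
        then have "norm (c i - x s) \<le> e / 2"
          using elim(2) norm_triangle_ineq4[of "c i - left_lim x t" "x s - left_lim x t"]
          by (simp add: dist_norm)
        with 2 show ?thesis by (simp add: freeze_def stop_left_eq_freeze)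
      qed (use elim e in \<open>auto simp: freeze_def stop_left_eq_freeze dist_norm\<close>)
    qed
  qed
qed (use assms in auto)

lemma limitin_J1_freeze_right:
  assumes x: "x \<in> cadlag_paths" and "0 \<le> t" and \<tau>: "(\<tau> \<longlongrightarrow> t) G" "\<forall>\<^sub>F i in G. t \<le> \<tau> i"
    and c: "(c \<longlongrightarrow> x t) G"
    and "stop x t \<in> cadlag_paths" "\<forall>\<^sub>F i in G. freeze x (\<tau> i) (c i) \<in> cadlag_paths"
  shows "limitin J1_topology (\<lambda>i. freeze x (\<tau> i) (c i)) (stop x t) G"
  unfolding limitin_J1_nbhd
proof (intro conjI allI impI)
  fix T e :: real assume e: "0 < e"
  then have "0 < e / 2" by simp
  obtain d where d: "0 < d" "\<And>r. t \<le> r \<Longrightarrow> r < t + d \<Longrightarrow> norm (x r - x t) < e / 2"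
    using cadlag_right[OF x \<open>0 \<le> t\<close> \<open>0 < e / 2\<close>] by metis
  have "\<forall>\<^sub>F i in G. dist (\<tau> i) t < d" using \<tau>(1) d(1) unfolding tendsto_iff by blast
  moreover have "\<forall>\<^sub>F i in G. dist (c i) (x t) < e / 2"
    using c \<open>0 < e / 2\<close> unfolding tendsto_iff by blast
  ultimately show "\<forall>\<^sub>F i in G. freeze x (\<tau> i) (c i) \<in> J1_nbhd (stop x t) T e"
    using assms(4,7)
  proof eventually_elim
    case (elim i)
    show ?case
    proof (rule J1_nbhd_uniformI[OF elim(4) e])
      fix s :: real
      consider "s < t" | "t \<le> s" "s < \<tau> i" | "\<tau> i \<le> s" by linarith
      then show "norm (freeze x (\<tau> i) (c i) s - stop x t s) \<le> e / 2"
      proof cases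
        case 2
        then have "norm (x s - x t) < e / 2"
          using d(2)[of s] elim by (auto simp: dist_real_def)
        with 2 show ?thesis by (simp add: freeze_def stop_eq_freeze)
      qed (use elim e in \<open>auto simp: freeze_def stop_eq_freeze dist_norm\<close>)
    qed
  qed
qed (use assms in auto)

section \<open>One-sided limits and matching time changes for step approximations\<close>

context partitions
begin

text \<open>The approximation at \<open>\<tau> n\<close> is the value of x at the next partition
  point. Since \<open>\<tau> n\<close> is not before \<open>last_before \<pi> n t\<close>, that
  point is at least \<open>t\<close>, and right continuity applies.\<close>

lemma step_approx_tendsto_right:
  assumes "x \<in> cadlag_paths" "0 \<le> t" "\<tau> \<longlonglongrightarrow> t" "\<And>n. 0 \<le> \<tau> n" "\<And>n. last_before \<pi> n t \<le> \<tau> n"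
  shows "(\<lambda>n. step_approx \<pi> n x (\<tau> n)) \<longlonglongrightarrow> x t"
proof -
  have ev: "\<forall>\<^sub>F n in sequentially. \<tau> n < last (\<pi> n)"
  proof -
    have "\<forall>\<^sub>F n in sequentially. \<tau> n < t + 1" using assms(3) by (rule order_tendstoD) simp
    with eventually_next_after[OF zero_less_one, of "t + 1"] show ?thesis
      by eventually_elim auto
  qed
  have "(\<lambda>n. x (next_after \<pi> n (\<tau> n))) \<longlonglongrightarrow> x t"
  proof (rule cadlag_tendsto_right[OF assms(1,2) next_after_tendsto[OF assms(4,3)]])
    show "\<forall>\<^sub>F n in sequentially. t \<le> next_after \<pi> n (\<tau> n)"
      using ev
    proof eventually_elim
      case (elim n)
      then show ?case
        using next_after_in[OF elim] assms(5)[of n] by (intro last_before_less_imp[OF assms(2)]) auto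
    qed
  qed
  then show ?thesis
  proof (rule Lim_transform_eventually)
    show "\<forall>\<^sub>F n in sequentially. x (next_after \<pi> n (\<tau> n)) = step_approx \<pi> n x (\<tau> n)"
      using ev by eventually_elim (simp add: step_approx_eq assms(4))
  qed
qed

lemma step_approx_tendsto:
  assumes "x \<in> cadlag_paths" "0 \<le> t"
  shows "(\<lambda>n. step_approx \<pi> n x t) \<longlonglongrightarrow> x t"
  using assms by (intro step_approx_tendsto_right) (auto simp: last_before_le)

text \<open>Here the next partition point is at most \<open>last_before \<pi> n t\<close>, hence
  strictly before \<open>t\<close>, so x is read only on the left of \<open>t\<close>.\<close>

lemma step_approx_tendsto_left:
  assumes "x \<in> cadlag_paths" "0 < t" "\<tau> \<longlonglongrightarrow> t" "\<And>n. 0 \<le> \<tau> n" "\<And>n. \<tau> n < last_before \<pi> n t"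
  shows "(\<lambda>n. step_approx \<pi> n x (\<tau> n)) \<longlonglongrightarrow> left_lim x t"
proof -
  have ev: "\<forall>\<^sub>F n in sequentially. \<tau> n < last (\<pi> n)"
  proof -
    have "\<forall>\<^sub>F n in sequentially. \<tau> n < t + 1" using assms(3) by (rule order_tendstoD) simp
    with eventually_next_after[OF zero_less_one, of "t + 1"] show ?thesis
      by eventually_elim auto
  qed
  have "(\<lambda>n. x (next_after \<pi> n (\<tau> n))) \<longlonglongrightarrow> left_lim x t"
  proof (rule cadlag_tendsto_left[OF assms(1,2) next_after_tendsto[OF assms(4,3)]])
    show "\<forall>\<^sub>F n in sequentially. next_after \<pi> n (\<tau> n) < t"
      using next_after_le[OF last_before_in(1)[OF assms(2)] assms(5)] last_before_in(2)[OF assms(2)]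
      by (intro always_eventually allI) (rule le_less_trans)
  qed
  then show ?thesis
  proof (rule Lim_transform_eventually)
    show "\<forall>\<^sub>F n in sequentially. x (next_after \<pi> n (\<tau> n)) = step_approx \<pi> n x (\<tau> n)"
      using ev by eventually_elim (simp add: step_approx_eq assms(4))
  qed
qed

text \<open>Just before \<open>\<tau>\<close> the approximation is constant, with the value of x at
  the first partition point that is at least \<open>\<tau>\<close>. That point is
  \<open>next_after\<close> of \<open>last_before\<close>, whereas
  \<open>next_after \<pi> n \<tau>\<close> would skip \<open>\<tau>\<close> if it is itself a
  partition point.\<close>

lemma left_lim_step_approx:
  assumes "0 < \<tau>" "\<tau> \<le> last (\<pi> n)"
  shows "left_lim (step_approx \<pi> n x) \<tau> = x (next_after \<pi> n (last_before \<pi> n \<tau>))"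
proof (rule left_lim_eqI)
  have "eventually (\<lambda>s. s \<in> {last_before \<pi> n \<tau><..<\<tau>}) (at_left \<tau>)"
    using last_before_in(2)[OF assms(1)] by (rule eventually_at_left_real)
  then have "\<forall>\<^sub>F s in at_left \<tau>. step_approx \<pi> n x s = x (next_after \<pi> n (last_before \<pi> n \<tau>))"
  proof eventually_elim
    case (elim s)
    then have s: "0 \<le> s" "s < last (\<pi> n)" "last_before \<pi> n \<tau> < last (\<pi> n)"
      using last_before_nonneg[of n \<tau>] assms(2) by auto
    have "\<tau> \<le> next_after \<pi> n (last_before \<pi> n \<tau>)"
      using next_after_in[OF s(3)] assms(1) by (intro last_before_less_imp[of \<tau> _ n]) auto
    then have "next_after \<pi> n s \<le> next_after \<pi> n (last_before \<pi> n \<tau>)"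
      using next_after_in[OF s(3)] elim by (intro next_after_le) auto
    moreover have "next_after \<pi> n (last_before \<pi> n \<tau>) \<le> next_after \<pi> n s"
      using next_after_in[OF s(2)] elim by (intro next_after_le) auto
    ultimately show ?case by (simp add: step_approx_eq[OF s(1,2)])
  qed
  then show "(step_approx \<pi> n x \<longlongrightarrow> x (next_after \<pi> n (last_before \<pi> n \<tau>))) (at_left \<tau>)"
    by (rule tendsto_eventually)
qed (use assms in auto)

lemma last_before_tendsto_seq:
  assumes "\<tau> \<longlonglongrightarrow> t" "\<And>n. 0 \<le> \<tau> n"
  shows "(\<lambda>n. last_before \<pi> n (\<tau> n)) \<longlonglongrightarrow> t"
  unfolding tendsto_iff
proof (intro allI impI)
  fix e :: real assume "0 < e"
  then have "0 < min 1 (e / 2)" by simp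
  then have "\<forall>\<^sub>F n in sequentially. dist (\<tau> n) t < min 1 (e / 2)"
    using assms(1) unfolding tendsto_iff by blast
  moreover have "\<forall>\<^sub>F n in sequentially. \<forall>r\<in>{0..t + 1}. r - e / 2 < last_before \<pi> n r"
    using eventually_last_before[of "e / 2" "t + 1"] \<open>0 < e\<close> by (auto elim: eventually_mono)
  ultimately show "\<forall>\<^sub>F n in sequentially. dist (last_before \<pi> n (\<tau> n)) t < e"
  proof eventually_elim
    case (elim n)
    then have "\<tau> n - e / 2 < last_before \<pi> n (\<tau> n)"
      using assms(2)[of n] by (auto simp: dist_real_def)
    then show ?case
      using elim(1) last_before_le[OF assms(2)[of n], of n]
      unfolding dist_real_def min_less_iff_conj by linarith
  qed
qed

lemma next_after_last_before_tendsto: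
  assumes "\<tau> \<longlonglongrightarrow> t" "\<And>n. 0 \<le> \<tau> n"
  shows "(\<lambda>n. next_after \<pi> n (last_before \<pi> n (\<tau> n))) \<longlonglongrightarrow> t"
  by (rule next_after_tendsto[OF last_before_nonneg last_before_tendsto_seq[OF assms]])

lemma left_lim_step_approx_tendsto_right:
  assumes "x \<in> cadlag_paths" "0 \<le> t" "\<tau> \<longlonglongrightarrow> t" "\<And>n. 0 \<le> \<tau> n" "\<And>n. last_before \<pi> n t < \<tau> n"
  shows "(\<lambda>n. left_lim (step_approx \<pi> n x) (\<tau> n)) \<longlonglongrightarrow> x t"
proof -
  have pos: "0 < \<tau> n" for n using assms(5)[of n] last_before_nonneg[of n t] by simp
  have ev: "\<forall>\<^sub>F n in sequentially. \<tau> n < last (\<pi> n)"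
  proof -
    have "\<forall>\<^sub>F n in sequentially. \<tau> n < t + 1" using assms(3) by (rule order_tendstoD) simp
    with eventually_next_after[OF zero_less_one, of "t + 1"] show ?thesis
      by eventually_elim auto
  qed
  have "(\<lambda>n. x (next_after \<pi> n (last_before \<pi> n (\<tau> n)))) \<longlonglongrightarrow> x t"
  proof (rule cadlag_tendsto_right[OF assms(1,2) next_after_last_before_tendsto[OF assms(3,4)]])
    show "\<forall>\<^sub>F n in sequentially. t \<le> next_after \<pi> n (last_before \<pi> n (\<tau> n))"
      using ev
    proof eventually_elim
      case (elim n)
      have "last_before \<pi> n t \<le> last_before \<pi> n (\<tau> n)"
      proof (cases "t = 0")
        case True
        then show ?thesis using last_before_0 last_before_nonneg by simp
      next
        case False
        then show ?thesis
          using assms(2,4,5) by (intro last_before_greatest last_before_in) auto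
      qed
      moreover have "last_before \<pi> n (\<tau> n) < last (\<pi> n)"
        using last_before_in(2)[OF pos, of n n] elim by simp
      ultimately show ?case
        using next_after_in[of "last_before \<pi> n (\<tau> n)" n]
        by (intro last_before_less_imp[OF assms(2)]) auto
    qed
  qed
  then show ?thesis
  proof (rule Lim_transform_eventually)
    show "\<forall>\<^sub>F n in sequentially. x (next_after \<pi> n (last_before \<pi> n (\<tau> n)))
        = left_lim (step_approx \<pi> n x) (\<tau> n)"
      using ev by eventually_elim (simp add: left_lim_step_approx pos)
  qed
qed

lemma left_lim_step_approx_tendsto_left:
  assumes "x \<in> cadlag_paths" "0 < t" "\<tau> \<longlonglongrightarrow> t" "\<And>n. 0 \<le> \<tau> n" "\<And>n. \<tau> n \<le> last_before \<pi> n t"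
  shows "(\<lambda>n. left_lim (step_approx \<pi> n x) (\<tau> n)) \<longlonglongrightarrow> left_lim x t"
proof -
  have ev: "\<forall>\<^sub>F n in sequentially. 0 < \<tau> n \<and> \<tau> n < last (\<pi> n)"
  proof -
    have "\<forall>\<^sub>F n in sequentially. \<tau> n < t + 1" using assms(3) by (rule order_tendstoD) simp
    moreover have "\<forall>\<^sub>F n in sequentially. 0 < \<tau> n" using assms(3,2) by (rule order_tendstoD)
    ultimately show ?thesis using eventually_next_after[OF zero_less_one, of "t + 1"]
      by eventually_elim auto
  qed
  have "(\<lambda>n. x (next_after \<pi> n (last_before \<pi> n (\<tau> n)))) \<longlonglongrightarrow> left_lim x t"
  proof (rule cadlag_tendsto_left[OF assms(1,2) next_after_last_before_tendsto[OF assms(3,4)]])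
    show "\<forall>\<^sub>F n in sequentially. next_after \<pi> n (last_before \<pi> n (\<tau> n)) < t"
      using ev
    proof eventually_elim
      case (elim n)
      then have "last_before \<pi> n (\<tau> n) < last_before \<pi> n t"
        using last_before_in(2)[of "\<tau> n" n] assms(5)[of n] by simp
      then have "next_after \<pi> n (last_before \<pi> n (\<tau> n)) \<le> last_before \<pi> n t"
        by (intro next_after_le last_before_in assms)
      then show ?case using last_before_in(2)[OF assms(2), of n] by simp
    qed
  qed
  then show ?thesis
  proof (rule Lim_transform_eventually)
    show "\<forall>\<^sub>F n in sequentially. x (next_after \<pi> n (last_before \<pi> n (\<tau> n)))
        = left_lim (step_approx \<pi> n x) (\<tau> n)"
      using ev by eventually_elim (simp add: left_lim_step_approx)
  qed
qed

text \<open>The invariant for building the time change on growing intervals [0,b). The value at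
  \<open>b\<close> is prescribed as \<open>last_before \<pi> n b\<close>, since from there on the
  approximation reads x at times not before \<open>b\<close>. Beyond \<open>b\<close> only the
  displacement is controlled.\<close>

definition matched :: "(real \<Rightarrow> 'a::real_normed_vector) \<Rightarrow> real \<Rightarrow> real \<Rightarrow> nat \<Rightarrow> real \<Rightarrow> (real \<Rightarrow> real) \<Rightarrow> bool" where
  "matched x e d n b l \<longleftrightarrow> time_change l \<and> l b = last_before \<pi> n b \<and>
     (\<forall>s\<ge>0. \<bar>l s - s\<bar> \<le> d) \<and> (\<forall>s. 0 \<le> s \<and> s < b \<longrightarrow> norm (step_approx \<pi> n x (l s) - x s) \<le> e)"

text \<open>
  On \<open>[a, b)\<close> the new time change is affine; the values of \<open>step_approx\<close> at times in
  \<open>[last_before a, last_before b)\<close> are values of \<open>x\<close> on \<open>[a, b)\<close>.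
\<close>

lemma matched_extend:
  assumes "0 \<le> a" "a < b" "0 < d"
    and osc: "\<And>r s. a \<le> r \<Longrightarrow> r < b \<Longrightarrow> a \<le> s \<Longrightarrow> s < b \<Longrightarrow> norm (x r - x s) \<le> e"
    and m: "\<forall>\<^sub>F n in sequentially. \<exists>l. matched x e d n a l"
  shows "\<forall>\<^sub>F n in sequentially. \<exists>l. matched x e d n b l"
proof -
  \<comment> \<open>A mesh below \<open>d\<close> bounds the displacement at \<open>a\<close> and
    \<open>b\<close>; a mesh below \<open>b - a\<close> puts a partition point strictly between
    \<open>a\<close> and \<open>b\<close>, so that \<open>p \<le> a < q\<close> and the new piece
    has positive slope.\<close>
  have "0 < min d (b - a)" using assms by simp
  from eventually_last_before[OF this, of b] m show ?thesis
  proof eventually_elim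
    case (elim n)
    define p q where "p = last_before \<pi> n a" and "q = last_before \<pi> n b"
    have lb: "r - min d (b - a) < last_before \<pi> n r" if "0 \<le> r" "r \<le> b" for r
      using elim(1) that by auto
    have q: "q < b" "q \<in> set (\<pi> n)" "b < last (\<pi> n)"
      using elim(1) assms(1,2) last_before_in[of b n] by (auto simp: q_def)
    have q': "b - d < q" "a < q"
      using lb[of b] assms(1,2) unfolding q_def by linarith+
    have p: "p \<le> a" "a - d < p" "0 \<le> p"
      using lb[of a] assms(1,2) last_before_le[of a n] last_before_nonneg[of n a]
      unfolding p_def by linarith+
    obtain l where l: "time_change l" "l a = p" "\<And>s. 0 \<le> s \<Longrightarrow> \<bar>l s - s\<bar> \<le> d"
      "\<And>s. 0 \<le> s \<Longrightarrow> s < a \<Longrightarrow> norm (step_approx \<pi> n x (l s) - x s) \<le> e"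
      using elim(2) by (auto simp: matched_def p_def)
    define c where "c = (q - p) / (b - a)"
    have c: "0 < c" "c * (b - a) = q - p" using p q' assms by (auto simp: c_def)
    define l1 where "l1 = (\<lambda>s. if s \<le> a then l s else l a + c * (s - a))"
    define l2 where "l2 = (\<lambda>s. if s \<le> b then l1 s else l1 b + 1 * (s - b))"
    have tc: "time_change l2"
      unfolding l2_def l1_def using l(1) assms c by (intro time_change_append_affine) auto
    have l2a: "l2 s = l s" if "s \<le> a" for s using that assms by (simp add: l1_def l2_def)
    have l2b: "l2 b = q" using assms l(2) c by (simp add: l1_def l2_def)
    have "\<bar>l2 s - s\<bar> \<le> d" if s: "0 \<le> s" for s
    proof -
      consider "s \<le> a" | "a < s" "s \<le> b" | "b < s" by linarith
      then show ?thesis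
      proof cases
        case 1
        then show ?thesis using l(3)[OF s] l2a by simp
      next
        case 2
        \<comment> \<open>The displacement is affine on [a,b], hence a convex combination of its end
          values \<open>p - a\<close> and \<open>q - b\<close>, both at most \<open>d\<close> in
          absolute value.\<close>
        define \<theta> where "\<theta> = (s - a) / (b - a)"
        have \<theta>: "0 \<le> \<theta>" "\<theta> \<le> 1" "s - a = \<theta> * (b - a)" using 2 by (auto simp: \<theta>_def field_simps)
        have "l2 s = p + c * (s - a)" using 2 l(2) by (simp add: l2_def l1_def)
        moreover have "c * (s - a) = \<theta> * (q - p)" using \<theta>(3) c(2) by (metis mult.left_commute)
        ultimately have eq: "l2 s - s = (1 - \<theta>) * (p - a) + \<theta> * (q - b)"
          using \<theta>(3) by (simp add: algebra_simps)
        have "\<bar>(1 - \<theta>) * (p - a) + \<theta> * (q - b)\<bar> \<le> (1 - \<theta>) * d + \<theta> * d"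
          using \<theta> p q q' by (intro order_trans[OF abs_triangle_ineq] add_mono)
            (auto simp: abs_mult intro!: mult_left_mono)
        then show ?thesis unfolding eq by (simp add: algebra_simps)
      next
        case 3
        then have "l2 s - s = q - b" using l2b by (simp add: l2_def)
        then show ?thesis using q q' by simp
      qed
    qed
    moreover have "norm (step_approx \<pi> n x (l2 s) - x s) \<le> e" if s: "0 \<le> s" "s < b" for s
    proof (cases "s < a")
      case True
      then show ?thesis using l(4) s l2a by simp
    next
      case False
      have "p \<le> l2 s" using time_change_le[OF tc assms(1), of s] False l2a[of a] l(2) by simp
      moreover have "l2 s < q" using time_change_less[OF tc s] l2b by simp
      ultimately have u: "0 \<le> l2 s" "l2 s < last (\<pi> n)" "last_before \<pi> n a \<le> l2 s"
        using p q by (auto simp: p_def)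
      have "next_after \<pi> n (l2 s) \<le> q" using \<open>l2 s < q\<close> q(2) by (intro next_after_le)
      moreover have "a \<le> next_after \<pi> n (l2 s)"
        using next_after_in[OF u(2)] u(3) by (intro last_before_less_imp[OF assms(1)]) auto
      ultimately show ?thesis
        unfolding step_approx_eq[OF u(1,2)] using osc q False s by auto
    qed
    ultimately have "matched x e d n b l2"
      using tc l2b by (simp add: matched_def q_def)
    then show ?case by blast
  qed
qed

text \<open>A path with one-sided limits oscillates by at most \<open>e\<close> on sufficiently
  short half-open intervals on either side of each point. Extending over such intervals propagates
  the invariant, and bisection replaces an explicit finite subdivision of [0,b].\<close>

lemma eventually_matched:
  assumes x: "x \<in> cadlag_paths" and "0 \<le> b" "0 < e" "0 < d"
  shows "\<forall>\<^sub>F n in sequentially. \<exists>l. matched x e d n b l"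
proof -
  define Q where "Q b \<longleftrightarrow> (\<forall>\<^sub>F n in sequentially. \<exists>l. matched x e d n b l)" for b
  have "0 < e / 2" using assms by simp
  have extend: "Q b" if "Q a" "0 \<le> a" "a < b"
    "\<And>r. a \<le> r \<Longrightarrow> r < b \<Longrightarrow> norm (x r - c) \<le> e / 2" for a b c
    using \<open>Q a\<close> unfolding Q_def
  proof (rule matched_extend[OF \<open>0 \<le> a\<close> \<open>a < b\<close> \<open>0 < d\<close>, rotated])
    fix r s assume "a \<le> r" "r < b" "a \<le> s" "s < b"
    then show "norm (x r - x s) \<le> e"
      using norm_triangle_ineq4[of "x r - c" "x s - c"] that(4)[of r] that(4)[of s] by simp
  qed
  have "0 \<le> (0::real) \<longrightarrow> Q 0 \<longrightarrow> Q b"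
    using \<open>0 \<le> b\<close>
  proof (rule Bolzano[where P = "\<lambda>a b. 0 \<le> a \<longrightarrow> Q a \<longrightarrow> Q b"], goal_cases)
    case (1 a b c)
    then show ?case by auto
  next
    case (2 t)
    obtain d1 where d1: "0 < d1" "\<And>r. t \<le> r \<Longrightarrow> r < t + d1 \<Longrightarrow> norm (x r - x t) < e / 2"
      using cadlag_right[OF x 2(1) \<open>0 < e / 2\<close>] by metis
    have "\<exists>d2>0. \<forall>a. 0 \<le> a \<and> a < t \<and> t - a < d2 \<longrightarrow> Q a \<longrightarrow> Q t"
    proof (cases "t = 0")
      case False
      then have "0 < t" using 2(1) by simp
      then obtain d2 where d2: "0 < d2"
          "\<And>r. t - d2 < r \<Longrightarrow> r < t \<Longrightarrow> norm (x r - left_lim x t) < e / 2"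
        using cadlag_left[OF x _ \<open>0 < e / 2\<close>, of t] by metis
      have "Q t" if "0 \<le> a" "a < t" "t - a < d2" "Q a" for a
        using that d2(2) by (intro extend[of a t "left_lim x t"]) (auto intro!: less_imp_le)
      then show ?thesis using d2(1) by blast
    qed (auto intro: exI[of _ 1])
    then obtain d2 where d2: "0 < d2" "\<And>a. 0 \<le> a \<Longrightarrow> a < t \<Longrightarrow> t - a < d2 \<Longrightarrow> Q a \<Longrightarrow> Q t"
      by blast
    have right: "Q c" if "Q t" "t < c" "c - t < d1" for c
      using that d1(2) 2(1) by (intro extend[of t c "x t"]) (auto intro!: less_imp_le)
    \<comment> \<open>An interval around \<open>t\<close> is crossed in two moves, through
      \<open>Q t\<close>, because x may jump at \<open>t\<close> and oscillates little only on each
      side separately.\<close>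
    have step: "Q c" if "a \<le> t \<and> t \<le> c \<and> c - a < min d1 d2" "0 \<le> a" "Q a" for a c
      using that d2(2)[of a] right[of c] by (cases "a = t"; cases "c = t") auto
    show ?case
      using d1(1) d2(1) by (intro exI[of _ "min d1 d2"] conjI allI impI) (simp, rule step)
  qed
  \<comment> \<open>The identity works: \<open>last_before\<close> is 0 at 0, and there is no time
    before 0 to compare.\<close>
  moreover have "Q 0"
    unfolding Q_def matched_def using assms time_change_id last_before_0
    by (intro always_eventually allI exI[of _ "\<lambda>s. s"]) auto
  ultimately show ?thesis by (simp add: Q_def)
qed

text \<open>The time change maps \<open>t\<close> to \<open>last_before t\<close>, where the approximation makes its jump.\<close>

lemma limitin_J1_step_approx_right:
  assumes x: "x \<in> cadlag_paths" and t: "0 \<le> t"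
    and \<tau>: "\<tau> \<longlonglongrightarrow> t" "\<And>n. last_before \<pi> n t \<le> \<tau> n"
    and c: "c \<longlonglongrightarrow> x t" and "stop x t \<in> cadlag_paths"
    and fr: "\<forall>\<^sub>F n in sequentially. freeze (step_approx \<pi> n x) (\<tau> n) (c n) \<in> cadlag_paths"
  shows "limitin J1_topology (\<lambda>n. freeze (step_approx \<pi> n x) (\<tau> n) (c n)) (stop x t) sequentially"
  unfolding limitin_J1_nbhd
proof (intro conjI allI impI)
  fix T e :: real assume e: "0 < e"
  then have "0 < e / 2" by simp
  \<comment> \<open>Half of \<open>d\<close> is spent on \<open>\<tau> n\<close> and half on the
    mesh, so that a partition point read before \<open>\<tau> n\<close> lies before
    \<open>t + d\<close>. The bound \<open>t + 1\<close> on \<open>\<tau> n\<close> keeps these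
    times within the range of the mesh estimate.\<close>
  obtain d where d: "0 < d" "\<And>r. t \<le> r \<Longrightarrow> r < t + d \<Longrightarrow> norm (x r - x t) < e / 2"
    using cadlag_right[OF x t \<open>0 < e / 2\<close>] by metis
  have "\<forall>\<^sub>F n in sequentially. \<tau> n < t + min 1 (d / 2)"
    using \<tau>(1) by (rule order_tendstoD) (use d in simp)
  moreover have "\<forall>\<^sub>F n in sequentially. dist (c n) (x t) < e / 2"
    using c \<open>0 < e / 2\<close> unfolding tendsto_iff by blast
  moreover have "\<forall>\<^sub>F n in sequentially. \<exists>l. matched x (e / 2) (e / 2) n t l"
    using e by (intro eventually_matched x t) auto
  moreover have "\<forall>\<^sub>F n in sequentially. t + 1 < last (\<pi> n) \<and>
      (\<forall>s\<in>{0..t + 1}. next_after \<pi> n s < s + d / 2)"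
    using d by (intro eventually_next_after) auto
  ultimately show "\<forall>\<^sub>F n in sequentially. freeze (step_approx \<pi> n x) (\<tau> n) (c n)
      \<in> J1_nbhd (stop x t) T e"
    using fr
  proof eventually_elim
    case (elim n)
    then obtain l where l: "matched x (e / 2) (e / 2) n t l" by blast
    then have tc: "time_change l" by (simp add: matched_def)
    show ?case
    proof (rule J1_nbhdI[OF elim(5) tc])
      show "e / 2 < e" using e by simp
      show "\<bar>l s - s\<bar> \<le> e / 2" if "0 \<le> s" for s using l that by (simp add: matched_def)
      fix s :: real assume s: "0 \<le> s"
      show "norm (freeze (step_approx \<pi> n x) (\<tau> n) (c n) (l s) - stop x t s) \<le> e / 2"
      proof (cases "s < t")
        case True
        then have "l s < \<tau> n"
          using time_change_less[OF tc s True] l \<tau>(2)[of n] by (simp add: matched_def)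
        then show ?thesis using l s True by (simp add: freeze_def stop_eq_freeze matched_def)
      next
        case False
        show ?thesis
        proof (cases "l s < \<tau> n")
          case True
          have "last_before \<pi> n t \<le> l s"
            using time_change_le[OF tc t, of s] False l by (simp add: matched_def)
          moreover have u: "0 \<le> l s" "l s < last (\<pi> n)"
            using time_change_nonneg[OF tc s] True elim by auto
          ultimately have "t \<le> next_after \<pi> n (l s)"
            using next_after_in[OF u(2)] by (intro last_before_less_imp[OF t]) auto
          moreover have "next_after \<pi> n (l s) < l s + d / 2" using u True elim by auto
          ultimately have "norm (x (next_after \<pi> n (l s)) - x t) < e / 2"
            using True elim by (intro d(2)) auto
          then show ?thesis
            using True False by (simp add: freeze_def stop_eq_freeze step_approx_eq[OF u])
        next
          case F: False
          then show ?thesis using False elim by (simp add: freeze_def stop_eq_freeze dist_norm)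
        qed
      qed
    qed
  qed
qed (use assms in auto)

lemma limitin_J1_step_approx_left:
  assumes x: "x \<in> cadlag_paths" and t: "0 < t"
    and \<tau>: "\<tau> \<longlonglongrightarrow> t" "\<And>n. \<tau> n \<le> last_before \<pi> n t"
    and c: "c \<longlonglongrightarrow> left_lim x t" and "stop_left x t \<in> cadlag_paths"
    and fr: "\<forall>\<^sub>F n in sequentially. freeze (step_approx \<pi> n x) (\<tau> n) (c n) \<in> cadlag_paths"
  shows "limitin J1_topology (\<lambda>n. freeze (step_approx \<pi> n x) (\<tau> n) (c n)) (stop_left x t) sequentially"
  unfolding limitin_J1_nbhd
proof (intro conjI allI impI)
  fix T e :: real assume e: "0 < e"
  then have "0 < e / 4" by simp
  \<comment> \<open>Freezing takes place after \<open>t - d / 2\<close> and the time change moves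
    points by at most \<open>d / 2\<close>; thus a frozen time \<open>s < t\<close> satisfies
    \<open>t - d < s\<close>.\<close>
  obtain d where d: "0 < d" "d \<le> t"
      "\<And>r. t - d < r \<Longrightarrow> r < t \<Longrightarrow> norm (x r - left_lim x t) < e / 4"
    using cadlag_left[OF x t \<open>0 < e / 4\<close>] by metis
  have "\<forall>\<^sub>F n in sequentially. t - d / 2 < \<tau> n"
    using \<tau>(1) by (rule order_tendstoD) (use d in simp)
  moreover have "\<forall>\<^sub>F n in sequentially. dist (c n) (left_lim x t) < e / 4"
    using c \<open>0 < e / 4\<close> unfolding tendsto_iff by blast
  moreover have "\<forall>\<^sub>F n in sequentially. \<exists>l. matched x (e / 2) (min (e / 2) (d / 2)) n t l"
    using e d t by (intro eventually_matched x) auto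
  ultimately show "\<forall>\<^sub>F n in sequentially. freeze (step_approx \<pi> n x) (\<tau> n) (c n)
      \<in> J1_nbhd (stop_left x t) T e"
    using fr
  proof eventually_elim
    case (elim n)
    then obtain l where l: "matched x (e / 2) (min (e / 2) (d / 2)) n t l" by blast
    then have tc: "time_change l" by (simp add: matched_def)
    have ld: "\<bar>l s - s\<bar> \<le> min (e / 2) (d / 2)" if "0 \<le> s" for s
      using l that unfolding matched_def by blast
    show ?case
    proof (rule J1_nbhdI[OF elim(4) tc])
      show "e / 2 < e" using e by simp
      show "\<bar>l s - s\<bar> \<le> e / 2" if "0 \<le> s" for s using ld[OF that] by simp
      fix s :: real assume s: "0 \<le> s"
      consider "s < t" "l s < \<tau> n" | "s < t" "\<tau> n \<le> l s" | "t \<le> s" by linarith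
      then show "norm (freeze (step_approx \<pi> n x) (\<tau> n) (c n) (l s) - stop_left x t s) \<le> e / 2"
      proof cases
        case 1
        then show ?thesis using l s by (simp add: freeze_def stop_left_eq_freeze matched_def)
      next
        case 2
        have "t - d < s" using ld[OF s] 2 elim(1) by linarith
        then have "norm (x s - left_lim x t) < e / 4" using d(3) 2 by blast
        then have "norm (c n - x s) \<le> e / 2"
          using elim(2) norm_triangle_ineq4[of "c n - left_lim x t" "x s - left_lim x t"]
          by (simp add: dist_norm)
        with 2 show ?thesis by (simp add: freeze_def stop_left_eq_freeze)
      next
        case 3
        then have "last_before \<pi> n t \<le> l s"
          using time_change_le[OF tc, of t s] t l by (simp add: matched_def)
        then have "\<tau> n \<le> l s" using \<tau>(2)[of n] by simp
        then show ?thesis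
          using 3 elim(2) e by (simp add: freeze_def stop_left_eq_freeze dist_norm)
      qed
    qed
  qed
qed (use assms in auto)

end

section \<open>The nets generating the topology\<close>

locale generic_paths = partitions \<pi> for \<pi> +
  fixes \<Omega> :: "(real \<Rightarrow> real^'m) set"
  assumes generic: "generic_set \<pi> \<Omega>"
begin

text \<open>The eight conditions on a functional as filters with a prescribed limit point, in the
  order of \<open>pi_functionals\<close>. In this form the same nets can be tested against
  \<open>F\<close>, against open sets and against J1 convergence.\<close>

inductive approaching ::
    "(real \<times> (real \<Rightarrow> real^'m)) filter \<Rightarrow> real \<times> (real \<Rightarrow> real^'m) \<Rightarrow> bool" where
  left1: "x \<in> \<Omega> \<Longrightarrow> 0 \<le> t \<Longrightarrow>
    approaching (filtermap (\<lambda>s. (s, stop_left x s)) (at t within {0..t})) (t, stop_left x t)"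
| left2: "x \<in> \<Omega> \<Longrightarrow> 0 \<le> t \<Longrightarrow>
    approaching (filtermap (\<lambda>s. (s, stop x s)) (at t within {0..<t})) (t, stop_left x t)"
| left3: "x \<in> \<Omega> \<Longrightarrow> 0 \<le> t \<Longrightarrow> (\<And>n. 0 \<le> \<tau> n) \<Longrightarrow> \<tau> \<longlonglongrightarrow> t \<Longrightarrow> (\<And>n. \<tau> n \<le> last_before \<pi> n t) \<Longrightarrow>
    approaching (filtermap (\<lambda>n. (\<tau> n, stop_left (step_approx \<pi> n x) (\<tau> n))) sequentially)
      (t, stop_left x t)"
| left4: "x \<in> \<Omega> \<Longrightarrow> 0 \<le> t \<Longrightarrow> (\<And>n. 0 \<le> \<tau> n) \<Longrightarrow> \<tau> \<longlonglongrightarrow> t \<Longrightarrow> (\<And>n. \<tau> n < last_before \<pi> n t) \<Longrightarrow>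
    approaching (filtermap (\<lambda>n. (\<tau> n, stop (step_approx \<pi> n x) (\<tau> n))) sequentially)
      (t, stop_left x t)"
| right1: "x \<in> \<Omega> \<Longrightarrow> 0 \<le> t \<Longrightarrow>
    approaching (filtermap (\<lambda>s. (s, stop x s)) (at t within {t..})) (t, stop x t)"
| right2: "x \<in> \<Omega> \<Longrightarrow> 0 \<le> t \<Longrightarrow>
    approaching (filtermap (\<lambda>s. (s, stop_left x s)) (at t within {t<..})) (t, stop x t)"
| right3: "x \<in> \<Omega> \<Longrightarrow> 0 \<le> t \<Longrightarrow> (\<And>n. 0 \<le> \<tau> n) \<Longrightarrow> \<tau> \<longlonglongrightarrow> t \<Longrightarrow> (\<And>n. \<tau> n \<ge> last_before \<pi> n t) \<Longrightarrow>
    approaching (filtermap (\<lambda>n. (\<tau> n, stop (step_approx \<pi> n x) (\<tau> n))) sequentially)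
      (t, stop x t)"
| right4: "x \<in> \<Omega> \<Longrightarrow> 0 \<le> t \<Longrightarrow> (\<And>n. 0 \<le> \<tau> n) \<Longrightarrow> \<tau> \<longlonglongrightarrow> t \<Longrightarrow> (\<And>n. \<tau> n > last_before \<pi> n t) \<Longrightarrow>
    approaching (filtermap (\<lambda>n. (\<tau> n, stop_left (step_approx \<pi> n x) (\<tau> n))) sequentially)
      (t, stop x t)"

lemma pi_functionals_iff:
  "F \<in> pi_functionals \<pi> \<Omega> \<longleftrightarrow> (\<forall>G p. approaching G p \<longrightarrow> (F \<longlongrightarrow> F p) G)"
proof
  assume F: "F \<in> pi_functionals \<pi> \<Omega>"
  show "\<forall>G p. approaching G p \<longrightarrow> (F \<longlongrightarrow> F p) G"
  proof (intro allI impI)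
    fix G p assume "approaching G p"
    then show "(F \<longlongrightarrow> F p) G"
      using F by cases (simp_all add: pi_functionals_def filterlim_filtermap)
  qed
next
  assume F: "\<forall>G p. approaching G p \<longrightarrow> (F \<longlongrightarrow> F p) G"
  show "F \<in> pi_functionals \<pi> \<Omega>"
    unfolding pi_functionals_def
    using F[rule_format, OF left1] F[rule_format, OF left2] F[rule_format, OF left3]
      F[rule_format, OF left4] F[rule_format, OF right1] F[rule_format, OF right2]
      F[rule_format, OF right3] F[rule_format, OF right4]
    by (simp add: filterlim_filtermap)
qed

lemma approaching_freeze:
  assumes "approaching G p"
  obtains x t c S c' where "x \<in> \<Omega>" "0 \<le> t" "p = (t, freeze x t c)"
      "G = filtermap (\<lambda>s. (s, freeze x s (c' s))) (at t within S)"
    | x t c \<tau> c' where "x \<in> \<Omega>" "0 \<le> t" "p = (t, freeze x t c)" "\<tau> \<longlonglongrightarrow> t"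
      "G = filtermap (\<lambda>n. (\<tau> n, freeze (step_approx \<pi> n x) (\<tau> n) (c' n))) sequentially"
  using assms
proof cases
  case (left1 x t)
  show ?thesis
    by (rule that(1)[of x t "left_lim x t" "left_lim x" "{0..t}"]) (use left1 in \<open>auto simp: stop_eq_freeze stop_left_eq_freeze\<close>)
next
  case (left2 x t)
  show ?thesis
    by (rule that(1)[of x t "left_lim x t" x "{0..<t}"]) (use left2 in \<open>auto simp: stop_eq_freeze stop_left_eq_freeze\<close>)
next
  case (left3 x t \<tau>)
  show ?thesis
    by (rule that(2)[of x t "left_lim x t" \<tau> "\<lambda>n. left_lim (step_approx \<pi> n x) (\<tau> n)"]) (use left3 in \<open>auto simp: stop_eq_freeze stop_left_eq_freeze\<close>)
next
  case (left4 x t \<tau>)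
  show ?thesis
    by (rule that(2)[of x t "left_lim x t" \<tau> "\<lambda>n. step_approx \<pi> n x (\<tau> n)"]) (use left4 in \<open>auto simp: stop_eq_freeze stop_left_eq_freeze\<close>)
next
  case (right1 x t)
  show ?thesis
    by (rule that(1)[of x t "x t" x "{t..}"]) (use right1 in \<open>auto simp: stop_eq_freeze stop_left_eq_freeze\<close>)
next
  case (right2 x t)
  show ?thesis
    by (rule that(1)[of x t "x t" "left_lim x" "{t<..}"]) (use right2 in \<open>auto simp: stop_eq_freeze stop_left_eq_freeze\<close>)
next
  case (right3 x t \<tau>)
  show ?thesis
    by (rule that(2)[of x t "x t" \<tau> "\<lambda>n. step_approx \<pi> n x (\<tau> n)"]) (use right3 in \<open>auto simp: stop_eq_freeze stop_left_eq_freeze\<close>)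
next
  case (right4 x t \<tau>)
  show ?thesis
    by (rule that(2)[of x t "x t" \<tau> "\<lambda>n. left_lim (step_approx \<pi> n x) (\<tau> n)"]) (use right4 in \<open>auto simp: stop_eq_freeze stop_left_eq_freeze\<close>)
qed

lemma generic_cadlag: "x \<in> \<Omega> \<Longrightarrow> x \<in> cadlag_paths"
  using generic unfolding generic_set_def by (elim conjE) (rule subsetD)

lemma append_jump_in:
  assumes "x \<in> \<Omega>" "0 \<le> t"
  obtains U where "convex U" "0 \<in> interior U" "- jump x t \<in> U"
    "\<And>e. e \<in> U \<Longrightarrow> freeze x t (x t + e) \<in> \<Omega>"
proof -
  have eq: "(\<lambda>s. stop x t s + indicator {t..} s *\<^sub>R e) = freeze x t (x t + e)" for e
    by (auto simp: stop_eq_freeze freeze_def)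
  have "\<forall>x\<in>\<Omega>. \<forall>t\<ge>0. \<exists>U. convex U \<and> 0 \<in> interior U \<and> - jump x t \<in> U
      \<and> (\<forall>e\<in>U. (\<lambda>s. stop x t s + indicator {t..} s *\<^sub>R e) \<in> \<Omega>)"
    using generic unfolding generic_set_def by (elim conjE)
  from this[rule_format, OF assms] obtain U where U: "convex U" "0 \<in> interior U" "- jump x t \<in> U"
      "\<forall>e\<in>U. (\<lambda>s. stop x t s + indicator {t..} s *\<^sub>R e) \<in> \<Omega>"
    by (elim exE conjE)
  show ?thesis by (rule that[OF U(1-3)]) (use U(4) eq in auto)
qed

text \<open>The appended jump 0 is admissible, since 0 is interior to the neighbourhood.\<close>

lemma stop_in:
  assumes "x \<in> \<Omega>" "0 \<le> t"
  shows "stop x t \<in> \<Omega>"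
proof -
  obtain U where "0 \<in> interior U" "\<And>e. e \<in> U \<Longrightarrow> freeze x t (x t + e) \<in> \<Omega>"
    using append_jump_in[OF assms] by metis
  then have "freeze x t (x t + 0) \<in> \<Omega>" using interior_subset by blast
  then show ?thesis by (simp add: stop_eq_freeze)
qed

text \<open>Appending \<open>- jump x t\<close> at \<open>t\<close> cancels the jump of x
  there.\<close>

lemma stop_left_in:
  assumes "x \<in> \<Omega>" "0 \<le> t"
  shows "stop_left x t \<in> \<Omega>"
proof -
  obtain U where "- jump x t \<in> U" "\<And>e. e \<in> U \<Longrightarrow> freeze x t (x t + e) \<in> \<Omega>"
    using append_jump_in[OF assms] by metis
  then have "freeze x t (x t + - jump x t) \<in> \<Omega>" by blast
  then show ?thesis by (simp add: stop_left_eq_freeze jump_def)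
qed

lemma stopped_pathsI: "x \<in> \<Omega> \<Longrightarrow> 0 \<le> t \<Longrightarrow> stop x t = x \<Longrightarrow> (t, x) \<in> stopped_paths \<Omega>"
  unfolding stopped_paths_def by (intro CollectI exI[of _ t] exI[of _ x]) simp

lemma stopped_paths_cadlag: "(t, x) \<in> stopped_paths \<Omega> \<Longrightarrow> x \<in> cadlag_paths \<and> 0 \<le> t"
  using stop_in generic_cadlag by (auto simp: stopped_paths_def)

text \<open>Genericity gives only approximations stopped at a fixed horizon. The horizon
  \<open>t + 1\<close> eventually exceeds \<open>\<tau> n\<close>, and stopping once more at
  \<open>\<tau> n\<close> does not leave \<open>\<Omega>\<close>.\<close>

lemma stop_step_approx_in:
  assumes x: "x \<in> \<Omega>" and "0 \<le> t" and \<tau>: "\<And>n. 0 \<le> \<tau> n" "\<tau> \<longlonglongrightarrow> t"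
  shows "\<forall>\<^sub>F n in sequentially. stop (step_approx \<pi> n x) (\<tau> n) \<in> \<Omega> \<and>
    stop_left (step_approx \<pi> n x) (\<tau> n) \<in> \<Omega>"
proof -
  have "\<forall>\<^sub>F n in sequentially. stop (step_approx \<pi> n x) (t + 1) \<in> \<Omega>"
  proof -
    have "\<forall>x\<in>\<Omega>. \<forall>T>0. \<exists>N. \<forall>n\<ge>N. stop (step_approx \<pi> n x) T \<in> \<Omega>"
      using generic unfolding generic_set_def by (elim conjE)
    then show ?thesis using x \<open>0 \<le> t\<close> unfolding eventually_sequentially by simp
  qed
  moreover have "\<forall>\<^sub>F n in sequentially. \<tau> n < t + 1" using \<tau>(2) by (rule order_tendstoD) simp
  ultimately show ?thesis
  proof eventually_elim
    case (elim n)
    define y where "y = step_approx \<pi> n x"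
    have "stop (stop y (t + 1)) (\<tau> n) = stop y (\<tau> n)"
      using elim by (auto simp: stop_def min_def)
    moreover have "left_lim (stop y (t + 1)) (\<tau> n) = left_lim y (\<tau> n)"
      using elim \<tau>(1)[of n] \<open>0 \<le> t\<close> by (intro left_lim_cong) (auto simp: stop_def)
    then have "stop_left (stop y (t + 1)) (\<tau> n) = stop_left y (\<tau> n)"
      using elim by (auto simp: stop_left_def stop_def)
    ultimately show ?case
      using stop_in[OF elim(1) \<tau>(1)[of n]] stop_left_in[OF elim(1) \<tau>(1)[of n]] by (simp add: y_def)
  qed
qed

definition J1_approaching ::
    "(real \<times> (real \<Rightarrow> real^'m)) filter \<Rightarrow> real \<times> (real \<Rightarrow> real^'m) \<Rightarrow> bool" where
  "J1_approaching G p \<longleftrightarrow> p \<in> stopped_paths \<Omega> \<and> eventually (\<lambda>q. q \<in> stopped_paths \<Omega>) G \<and>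
     (fst \<longlongrightarrow> fst p) G \<and> limitin J1_topology snd (snd p) G"

lemma J1_approaching_filtermap:
  assumes "\<forall>\<^sub>F i in G. 0 \<le> \<tau> i \<and> y i \<in> \<Omega> \<and> stop (y i) (\<tau> i) = y i"
    and "(\<tau> \<longlongrightarrow> t) G" "limitin J1_topology y z G" "0 \<le> t" "z \<in> \<Omega>" "stop z t = z"
  shows "J1_approaching (filtermap (\<lambda>i. (\<tau> i, y i)) G) (t, z)"
proof -
  have "\<forall>\<^sub>F i in G. (\<tau> i, y i) \<in> stopped_paths \<Omega>"
    using assms(1) by eventually_elim (auto intro: stopped_pathsI)
  then show ?thesis
    using assms(2-) stopped_pathsI[of z t]
    by (simp add: J1_approaching_def limitin_def eventually_filtermap filterlim_filtermap)
qed

lemma stop_stop [simp]: "stop (stop y t) t = stop y t" "stop (stop_left y t) t = stop_left y t"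
  by (auto simp: stop_def stop_left_def)

lemma J1_approaching_left_within:
  assumes x: "x \<in> \<Omega>" and t: "0 \<le> t" and S: "S \<subseteq> {0..t}"
    and c: "0 < t \<Longrightarrow> (c \<longlongrightarrow> left_lim x t) (at t within S)"
    and fr: "\<And>s. 0 \<le> s \<Longrightarrow> freeze x s (c s) \<in> \<Omega>"
  shows "J1_approaching (filtermap (\<lambda>s. (s, freeze x s (c s))) (at t within S)) (t, stop_left x t)"
proof (rule J1_approaching_filtermap)
  have inS: "\<forall>\<^sub>F s in at t within S. s \<in> S" by (simp add: eventually_at_filter)
  show "\<forall>\<^sub>F s in at t within S. 0 \<le> s \<and> freeze x s (c s) \<in> \<Omega> \<and> stop (freeze x s (c s)) s = freeze x s (c s)"
    using inS by eventually_elim (use S fr in \<open>auto simp: stop_def freeze_def\<close>)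
  show "limitin J1_topology (\<lambda>s. freeze x s (c s)) (stop_left x t) (at t within S)"
  proof (cases "t = 0")
    case True
    \<comment> \<open>At time 0 nothing can approach from the left: the filter is trivial and every
      point of the space is a limit.\<close>
    then have "S - {t} = {}" using S by auto
    then have "at t within S = bot" by (simp only: at_within_eq_bot_iff closure_empty) simp
    then show ?thesis
      using stop_left_in[OF x t] generic_cadlag by (simp add: limitin_def topspace_J1)
  next
    case False
    then have pos: "0 < t" using t by simp
    show ?thesis
    proof (rule limitin_J1_freeze_left[OF generic_cadlag[OF x] pos tendsto_ident_at _ c[OF pos]])
      show "\<forall>\<^sub>F s in at t within S. s \<le> t" "\<forall>\<^sub>F s in at t within S. freeze x s (c s) \<in> cadlag_paths"
        using inS by (eventually_elim, use S fr generic_cadlag in auto)+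
    qed (use stop_left_in[OF x t] generic_cadlag in auto)
  qed
qed (use assms stop_left_in in auto)

lemma J1_approaching_right_within:
  assumes x: "x \<in> \<Omega>" and t: "0 \<le> t" and S: "S \<subseteq> {t..}"
    and c: "(c \<longlongrightarrow> x t) (at t within S)"
    and fr: "\<And>s. 0 \<le> s \<Longrightarrow> freeze x s (c s) \<in> \<Omega>"
  shows "J1_approaching (filtermap (\<lambda>s. (s, freeze x s (c s))) (at t within S)) (t, stop x t)"
proof (rule J1_approaching_filtermap)
  have inS: "\<forall>\<^sub>F s in at t within S. s \<in> S" by (simp add: eventually_at_filter)
  show "\<forall>\<^sub>F s in at t within S. 0 \<le> s \<and> freeze x s (c s) \<in> \<Omega> \<and> stop (freeze x s (c s)) s = freeze x s (c s)"
    using inS by eventually_elim (use S t fr in \<open>auto simp: stop_def freeze_def\<close>)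
  show "limitin J1_topology (\<lambda>s. freeze x s (c s)) (stop x t) (at t within S)"
  proof (rule limitin_J1_freeze_right[OF generic_cadlag[OF x] t tendsto_ident_at _ c])
    show "\<forall>\<^sub>F s in at t within S. t \<le> s" "\<forall>\<^sub>F s in at t within S. freeze x s (c s) \<in> cadlag_paths"
      using inS by (eventually_elim, use S t fr generic_cadlag in auto)+
  qed (use stop_in[OF x t] generic_cadlag in auto)
qed (use assms stop_in in auto)

lemma J1_approaching_left_steps:
  assumes x: "x \<in> \<Omega>" and t: "0 < t" and \<tau>: "\<And>n. 0 \<le> \<tau> n" "\<tau> \<longlonglongrightarrow> t" "\<And>n. \<tau> n \<le> last_before \<pi> n t"
    and c: "c \<longlonglongrightarrow> left_lim x t"
    and fr: "\<forall>\<^sub>F n in sequentially. freeze (step_approx \<pi> n x) (\<tau> n) (c n) \<in> \<Omega>"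
  shows "J1_approaching (filtermap (\<lambda>n. (\<tau> n, freeze (step_approx \<pi> n x) (\<tau> n) (c n))) sequentially)
    (t, stop_left x t)"
proof (rule J1_approaching_filtermap)
  show "\<forall>\<^sub>F n in sequentially. 0 \<le> \<tau> n \<and> freeze (step_approx \<pi> n x) (\<tau> n) (c n) \<in> \<Omega> \<and>
      stop (freeze (step_approx \<pi> n x) (\<tau> n) (c n)) (\<tau> n) = freeze (step_approx \<pi> n x) (\<tau> n) (c n)"
    using fr by eventually_elim (use \<tau> in \<open>auto simp: stop_def freeze_def\<close>)
  show "limitin J1_topology (\<lambda>n. freeze (step_approx \<pi> n x) (\<tau> n) (c n)) (stop_left x t) sequentially"
  proof (rule limitin_J1_step_approx_left[OF generic_cadlag[OF x] t \<tau>(2,3) c])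
    show "\<forall>\<^sub>F n in sequentially. freeze (step_approx \<pi> n x) (\<tau> n) (c n) \<in> cadlag_paths"
      using fr by eventually_elim (rule generic_cadlag)
  qed (use stop_left_in[OF x, of t] t generic_cadlag in auto)
qed (use assms stop_left_in in auto)

lemma J1_approaching_right_steps:
  assumes x: "x \<in> \<Omega>" and t: "0 \<le> t" and \<tau>: "\<And>n. 0 \<le> \<tau> n" "\<tau> \<longlonglongrightarrow> t" "\<And>n. last_before \<pi> n t \<le> \<tau> n"
    and c: "c \<longlonglongrightarrow> x t"
    and fr: "\<forall>\<^sub>F n in sequentially. freeze (step_approx \<pi> n x) (\<tau> n) (c n) \<in> \<Omega>"
  shows "J1_approaching (filtermap (\<lambda>n. (\<tau> n, freeze (step_approx \<pi> n x) (\<tau> n) (c n))) sequentially)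
    (t, stop x t)"
proof (rule J1_approaching_filtermap)
  show "\<forall>\<^sub>F n in sequentially. 0 \<le> \<tau> n \<and> freeze (step_approx \<pi> n x) (\<tau> n) (c n) \<in> \<Omega> \<and>
      stop (freeze (step_approx \<pi> n x) (\<tau> n) (c n)) (\<tau> n) = freeze (step_approx \<pi> n x) (\<tau> n) (c n)"
    using fr by eventually_elim (use \<tau> in \<open>auto simp: stop_def freeze_def\<close>)
  show "limitin J1_topology (\<lambda>n. freeze (step_approx \<pi> n x) (\<tau> n) (c n)) (stop x t) sequentially"
  proof (rule limitin_J1_step_approx_right[OF generic_cadlag[OF x] t \<tau>(2,3) c])
    show "\<forall>\<^sub>F n in sequentially. freeze (step_approx \<pi> n x) (\<tau> n) (c n) \<in> cadlag_paths"
      using fr by eventually_elim (rule generic_cadlag)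
  qed (use stop_in[OF x t] generic_cadlag in auto)
qed (use assms stop_in in auto)

lemma approaching_J1: "approaching G p \<Longrightarrow> J1_approaching G p"
proof (induction rule: approaching.induct)
  case (left1 x t)
  have "J1_approaching (filtermap (\<lambda>s. (s, freeze x s (left_lim x s))) (at t within {0..t}))
      (t, stop_left x t)"
  proof (rule J1_approaching_left_within)
    assume "0 < t"
    then show "(left_lim x \<longlongrightarrow> left_lim x t) (at t within {0..t})"
      using left1 by (intro left_lim_tendsto_left generic_cadlag tendsto_ident_at)
        (auto simp: eventually_at_filter)
  qed (use left1 stop_left_in in \<open>auto simp: stop_left_eq_freeze\<close>)
  then show ?case by (simp add: stop_left_eq_freeze)
next
  case (left2 x t)
  have "J1_approaching (filtermap (\<lambda>s. (s, freeze x s (x s))) (at t within {0..<t}))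
      (t, stop_left x t)"
  proof (rule J1_approaching_left_within)
    assume "0 < t"
    then show "(x \<longlongrightarrow> left_lim x t) (at t within {0..<t})"
      using left2 by (intro cadlag_tendsto_left generic_cadlag tendsto_ident_at)
        (auto simp: eventually_at_filter)
  qed (use left2 stop_in in \<open>auto simp: stop_eq_freeze\<close>)
  then show ?case by (simp add: stop_eq_freeze)
next
  case (left3 x t \<tau>)
  show ?case
  proof (cases "t = 0")
    case True
    \<comment> \<open>At \<open>t = 0\<close> the times are forced to be 0. The convention x(0-) =
      x(0) makes \<open>stop_left\<close> and \<open>stop\<close> agree there, so the net is treated
      as one from the right.\<close>
    have "\<tau> n = 0" for n using left3(3,5)[of n] last_before_0[of n] True by simp
    then have \<tau>: "\<tau> = (\<lambda>n. 0)" by blast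
    have "J1_approaching (filtermap (\<lambda>n. (\<tau> n, freeze (step_approx \<pi> n x) (\<tau> n)
        (step_approx \<pi> n x 0))) sequentially) (t, stop x t)"
    proof (rule J1_approaching_right_steps)
      show "\<forall>\<^sub>F n in sequentially. freeze (step_approx \<pi> n x) (\<tau> n) (step_approx \<pi> n x 0) \<in> \<Omega>"
        using stop_step_approx_in[OF left3(1-4)] by eventually_elim (simp add: \<tau> stop_eq_freeze)
      show "(\<lambda>n. step_approx \<pi> n x 0) \<longlonglongrightarrow> x t"
        using step_approx_tendsto[OF generic_cadlag[OF left3(1)], of 0] True by simp
    qed (use left3 True last_before_0 in \<open>auto simp: \<tau>\<close>)
    then show ?thesis by (simp add: True \<tau> stop_left_0 stop_eq_freeze)
  next
    case False
    then have t: "0 < t" using left3(2) by simp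
    have "J1_approaching (filtermap (\<lambda>n. (\<tau> n, freeze (step_approx \<pi> n x) (\<tau> n)
        (left_lim (step_approx \<pi> n x) (\<tau> n)))) sequentially) (t, stop_left x t)"
    proof (rule J1_approaching_left_steps)
      show "(\<lambda>n. left_lim (step_approx \<pi> n x) (\<tau> n)) \<longlonglongrightarrow> left_lim x t"
        using left3 t by (intro left_lim_step_approx_tendsto_left generic_cadlag) auto
      show "\<forall>\<^sub>F n in sequentially. freeze (step_approx \<pi> n x) (\<tau> n) (left_lim (step_approx \<pi> n x) (\<tau> n)) \<in> \<Omega>"
        using stop_step_approx_in[OF left3(1-4)] by eventually_elim (simp add: stop_left_eq_freeze)
    qed (use left3 t in \<open>auto intro: less_imp_le\<close>)
    then show ?thesis by (simp add: stop_left_eq_freeze)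
  qed
next
  case (left4 x t \<tau>)
  \<comment> \<open>For \<open>t = 0\<close> the case is vacuous, since no nonnegative time lies
    strictly before 0.\<close>
  have t: "0 < t"
    using left4(2) left4(3,5)[of 0] last_before_0[of 0] by (cases "t = 0") auto
  have "J1_approaching (filtermap (\<lambda>n. (\<tau> n, freeze (step_approx \<pi> n x) (\<tau> n)
      (step_approx \<pi> n x (\<tau> n)))) sequentially) (t, stop_left x t)"
  proof (rule J1_approaching_left_steps)
    show "(\<lambda>n. step_approx \<pi> n x (\<tau> n)) \<longlonglongrightarrow> left_lim x t"
      using left4 t by (intro step_approx_tendsto_left generic_cadlag) auto
    show "\<forall>\<^sub>F n in sequentially. freeze (step_approx \<pi> n x) (\<tau> n) (step_approx \<pi> n x (\<tau> n)) \<in> \<Omega>"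
      using stop_step_approx_in[OF left4(1-4)] by eventually_elim (simp add: stop_eq_freeze)
  qed (use left4 t in \<open>auto intro: less_imp_le\<close>)
  then show ?case by (simp add: stop_eq_freeze)
next
  case (right1 x t)
  have "J1_approaching (filtermap (\<lambda>s. (s, freeze x s (x s))) (at t within {t..})) (t, stop x t)"
  proof (rule J1_approaching_right_within)
    show "(x \<longlongrightarrow> x t) (at t within {t..})"
      using right1 cadlag_tendsto_right[of x t "\<lambda>s. s" "at t within {t..}"]
      by (simp add: generic_cadlag tendsto_ident_at eventually_at_filter)
  qed (use right1 stop_in in \<open>auto simp: stop_eq_freeze\<close>)
  then show ?case by (simp add: stop_eq_freeze)
next
  case (right2 x t)
  have "J1_approaching (filtermap (\<lambda>s. (s, freeze x s (left_lim x s))) (at t within {t<..}))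
      (t, stop x t)"
  proof (rule J1_approaching_right_within)
    show "(left_lim x \<longlongrightarrow> x t) (at t within {t<..})"
      using right2 left_lim_tendsto_right[of x t "\<lambda>s. s" "at_right t"]
      by (simp add: generic_cadlag tendsto_ident_at eventually_at_filter)
  qed (use right2 stop_left_in in \<open>auto simp: stop_left_eq_freeze\<close>)
  then show ?case by (simp add: stop_left_eq_freeze)
next
  case (right3 x t \<tau>)
  have "J1_approaching (filtermap (\<lambda>n. (\<tau> n, freeze (step_approx \<pi> n x) (\<tau> n)
      (step_approx \<pi> n x (\<tau> n)))) sequentially) (t, stop x t)"
  proof (rule J1_approaching_right_steps)
    show "(\<lambda>n. step_approx \<pi> n x (\<tau> n)) \<longlonglongrightarrow> x t"
      using right3 by (intro step_approx_tendsto_right generic_cadlag) auto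
    show "\<forall>\<^sub>F n in sequentially. freeze (step_approx \<pi> n x) (\<tau> n) (step_approx \<pi> n x (\<tau> n)) \<in> \<Omega>"
      using stop_step_approx_in[OF right3(1-4)] by eventually_elim (simp add: stop_eq_freeze)
  qed (use right3 in \<open>auto intro: less_imp_le\<close>)
  then show ?case by (simp add: stop_eq_freeze)
next
  case (right4 x t \<tau>)
  have "J1_approaching (filtermap (\<lambda>n. (\<tau> n, freeze (step_approx \<pi> n x) (\<tau> n)
      (left_lim (step_approx \<pi> n x) (\<tau> n)))) sequentially) (t, stop x t)"
  proof (rule J1_approaching_right_steps)
    show "(\<lambda>n. left_lim (step_approx \<pi> n x) (\<tau> n)) \<longlonglongrightarrow> x t"
      using right4 by (intro left_lim_step_approx_tendsto_right generic_cadlag) auto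
    show "\<forall>\<^sub>F n in sequentially. freeze (step_approx \<pi> n x) (\<tau> n) (left_lim (step_approx \<pi> n x) (\<tau> n)) \<in> \<Omega>"
      using stop_step_approx_in[OF right4(1-4)] by eventually_elim (simp add: stop_left_eq_freeze)
  qed (use right4 in \<open>auto intro: less_imp_le\<close>)
  then show ?case by (simp add: stop_left_eq_freeze)
qed

lemma approaching_stopped: "approaching G p \<Longrightarrow> \<forall>\<^sub>F q in G. q \<in> stopped_paths \<Omega>"
  and approaching_limit_stopped: "approaching G p \<Longrightarrow> p \<in> stopped_paths \<Omega>"
  using approaching_J1[of G p] unfolding J1_approaching_def by simp_all

lemma approaching_limitin_J: "approaching G p \<Longrightarrow> limitin (J_topology \<Omega>) (\<lambda>q. q) p G"
proof -
  assume "approaching G p"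
  then have J: "p \<in> stopped_paths \<Omega>" "\<forall>\<^sub>F q in G. q \<in> stopped_paths \<Omega>"
     "(fst \<longlongrightarrow> fst p) G" "limitin J1_topology snd (snd p) G"
    using approaching_J1 by (auto simp: J1_approaching_def)
  have "\<forall>\<^sub>F q in G. fst q \<in> {0..}"
    using J(2) by eventually_elim (use stopped_paths_cadlag in \<open>force simp: split_paired_all\<close>)
  moreover have "fst p \<in> {0..}" using J(1) stopped_paths_cadlag by (cases p) auto
  ultimately show ?thesis
    using J by (simp add: J_topology_def limitin_subtopology limitin_pairwise o_def)
qed

lemma J1_continuous_in_pi_functionals:
  assumes "continuous_map (J_topology \<Omega>) euclideanreal F"
  shows "F \<in> pi_functionals \<pi> \<Omega>"
  unfolding pi_functionals_iff
proof (intro allI impI)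
  fix G p assume "approaching G p"
  then have "limitin euclideanreal (F \<circ> (\<lambda>q. q)) (F p) G"
    by (intro continuous_map_limit[OF assms] approaching_limitin_J)
  then show "(F \<longlongrightarrow> F p) G" by (simp add: o_def)
qed

section \<open>Continuous functionals of the initial topology\<close>

lemma topspace_pi_topology: "topspace (pi_topology \<pi> \<Omega>) = stopped_paths \<Omega>"
proof -
  have "(\<lambda>_. 0) \<in> pi_functionals \<pi> \<Omega>" by (simp add: pi_functionals_iff)
  then have "(\<lambda>_. 0) -` UNIV \<inter> stopped_paths \<Omega> \<in>
      {F -` V \<inter> stopped_paths \<Omega> | F V. F \<in> pi_functionals \<pi> \<Omega> \<and> open V}"
    by blast
  then show ?thesis unfolding pi_topology_def topology_generated_by_topspace by auto
qed

lemma pi_functionals_continuous: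
  assumes "F \<in> pi_functionals \<pi> \<Omega>"
  shows "continuous_map (pi_topology \<pi> \<Omega>) euclideanreal F"
  unfolding continuous_map_def topspace_pi_topology
proof (intro conjI allI impI)
  fix V :: "real set" assume "openin euclideanreal V"
  then have "F -` V \<inter> stopped_paths \<Omega> \<in>
      {F -` V \<inter> stopped_paths \<Omega> | F V. F \<in> pi_functionals \<pi> \<Omega> \<and> open V}"
    using assms by auto
  then have "openin (pi_topology \<pi> \<Omega>) (F -` V \<inter> stopped_paths \<Omega>)"
    unfolding pi_topology_def by (rule topology_generated_by_Basis)
  moreover have "{p \<in> stopped_paths \<Omega>. F p \<in> V} = F -` V \<inter> stopped_paths \<Omega>" by auto
  ultimately show "openin (pi_topology \<pi> \<Omega>) {p \<in> stopped_paths \<Omega>. F p \<in> V}" by simp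
qed auto

text \<open>The sets that contain \<open>G\<close> eventually whenever they contain \<open>p\<close>
  include the generating sets and are stable under finite intersections and unions. This yields the
  less obvious half of \<open>pi_continuous_iff\<close>: the initial topology makes no further
  functional continuous.\<close>

lemma approaching_limitin_pi:
  assumes "approaching G p"
  shows "limitin (pi_topology \<pi> \<Omega>) (\<lambda>q. q) p G"
  unfolding limitin_def topspace_pi_topology
proof (intro conjI allI impI)
  show "p \<in> stopped_paths \<Omega>" using assms by (rule approaching_limit_stopped)
  fix U assume U: "openin (pi_topology \<pi> \<Omega>) U \<and> p \<in> U"
  then have "generate_topology_on
      {F -` V \<inter> stopped_paths \<Omega> | F V. F \<in> pi_functionals \<pi> \<Omega> \<and> open V} U"
    by (simp add: pi_topology_def openin_topology_generated_by_iff)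
  then have "p \<in> U \<longrightarrow> eventually (\<lambda>q. q \<in> U) G"
  proof (induction rule: generate_topology_on.induct)
    case (Int a b)
    then show ?case by (auto intro: eventually_conj)
  next
    case (UN K)
    show ?case
    proof
      assume "p \<in> \<Union>K"
      then obtain k where "k \<in> K" "p \<in> k" by blast
      with UN have "eventually (\<lambda>q. q \<in> k) G" by blast
      then show "eventually (\<lambda>q. q \<in> \<Union>K) G" by eventually_elim (use \<open>k \<in> K\<close> in blast)
    qed
  next
    case (Basis s)
    then obtain F V where s: "s = F -` V \<inter> stopped_paths \<Omega>" "F \<in> pi_functionals \<pi> \<Omega>" "open V"
      by blast
    then have "(F \<longlongrightarrow> F p) G" using assms unfolding pi_functionals_iff by blast
    with s show ?case
      using approaching_stopped[OF assms] by (auto simp: tendsto_def intro: eventually_conj)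
  qed simp
  then show "eventually (\<lambda>q. q \<in> U) G" using U by simp
qed

lemma pi_continuous_iff:
  "continuous_map (pi_topology \<pi> \<Omega>) euclideanreal F \<longleftrightarrow> F \<in> pi_functionals \<pi> \<Omega>"
proof
  assume F: "continuous_map (pi_topology \<pi> \<Omega>) euclideanreal F"
  show "F \<in> pi_functionals \<pi> \<Omega>"
    unfolding pi_functionals_iff
  proof (intro allI impI)
    fix G p assume "approaching G p"
    then have "limitin euclideanreal (F \<circ> (\<lambda>q. q)) (F p) G"
      by (intro continuous_map_limit[OF F] approaching_limitin_pi)
    then show "(F \<longlongrightarrow> F p) G" by (simp add: o_def)
  qed
qed (rule pi_functionals_continuous)

end

section \<open>Skorokhod limits and quadratic variation\<close>

text \<open>The two limits are compared at nearby points \<open>r\<close> and \<open>r'\<close> with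
  the same image under the two time changes. Both points are kept strictly to the right of
  \<open>s\<close>, where right continuity of both limits is available.\<close>

lemma limitin_J1_unique:
  assumes "limitin J1_topology X q sequentially" "limitin J1_topology X q' sequentially"
  shows "q = q'"
proof
  fix s :: real
  have q: "q \<in> cadlag_paths" "q' \<in> cadlag_paths"
    using assms by (auto simp: limitin_J1_nbhd)
  show "q s = q' s"
  proof (cases "0 \<le> s")
    case False
    then show ?thesis using q by (simp add: cadlag_paths_def)
  next
    case True
    have "norm (q s - q' s) \<le> 0 + e" if e: "0 < e" for e
    proof -
      have "0 < e / 4" using e by simp
      obtain d where d: "0 < d" "\<And>r. s \<le> r \<Longrightarrow> r < s + d \<Longrightarrow> norm (q r - q s) < e / 4"
        using cadlag_right[OF q(1) True \<open>0 < e / 4\<close>] by metis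
      obtain d' where d': "0 < d'" "\<And>r. s \<le> r \<Longrightarrow> r < s + d' \<Longrightarrow> norm (q' r - q' s) < e / 4"
        using cadlag_right[OF q(2) True \<open>0 < e / 4\<close>] by metis
      define m where "m = min d d'"
      \<comment> \<open>With displacements below \<open>m / 8\<close> the point \<open>r'\<close> is
        within \<open>m / 4\<close> of \<open>r\<close>, hence inside (s, s + m). Four errors of at
        most \<open>e / 4\<close> then add up.\<close>
      define r where "r = s + m / 2"
      define \<eta> where "\<eta> = min (e / 4) (m / 8)"
      have m: "0 < m" "m \<le> d" "m \<le> d'" using d(1) d'(1) by (auto simp: m_def)
      have \<eta>: "0 < \<eta>" "\<eta> \<le> e / 4" "\<eta> \<le> m / 8" using m(1) e by (auto simp: \<eta>_def)
      have "\<forall>\<^sub>F n in sequentially. X n \<in> J1_nbhd q (s + m) \<eta> \<and> X n \<in> J1_nbhd q' (s + m) \<eta>"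
        using assms \<eta>(1) by (auto simp: limitin_J1_nbhd intro: eventually_conj)
      then obtain n where "X n \<in> J1_nbhd q (s + m) \<eta>" "X n \<in> J1_nbhd q' (s + m) \<eta>"
        using eventually_happens[of _ sequentially] by auto
      then obtain l l' c c' where l: "time_change l" "c < \<eta>" "\<And>s. 0 \<le> s \<Longrightarrow> \<bar>l s - s\<bar> \<le> c"
          "\<And>u. u \<in> {0..s + m} \<Longrightarrow> norm (X n (l u) - q u) \<le> c"
        and l': "time_change l'" "c' < \<eta>" "\<And>s. 0 \<le> s \<Longrightarrow> \<bar>l' s - s\<bar> \<le> c'"
          "\<And>u. u \<in> {0..s + m} \<Longrightarrow> norm (X n (l' u) - q' u) \<le> c'"
        unfolding J1_nbhd_def by blast
      have r: "0 \<le> r" using True m by (simp add: r_def)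
      obtain r' where r': "0 \<le> r'" "l' r' = l r"
        using time_change_surj[OF l'(1) time_change_nonneg[OF l(1) r]] .
      have "\<bar>r' - r\<bar> \<le> c + c'" using l(3)[OF r] l'(3)[OF r'(1)] r'(2) by linarith
      then have "s < r'" "r' < s + m" using l(2) l'(2) \<eta>(3) m(1) unfolding r_def abs_le_iff by linarith+
      then have "norm (q' r' - q' s) < e / 4" "norm (X n (l r) - q' r') \<le> c'"
        using d'(2)[of r'] l'(4)[of r'] m r' by auto
      moreover have "norm (q r - q s) < e / 4" "norm (X n (l r) - q r) \<le> c"
        using d(2)[of r] l(4)[of r] m True unfolding r_def by auto
      moreover have "norm (q s - q' s) =
          norm ((q' r' - q' s) - (q r - q s) + ((X n (l r) - q' r') - (X n (l r) - q r)))"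
        by simp
      ultimately show ?thesis
        using norm_triangle_ineq[of "(q' r' - q' s) - (q r - q s)" "(X n (l r) - q' r') - (X n (l r) - q r)"]
          norm_triangle_ineq4[of "q' r' - q' s" "q r - q s"]
          norm_triangle_ineq4[of "X n (l r) - q' r'" "X n (l r) - q r"] l(2) l'(2) \<eta>(2)
        by linarith
    qed
    then have "norm (q s - q' s) \<le> 0" by (rule field_le_epsilon)
    then show ?thesis by simp
  qed
qed

text \<open>A continuous limit absorbs the time change: \<open>v n\<close> is the image of a point
  near \<open>t\<close>, where \<open>q\<close> is close to \<open>q t\<close>. This allows
  quadratic variations to be evaluated along moving partition points.\<close>

lemma limitin_J1_continuous:
  assumes lim: "limitin J1_topology X q sequentially" and cont: "continuous_on {0..} q"
    and v: "v \<longlonglongrightarrow> t" "\<And>n. 0 \<le> v n"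
  shows "(\<lambda>n. X n (v n)) \<longlonglongrightarrow> q t"
  unfolding tendsto_iff
proof (intro allI impI)
  fix e :: real assume "0 < e"
  have t: "0 \<le> t" using v by (intro LIMSEQ_le_const[of v]) auto
  obtain d where d: "0 < d" "\<And>u. 0 \<le> u \<Longrightarrow> dist u t < d \<Longrightarrow> dist (q u) (q t) < e / 2"
    using cont t \<open>0 < e\<close> unfolding continuous_on_iff by (metis atLeast_iff half_gt_zero)
  \<comment> \<open>The preimage of \<open>v n\<close> lies within \<open>2 * \<eta>\<close> of
    \<open>t\<close>: at most \<open>d\<close> for the continuity of \<open>q\<close>, at most 2 for
    the horizon \<open>t + 2\<close>.\<close>
  define \<eta> where "\<eta> = min 1 (min (e / 2) (d / 2))"
  have \<eta>: "0 < \<eta>" "\<eta> \<le> 1" "\<eta> \<le> e / 2" "\<eta> \<le> d / 2" using d(1) \<open>0 < e\<close> by (auto simp: \<eta>_def)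
  have "\<forall>\<^sub>F n in sequentially. X n \<in> J1_nbhd q (t + 2) \<eta>"
    using lim \<eta>(1) by (simp add: limitin_J1_nbhd)
  moreover have "\<forall>\<^sub>F n in sequentially. dist (v n) t < \<eta>"
    using v(1) \<eta>(1) unfolding tendsto_iff by blast
  ultimately show "\<forall>\<^sub>F n in sequentially. dist (X n (v n)) (q t) < e"
  proof eventually_elim
    case (elim n)
    then obtain l c where l: "time_change l" "c < \<eta>" "\<And>s. 0 \<le> s \<Longrightarrow> \<bar>l s - s\<bar> \<le> c"
        "\<And>u. u \<in> {0..t + 2} \<Longrightarrow> norm (X n (l u) - q u) \<le> c"
      unfolding J1_nbhd_def by blast
    obtain u where u: "0 \<le> u" "l u = v n" using time_change_surj[OF l(1) v(2)] .
    have "\<bar>v n - u\<bar> \<le> c" using l(3)[OF u(1)] u(2) by simp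
    then have ut: "dist u t < 2 * \<eta>"
      using elim(2) l(2) unfolding dist_real_def by linarith
    then have "dist (q u) (q t) < e / 2" using u(1) \<eta>(4) by (intro d(2)) auto
    moreover have "dist (X n (v n)) (q u) \<le> c"
      using l(4)[of u] u ut \<eta>(2) unfolding dist_real_def by (auto simp: dist_norm)
    ultimately show ?case
      using dist_triangle[of "X n (v n)" "q t" "q u"] l(2) \<eta>(3) by linarith
  qed
qed

lemma qv_limit:
  assumes "x \<in> qv_paths \<pi>"
  shows "limitin J1_topology (\<lambda>n. qv_approx \<pi> n x) (qv \<pi> x) sequentially"
proof -
  obtain q where q: "limitin J1_topology (\<lambda>n. qv_approx \<pi> n x) q sequentially"
    using assms by (auto simp: qv_paths_def)
  show ?thesis
    unfolding qv_def by (rule theI[of _ q]) (use q limitin_J1_unique in blast)+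
qed

lemma qv_approx_component:
  "qv_approx \<pi> n x t $ a $ b = (\<Sum>i | i < length (\<pi> n) - 1 \<and> \<pi> n ! i \<le> t.
     (x (\<pi> n ! Suc i) - x (\<pi> n ! i)) $ a * (x (\<pi> n ! Suc i) - x (\<pi> n ! i)) $ b)"
  by (simp add: qv_approx_def Let_def matrix_matrix_mult_def columnvector_def rowvector_def)

section \<open>From the quadratic variation to properties of the path\<close>

context partitions
begin

text \<open>The cells starting after \<open>last_before \<pi> n u\<close> and not after
  \<open>u\<close> reduce to the single cell starting at the partition point
  \<open>u\<close>.\<close>

lemma qv_approx_jump:
  assumes "0 < u" "u \<in> set (\<pi> n)" "u < last (\<pi> n)"
  shows "qv_approx \<pi> n x u $ a $ b - qv_approx \<pi> n x (last_before \<pi> n u) $ a $ b =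
    (x (next_after \<pi> n u) - x u) $ a * (x (next_after \<pi> n u) - x u) $ b"
proof -
  obtain i where i: "Suc i < length (\<pi> n)" "\<pi> n ! i \<le> u" "u < \<pi> n ! Suc i"
    using partition_index[of u n] assms by auto
  obtain j where j: "j < length (\<pi> n)" "\<pi> n ! j = u" using assms(2) by (auto simp: in_set_conv_nth)
  have "\<not> i < j" using partition_nth_le[of "Suc i" j n] i j by auto
  moreover have "\<not> j < i" using partition_nth_less[of j i n] i j by auto
  ultimately have iu: "\<pi> n ! i = u" using j(2) by (metis linorder_neqE_nat)
  have eq: "{k. k < length (\<pi> n) - 1 \<and> \<pi> n ! k \<le> u} =
      insert i {k. k < length (\<pi> n) - 1 \<and> \<pi> n ! k \<le> last_before \<pi> n u}" (is "?A = insert i ?B")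
  proof (intro equalityI subsetI)
    fix k assume k: "k \<in> ?A"
    show "k \<in> insert i ?B"
    proof (cases "k = i")
      case False
      have kl: "k < length (\<pi> n)" "\<pi> n ! k \<le> u" using k by auto
      then have "\<not> i < k" using partition_nth_le[of "Suc i" k n] i by force
      with False have "\<pi> n ! k < u" using partition_nth_less[of k i n] i iu by force
      then show ?thesis using k assms(1) by (auto intro!: last_before_greatest)
    qed simp
  next
    fix k assume "k \<in> insert i ?B"
    then show "k \<in> ?A" using i last_before_in(2)[OF assms(1), of n] by auto
  qed
  have "i \<notin> ?B" using iu last_before_in(2)[OF assms(1), of n] by auto
  then show ?thesis
    unfolding qv_approx_component eq next_after_nth[OF i] using iu by simp
qed

text \<open>The increment of x over the cell from \<open>u n\<close> to the first partition point
  not before \<open>t\<close> tends to the jump at \<open>t\<close>. Its squared components are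
  diagonal increments of the approximate quadratic variation between two times tending to
  \<open>t\<close>, and these vanish in the limit by continuity.\<close>

lemma left_lim_eq_of_qv_continuous:
  assumes x: "x \<in> qv_paths \<pi>" and cont: "continuous_on {0..} (qv \<pi> x)" and t: "0 < t"
  shows "left_lim x t = x t"
proof -
  have cad: "x \<in> cadlag_paths" using x by (simp add: qv_paths_def)
  define u where "u n = last_before \<pi> n t" for n
  have u: "u \<longlonglongrightarrow> t" "\<And>n. 0 \<le> u n" "\<And>n. u n < t" "\<And>n. u n \<in> set (\<pi> n)"
    using last_before_tendsto[of t] t last_before_nonneg last_before_in by (auto simp: u_def[abs_def])
  have ev: "\<forall>\<^sub>F n in sequentially. 0 < u n \<and> u n < last (\<pi> n)"
  proof -
    have "\<forall>\<^sub>F n in sequentially. 0 < u n" using u(1) t by (rule order_tendstoD)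
    with eventually_next_after[OF zero_less_one, of t] show ?thesis
      by eventually_elim (use u(3) in \<open>auto intro: less_trans\<close>)
  qed
  have "left_lim x t $ a = x t $ a" for a
  proof -
    define D where "D n = (x (next_after \<pi> n (u n)) - x (u n)) $ a" for n
    have "(\<lambda>n. x (next_after \<pi> n (u n))) \<longlonglongrightarrow> x t"
    proof (rule cadlag_tendsto_right[OF cad _ next_after_tendsto[OF u(2,1)]])
      show "\<forall>\<^sub>F n in sequentially. t \<le> next_after \<pi> n (u n)"
        using ev
      proof eventually_elim
        case (elim n)
        then show ?case
          using next_after_in[of "u n" n] t by (intro last_before_less_imp[of t _ n]) (auto simp: u_def)
      qed
    qed (use t in simp)
    moreover have "(\<lambda>n. x (u n)) \<longlonglongrightarrow> left_lim x t"
      using u by (intro cadlag_tendsto_left[OF cad t]) auto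
    ultimately have "D \<longlonglongrightarrow> (x t - left_lim x t) $ a"
      unfolding D_def by (intro tendsto_vec_nth tendsto_diff)
    then have 1: "(\<lambda>n. D n * D n) \<longlonglongrightarrow> (x t - left_lim x t) $ a * (x t - left_lim x t) $ a"
      by (intro tendsto_mult)
    have "(\<lambda>n. qv_approx \<pi> n x (u n) $ a $ a - qv_approx \<pi> n x (last_before \<pi> n (u n)) $ a $ a)
        \<longlonglongrightarrow> qv \<pi> x t $ a $ a - qv \<pi> x t $ a $ a"
      by (intro tendsto_vec_nth tendsto_diff limitin_J1_continuous[OF qv_limit[OF x] cont]
          last_before_tendsto_seq last_before_nonneg u)
    then have "(\<lambda>n. D n * D n) \<longlonglongrightarrow> qv \<pi> x t $ a $ a - qv \<pi> x t $ a $ a"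
    proof (rule Lim_transform_eventually)
      show "\<forall>\<^sub>F n in sequentially. qv_approx \<pi> n x (u n) $ a $ a -
          qv_approx \<pi> n x (last_before \<pi> n (u n)) $ a $ a = D n * D n"
        using ev by eventually_elim (simp add: qv_approx_jump u(4) D_def)
    qed
    from LIMSEQ_unique[OF 1 this] show ?thesis by simp
  qed
  then show ?thesis by (simp add: vec_eq_iff)
qed

lemma continuous_of_qv_continuous:
  assumes x: "x \<in> qv_paths \<pi>" and cont: "continuous_on {0..} (qv \<pi> x)"
  shows "continuous_on {0..} x"
  unfolding continuous_on_iff
proof (intro ballI allI impI)
  fix t e :: real assume t: "t \<in> {0..}" and e: "0 < e"
  have cad: "x \<in> cadlag_paths" using x by (simp add: qv_paths_def)
  obtain d where d: "0 < d" "\<And>r. t \<le> r \<Longrightarrow> r < t + d \<Longrightarrow> norm (x r - x t) < e"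
    using cadlag_right[OF cad _ e, of t] t by auto
  have "\<exists>d'>0. \<forall>r. 0 \<le> r \<and> t - d' < r \<and> r < t \<longrightarrow> norm (x r - x t) < e"
  proof (cases "t = 0")
    case False
    then have "0 < t" using t by simp
    then show ?thesis
      using cadlag_left[OF cad _ e, of t] left_lim_eq_of_qv_continuous[OF assms, of t] by metis
  qed (auto intro: exI[of _ 1])
  then obtain d' where d': "0 < d'"
      "\<And>r. 0 \<le> r \<Longrightarrow> t - d' < r \<Longrightarrow> r < t \<Longrightarrow> norm (x r - x t) < e"
    by blast
  have "dist (x r) (x t) < e" if "0 \<le> r" "dist r t < min d d'" for r
    using that d(2)[of r] d'(2)[of r] unfolding dist_real_def dist_norm by (cases "t \<le> r") auto
  then show "\<exists>d>0. \<forall>r\<in>{0..}. dist r t < d \<longrightarrow> dist (x r) (x t) < e"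
    using d(1) d'(1) by (intro exI[of _ "min d d'"]) auto
qed

text \<open>The sum telescopes as long as cells start no later than \<open>c\<close>. The bound by
  \<open>\<pi> n ! m\<close> is carried along for the induction; \<open>b\<close> is the bound of
  interest.\<close>

lemma sum_increments_le:
  assumes "\<And>i. Suc i < length (\<pi> n) \<Longrightarrow> \<pi> n ! i \<le> c \<Longrightarrow> \<pi> n ! Suc i \<le> b" "0 \<le> b" "m < length (\<pi> n)"
  shows "(\<Sum>i<m. if \<pi> n ! i \<le> c then \<pi> n ! Suc i - \<pi> n ! i else 0) \<le> min (\<pi> n ! m) b"
  using assms(3)
proof (induction m)
  case 0
  then show ?case using assms(2) partition_nth_0 by simp
next
  case (Suc m)
  then show ?case
    using assms(1)[of m] partition_nth_less[of m "Suc m" n] by auto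
qed

text \<open>On an affine stretch each summand is a fixed constant times the squared cell length, so
  the sum is at most mesh times total length, up to that constant, and tends to 0.\<close>

lemma qv_eq_of_affine:
  assumes x: "x \<in> qv_paths \<pi>" and cont: "continuous_on {0..} (qv \<pi> x)"
    and ab: "0 \<le> a" "a < a'" "a' < b'" "b' < b"
    and aff: "\<And>s. a \<le> s \<Longrightarrow> s < b \<Longrightarrow> x s = c + s *\<^sub>R w"
  shows "qv \<pi> x a' = qv \<pi> x b'"
proof -
  have "qv \<pi> x b' $ i $ j - qv \<pi> x a' $ i $ j = 0" for i j
  proof -
    define D where "D n = qv_approx \<pi> n x b' $ i $ j - qv_approx \<pi> n x a' $ i $ j" for n
    have "D \<longlonglongrightarrow> qv \<pi> x b' $ i $ j - qv \<pi> x a' $ i $ j"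
      unfolding D_def using ab
      by (intro tendsto_vec_nth tendsto_diff limitin_J1_continuous[OF qv_limit[OF x] cont]) auto
    moreover have "D \<longlonglongrightarrow> 0"
      unfolding tendsto_iff
    proof (intro allI impI)
      fix e :: real assume e: "0 < e"
      define k where "k = \<bar>w $ i * w $ j\<bar>"
      \<comment> \<open>A mesh below \<open>b - b'\<close> makes every cell that starts by
        \<open>b'\<close> end where x is still affine. The other bound gives
        \<open>d * k * b < e\<close>; the summand 1 keeps the denominator positive if
        \<open>k = 0\<close> and the estimate strict.\<close>
      define d where "d = min (b - b') (e / (b * k + 1))"
      have k: "0 \<le> k" "0 < b * k + 1" using ab by (auto simp: k_def add_nonneg_pos)
      then have d: "0 < d" "d \<le> b - b'" "d \<le> e / (b * k + 1)" using ab e by (auto simp: d_def)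
      from eventually_next_after[OF d(1), of b'] show "\<forall>\<^sub>F n in sequentially. dist (D n) 0 < e"
      proof eventually_elim
        case (elim n)
        define f where "f l = (x (\<pi> n ! Suc l) - x (\<pi> n ! l)) $ i * (x (\<pi> n ! Suc l) - x (\<pi> n ! l)) $ j" for l
        define S where "S r = {l. l < length (\<pi> n) - 1 \<and> \<pi> n ! l \<le> r}" for r
        define g where "g l = \<pi> n ! Suc l - \<pi> n ! l" for l
        have mesh: "0 < g l \<and> g l < d \<and> \<pi> n ! Suc l \<le> b"
          if "Suc l < length (\<pi> n)" "\<pi> n ! l \<le> b'" for l
        proof -
          have "\<pi> n ! l \<in> {0..b'}" using that partition_nonneg[of "\<pi> n ! l" n] by auto
          then have "next_after \<pi> n (\<pi> n ! l) < \<pi> n ! l + d" using elim by blast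
          moreover have less: "\<pi> n ! l < \<pi> n ! Suc l" using that partition_nth_less by simp
          ultimately show ?thesis
            using next_after_nth[OF that(1) order_refl less] d(2) that(2) by (auto simp: g_def)
        qed
        have fin: "finite (S r)" for r by (simp add: S_def)
        have sub: "S a' \<subseteq> S b'" using ab by (auto simp: S_def)
        have "D n = sum f (S b') - sum f (S a')"
          by (simp add: D_def qv_approx_component f_def S_def)
        also have "\<dots> = sum f (S b' - S a')" using fin sub by (simp add: sum_diff)
        also have "\<bar>\<dots>\<bar> \<le> (\<Sum>l\<in>S b' - S a'. d * k * g l)"
        proof (rule order_trans[OF sum_abs sum_mono])
          fix l assume l: "l \<in> S b' - S a'"
          then have m: "0 < g l" "g l < d" "\<pi> n ! Suc l \<le> b" using mesh[of l] by (auto simp: S_def)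
          have "x (\<pi> n ! l) = c + (\<pi> n ! l) *\<^sub>R w" using l ab by (intro aff) (auto simp: S_def)
          moreover have "x (\<pi> n ! Suc l) = c + (\<pi> n ! Suc l) *\<^sub>R w"
          proof (rule aff)
            show "a \<le> \<pi> n ! Suc l" using l ab m(1) by (auto simp: S_def g_def)
            show "\<pi> n ! Suc l < b" using l m(2) d(2) by (auto simp: S_def g_def)
          qed
          ultimately have "x (\<pi> n ! Suc l) - x (\<pi> n ! l) = g l *\<^sub>R w"
            by (simp add: g_def scaleR_diff_left)
          then have "f l = (g l * g l) * (w $ i * w $ j)" by (simp add: f_def)
          then have "\<bar>f l\<bar> = (g l * g l) * k" by (simp add: k_def abs_mult)
          also have "\<dots> \<le> (d * g l) * k" using m k by (intro mult_right_mono) auto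
          finally show "\<bar>f l\<bar> \<le> d * k * g l" by (simp add: algebra_simps)
        qed
        also have "\<dots> = d * k * (\<Sum>l\<in>S b' - S a'. g l)" by (simp add: sum_distrib_left)
        also have "(\<Sum>l\<in>S b' - S a'. g l) \<le> sum g (S b')"
          using fin mesh by (intro sum_mono2) (auto simp: S_def intro!: less_imp_le)
        also have "sum g (S b') = (\<Sum>l<length (\<pi> n) - 1. if \<pi> n ! l \<le> b' then g l else 0)"
          unfolding S_def by (subst sum.inter_filter[symmetric]) (auto intro: sum.cong)
        also have "\<dots> \<le> b"
        proof -
          have "(\<Sum>l<length (\<pi> n) - 1. if \<pi> n ! l \<le> b' then \<pi> n ! Suc l - \<pi> n ! l else 0)
              \<le> min (\<pi> n ! (length (\<pi> n) - 1)) b"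
            by (rule sum_increments_le) (use mesh ab partition_nonempty[of n] in auto)
          then show ?thesis unfolding g_def by simp
        qed
        finally have "\<bar>D n\<bar> \<le> d * k * b" using d k by (simp add: mult_left_mono)
        also have "\<dots> < d * (b * k + 1)" using d(1) by (simp add: algebra_simps)
        also have "\<dots> \<le> e" using d(3) k(2) by (simp add: pos_le_divide_eq)
        finally show ?case by simp
      qed
    qed
    ultimately show ?thesis by (rule LIMSEQ_unique)
  qed
  then show ?thesis by (simp add: vec_eq_iff)
qed

text \<open>Serves twice: \<open>w = 0\<close> shows that x is not constant on any interval, and
  general \<open>w\<close> separates x from its interpolation on the first cell.\<close>

lemma not_affine:
  assumes x: "x \<in> qv_paths \<pi>" "continuous_on {0..} (qv \<pi> x)" "strictly_increasing (qv \<pi> x)"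
    and ab: "0 \<le> a" "a < b"
  shows "\<exists>s\<ge>a. s < b \<and> x s \<noteq> c + s *\<^sub>R w"
proof (rule ccontr)
  assume "\<not> ?thesis"
  then have aff: "\<And>s. a \<le> s \<Longrightarrow> s < b \<Longrightarrow> x s = c + s *\<^sub>R w" by blast
  \<comment> \<open>Thirds, since the comparison needs two points strictly inside the affine
    stretch.\<close>
  define a' b' where "a' = (2 * a + b) / 3" and "b' = (a + 2 * b) / 3"
  have "a < a'" "a' < b'" "b' < b" using ab by (auto simp: a'_def b'_def)
  then have "qv \<pi> x a' = qv \<pi> x b'" using qv_eq_of_affine[OF x(1,2) ab(1) _ _ _ aff] by blast
  moreover have "qv \<pi> x a' \<noteq> qv \<pi> x b'"
    using x(3) \<open>a < a'\<close> \<open>a' < b'\<close> ab(1) unfolding strictly_increasing_def by auto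
  ultimately show False by simp
qed

section \<open>Linear interpolation\<close>

lemma linear_interpolation_eq:
  assumes "Suc i < length (\<pi> n)" "\<pi> n ! i \<le> s" "s < \<pi> n ! Suc i"
  shows "linear_interpolation \<pi> n x s = x (\<pi> n ! i) +
    ((s - \<pi> n ! i) / (\<pi> n ! Suc i - \<pi> n ! i)) *\<^sub>R (x (\<pi> n ! Suc i) - x (\<pi> n ! i))"
proof -
  have "s < last (\<pi> n)"
    using assms partition_nth_le_last[of "Suc i" n] by simp
  then show ?thesis
    unfolding linear_interpolation_def
    by (subst partition_sum[OF assms]) simp
qed

lemma linear_interpolation_last:
  assumes "last (\<pi> n) \<le> s"
  shows "linear_interpolation \<pi> n x s = x (last (\<pi> n))"
proof -
  have "indicator {\<pi> n ! i..<\<pi> n ! Suc i} s = (0::real)" if "i < length (\<pi> n) - 1" for i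
  proof -
    have "\<pi> n ! Suc i \<le> last (\<pi> n)" using that by (intro partition_nth_le_last) simp
    then show ?thesis using assms by (simp add: indicator_def)
  qed
  then have "(\<Sum>i<length (\<pi> n) - 1. indicator {\<pi> n ! i..<\<pi> n ! Suc i} s *\<^sub>R
      (x (\<pi> n ! i) + ((s - \<pi> n ! i) / (\<pi> n ! Suc i - \<pi> n ! i)) *\<^sub>R
        (x (\<pi> n ! Suc i) - x (\<pi> n ! i)))) = 0"
    by (intro sum.neutral ballI) (simp only: lessThan_iff scaleR_zero_left)
  then show ?thesis using assms unfolding linear_interpolation_def by simp
qed

lemma linear_interpolation_node:
  assumes "i < length (\<pi> n)"
  shows "linear_interpolation \<pi> n x (\<pi> n ! i) = x (\<pi> n ! i)"
proof (cases "Suc i < length (\<pi> n)")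
  case True
  then show ?thesis using partition_nth_less[of i "Suc i" n] by (simp add: linear_interpolation_eq)
next
  case False
  then have "i = length (\<pi> n) - 1" using assms by linarith
  then have "last (\<pi> n) = \<pi> n ! i" using partition_last[of n] by simp
  then show ?thesis using linear_interpolation_last[of n "\<pi> n ! i" x] by simp
qed

lemma continuous_linear_interpolation: "continuous_on {0..} (linear_interpolation \<pi> n x)"
proof -
  have "continuous_on (\<Union>i\<in>{..<length (\<pi> n) - 1}. {\<pi> n ! i..\<pi> n ! Suc i}) (linear_interpolation \<pi> n x)"
  proof (rule continuous_on_closed_Union)
    fix i assume "i \<in> {..<length (\<pi> n) - 1}"
    then have i: "Suc i < length (\<pi> n)" by auto
    then have less: "\<pi> n ! i < \<pi> n ! Suc i" using partition_nth_less by simp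
    have "continuous_on {\<pi> n ! i..\<pi> n ! Suc i} (\<lambda>s. x (\<pi> n ! i) +
        ((s - \<pi> n ! i) / (\<pi> n ! Suc i - \<pi> n ! i)) *\<^sub>R (x (\<pi> n ! Suc i) - x (\<pi> n ! i)))"
      using less by (intro continuous_intros) auto
    then show "continuous_on {\<pi> n ! i..\<pi> n ! Suc i} (linear_interpolation \<pi> n x)"
    proof (rule continuous_on_eq)
      fix s assume s: "s \<in> {\<pi> n ! i..\<pi> n ! Suc i}"
      show "x (\<pi> n ! i) + ((s - \<pi> n ! i) / (\<pi> n ! Suc i - \<pi> n ! i)) *\<^sub>R (x (\<pi> n ! Suc i) - x (\<pi> n ! i))
          = linear_interpolation \<pi> n x s"
        using s less linear_interpolation_eq[OF i, of s x] linear_interpolation_node[OF i, of x]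
        by (cases "s = \<pi> n ! Suc i") auto
    qed
  qed auto
  moreover have "continuous_on {last (\<pi> n)..} (linear_interpolation \<pi> n x)"
    by (rule continuous_on_eq[OF continuous_on_const[of _ "x (last (\<pi> n))"]])
      (simp add: linear_interpolation_last)
  ultimately have "continuous_on ((\<Union>i\<in>{..<length (\<pi> n) - 1}. {\<pi> n ! i..\<pi> n ! Suc i}) \<union> {last (\<pi> n)..})
      (linear_interpolation \<pi> n x)"
    by (intro continuous_on_closed_Un closed_UN) auto
  then show ?thesis
  proof (rule continuous_on_subset, intro subsetI)
    fix s :: real assume s: "s \<in> {0..}"
    show "s \<in> (\<Union>i\<in>{..<length (\<pi> n) - 1}. {\<pi> n ! i..\<pi> n ! Suc i}) \<union> {last (\<pi> n)..}"
    proof (cases "s < last (\<pi> n)")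
      case True
      then obtain i where i: "Suc i < length (\<pi> n)" "\<pi> n ! i \<le> s" "s < \<pi> n ! Suc i"
        using partition_index s by auto
      then have "i \<in> {..<length (\<pi> n) - 1}" by auto
      with i show ?thesis by (intro UnI1 UN_I[of i]) auto
    qed auto
  qed
qed

text \<open>The error at \<open>s\<close> is a convex combination of the differences between x at
  the two ends of the cell and x at \<open>s\<close>. A mesh below 1 keeps the right end within
  [0, T + 1], where x is uniformly continuous.\<close>

lemma linear_interpolation_approx:
  assumes cont: "continuous_on {0..} x" and e: "0 < e"
  shows "\<forall>\<^sub>F n in sequentially. \<forall>s\<in>{0..T}. norm (linear_interpolation \<pi> n x s - x s) \<le> e"
proof -
  have "uniformly_continuous_on {0..T + 1} x"
    using cont by (intro compact_uniformly_continuous) (auto intro: continuous_on_subset)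
  then obtain d where d: "0 < d"
      "\<And>r s. r \<in> {0..T + 1} \<Longrightarrow> s \<in> {0..T + 1} \<Longrightarrow> dist r s < d \<Longrightarrow> dist (x r) (x s) < e"
    using e unfolding uniformly_continuous_on_def by metis
  have "0 < min 1 d" using d(1) by simp
  from eventually_next_after[OF this, of T] show ?thesis
  proof eventually_elim
    case (elim n)
    show ?case
    proof
      fix s assume s: "s \<in> {0..T}"
      then obtain i where i: "Suc i < length (\<pi> n)" "\<pi> n ! i \<le> s" "s < \<pi> n ! Suc i"
        using partition_index[of s n] elim by auto
      define p q where "p = \<pi> n ! i" and "q = \<pi> n ! Suc i"
      have p: "0 \<le> p" using partition_nonneg[of p n] i(1) by (simp add: p_def)
      have "next_after \<pi> n p < p + min 1 d" using elim p s i(2) by (auto simp: p_def)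
      then have q: "q < p + min 1 d"
        using next_after_nth[of i n p] i unfolding p_def q_def by auto
      then have q': "q < p + 1" "q < p + d" by auto
      define \<theta> where "\<theta> = (s - p) / (q - p)"
      have \<theta>: "0 \<le> \<theta>" "\<theta> \<le> 1" using i by (auto simp: \<theta>_def p_def q_def)
      have "linear_interpolation \<pi> n x s - x s = (1 - \<theta>) *\<^sub>R (x p - x s) + \<theta> *\<^sub>R (x q - x s)"
        using linear_interpolation_eq[OF i, of x]
        by (simp add: p_def[symmetric] q_def[symmetric] \<theta>_def[symmetric] algebra_simps)
      also have "norm \<dots> \<le> (1 - \<theta>) * norm (x p - x s) + \<theta> * norm (x q - x s)"
        using \<theta> by (intro order_trans[OF norm_triangle_ineq]) simp
      also have "\<dots> \<le> (1 - \<theta>) * e + \<theta> * e"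
      proof -
        have "norm (x p - x s) < e" "norm (x q - x s) < e"
          using d(2)[of p s] d(2)[of q s] p q' s i
          by (auto simp: p_def[symmetric] q_def[symmetric] dist_norm dist_real_def)
        then show ?thesis using \<theta> by (intro add_mono mult_left_mono) auto
      qed
      also have "\<dots> = e" by (simp add: algebra_simps)
      finally show "norm (linear_interpolation \<pi> n x s - x s) \<le> e" .
    qed
  qed
qed

end

section \<open>A distance to continuous paths\<close>

text \<open>The weight \<open>max 0 (2 - s)\<close> vanishes beyond time \<open>2\<close>, so that only finite horizons matter.\<close>

definition hat_dist :: "(real \<Rightarrow> 'a::real_normed_vector) \<Rightarrow> (real \<Rightarrow> 'a) \<Rightarrow> real" where
  "hat_dist z y = (SUP s\<in>{0..}. min (max 0 (2 - s)) (norm (y s - z s)))"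

lemma bdd_above_hat_dist:
  "bdd_above ((\<lambda>s. min (max 0 (2 - s)) (norm (y s - z s))) ` {0::real..})"
  by (rule bdd_aboveI[of _ 2]) auto

lemma hat_dist_upper: "0 \<le> s \<Longrightarrow> min (max 0 (2 - s)) (norm (y s - z s)) \<le> hat_dist z y"
  unfolding hat_dist_def by (intro cSUP_upper bdd_above_hat_dist) auto

lemma hat_dist_nonneg: "0 \<le> hat_dist z y"
  using hat_dist_upper[of 2 y z] by simp

lemma hat_dist_le:
  assumes "0 \<le> e" "\<And>s. 0 \<le> s \<Longrightarrow> s < 2 \<Longrightarrow> norm (y s - z s) \<le> e"
  shows "hat_dist z y \<le> e"
  unfolding hat_dist_def
proof (rule cSUP_least)
  fix s :: real assume "s \<in> {0..}"
  then show "min (max 0 (2 - s)) (norm (y s - z s)) \<le> e"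
    using assms by (cases "s < 2") (auto simp: min_le_iff_disj)
qed auto

lemma hat_dist_ge:
  assumes "0 \<le> s" "s \<le> 1"
  shows "min 1 (norm (y s - z s)) \<le> hat_dist z y"
proof (rule order_trans)
  show "min 1 (norm (y s - z s)) \<le> min (max 0 (2 - s)) (norm (y s - z s))"
    using assms by (intro min.mono) auto
qed (rule hat_dist_upper[OF assms(1)])

lemma hat_dist_eq_0:
  assumes "hat_dist z y = 0" "0 \<le> s" "s < 2"
  shows "y s = z s"
proof -
  have "min (max 0 (2 - s)) (norm (y s - z s)) \<le> 0"
    using hat_dist_upper[OF assms(2), of y z] unfolding assms(1) .
  then have "norm (y s - z s) \<le> 0" using assms(3) by (simp only: min_le_iff_disj) simp
  then show ?thesis by simp
qed

lemma hat_dist_triangle: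
  assumes "\<And>s. 0 \<le> s \<Longrightarrow> s < 2 \<Longrightarrow> norm (z s - z' s) \<le> e" "0 \<le> e"
  shows "hat_dist z' y \<le> hat_dist z y + e"
  unfolding hat_dist_def[of z']
proof (rule cSUP_least)
  fix s :: real assume s: "s \<in> {0..}"
  show "min (max 0 (2 - s)) (norm (y s - z' s)) \<le> hat_dist z y + e"
  proof (cases "s < 2")
    case True
    then have "norm (y s - z' s) \<le> norm (y s - z s) + e"
      using assms(1)[of s] s norm_triangle_ineq[of "y s - z s" "z s - z' s"] by simp
    then show ?thesis using hat_dist_upper[of s y z] s assms(2) by auto
  next
    case False
    then show ?thesis using hat_dist_nonneg[of z y] assms(2) by auto
  qed
qed auto

lemma abs_min_diff_le: "\<bar>a - a'\<bar> \<le> e \<Longrightarrow> \<bar>b - b'\<bar> \<le> e \<Longrightarrow> \<bar>min a b - min a' b'\<bar> \<le> e" for a :: real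
  by (auto simp: min_def abs_le_iff)

lemma abs_max_diff_le: "\<bar>a - a'\<bar> \<le> e \<Longrightarrow> \<bar>b - b'\<bar> \<le> e \<Longrightarrow> \<bar>max a b - max a' b'\<bar> \<le> e" for a :: real
  by (auto simp: max_def abs_le_iff)

text \<open>The integrand of the supremum for \<open>y'\<close> at time \<open>l s\<close> is
  compared with that for \<open>y\<close> at \<open>s\<close>. The time change shifts both the
  weight and \<open>z\<close>, so the continuity of \<open>z\<close> is essential. Surjectivity of
  \<open>l\<close> lets the comparison reach all times of \<open>y'\<close>.\<close>

lemma hat_dist_J1:
  assumes z: "continuous_on {0..} z" and e: "0 < e"
  obtains \<eta> where "0 < \<eta>" "\<And>y'. y' \<in> J1_nbhd y 3 \<eta> \<Longrightarrow> \<bar>hat_dist z y' - hat_dist z y\<bar> \<le> e"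
proof -
  have "uniformly_continuous_on {0..4} z"
    using z by (intro compact_uniformly_continuous) (auto intro: continuous_on_subset)
  moreover have "0 < e / 2" using e by simp
  ultimately obtain \<delta> where \<delta>: "0 < \<delta>"
      "\<And>r s. r \<in> {0..4} \<Longrightarrow> s \<in> {0..4} \<Longrightarrow> dist r s < \<delta> \<Longrightarrow> dist (z r) (z s) < e / 2"
    unfolding uniformly_continuous_on_def by metis
  define \<eta> where "\<eta> = min \<delta> (min (e / 2) 1)"
  have \<eta>: "0 < \<eta>" "\<eta> \<le> \<delta>" "\<eta> \<le> e / 2" "\<eta> \<le> 1" using \<delta>(1) e by (auto simp: \<eta>_def)
  show ?thesis
  proof (rule that[OF \<eta>(1)])
    fix y' assume "y' \<in> J1_nbhd y 3 \<eta>"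
    then obtain l c where l: "time_change l" "c < \<eta>" "\<And>s. 0 \<le> s \<Longrightarrow> \<bar>l s - s\<bar> \<le> c"
        "\<And>s. s \<in> {0..3} \<Longrightarrow> norm (y' (l s) - y s) \<le> c"
      unfolding J1_nbhd_def by blast
    define f where "f s = min (max 0 (2 - s)) (norm (y s - z s))" for s
    define f' where "f' s = min (max 0 (2 - s)) (norm (y' s - z s))" for s
    have close: "\<bar>f' (l s) - f s\<bar> \<le> e" if s: "0 \<le> s" for s
    proof (cases "s \<le> 3")
      case True
      have "l s \<in> {0..4}" using time_change_nonneg[OF l(1) s] l(2) l(3)[OF s] True \<eta>(4) by auto
      moreover have "dist (l s) s < \<delta>" using l(2) l(3)[OF s] \<eta>(2) unfolding dist_real_def by linarith
      ultimately have "norm (z (l s) - z s) < e / 2"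
        using \<delta>(2)[of "l s" s] s True by (simp add: dist_norm)
      moreover have "norm (y' (l s) - y s) \<le> e / 2" using l(2) l(4)[of s] s True \<eta>(3) by simp
      moreover have "\<bar>norm (y' (l s) - z (l s)) - norm (y s - z s)\<bar>
          \<le> norm (y' (l s) - y s) + norm (z (l s) - z s)"
        using norm_triangle_ineq3[of "y' (l s) - z (l s)" "y s - z s"]
          norm_triangle_ineq4[of "y' (l s) - y s" "z (l s) - z s"] by (simp add: algebra_simps)
      ultimately have "\<bar>norm (y' (l s) - z (l s)) - norm (y s - z s)\<bar> \<le> e" by linarith
      moreover have "\<bar>max 0 (2 - l s) - max 0 (2 - s)\<bar> \<le> e"
      proof (rule abs_max_diff_le)
        show "\<bar>(2 - l s) - (2 - s)\<bar> \<le> e" using l(2) l(3)[OF s] \<eta>(3) e by linarith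
      qed (use e in simp)
      ultimately show ?thesis unfolding f_def f'_def by (intro abs_min_diff_le)
    next
      case False
      \<comment> \<open>Past the horizon 3 a displacement below 1 stays past 2, where both weights
        vanish.\<close>
      then have "2 \<le> l s" using l(2) l(3)[OF s] \<eta>(4) by linarith
      then show ?thesis using False e by (simp add: f_def f'_def)
    qed
    have "hat_dist z y' \<le> hat_dist z y + e"
      unfolding hat_dist_def[of z y']
    proof (rule cSUP_least)
      fix u :: real assume "u \<in> {0..}"
      then obtain s where s: "0 \<le> s" "l s = u" using time_change_surj[OF l(1)] by auto
      have "f' u \<le> f s + e" using close[OF s(1)] s(2) by auto
      also have "f s \<le> hat_dist z y" unfolding f_def by (rule hat_dist_upper[OF s(1)])
      finally show "min (max 0 (2 - u)) (norm (y' u - z u)) \<le> hat_dist z y + e" by (simp add: f'_def)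
    qed auto
    moreover have "hat_dist z y \<le> hat_dist z y' + e"
      unfolding hat_dist_def[of z y]
    proof (rule cSUP_least)
      fix s :: real assume s: "s \<in> {0..}"
      have "f s \<le> f' (l s) + e" using close[of s] s by auto
      also have "f' (l s) \<le> hat_dist z y'"
        unfolding f'_def using s by (intro hat_dist_upper time_change_nonneg[OF l(1)]) auto
      finally show "min (max 0 (2 - s)) (norm (y s - z s)) \<le> hat_dist z y' + e" by (simp add: f_def)
    qed auto
    ultimately show "\<bar>hat_dist z y' - hat_dist z y\<bar> \<le> e" by auto
  qed
qed

lemma continuous_map_hat_dist:
  assumes z: "continuous_on {0..} z"
  shows "continuous_map J1_topology euclideanreal (hat_dist z)"
  unfolding continuous_map_def topspace_J1
proof (intro conjI allI impI)
  fix V :: "real set" assume "openin euclideanreal V"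
  then have V: "open V" by simp
  show "openin J1_topology {y \<in> cadlag_paths. hat_dist z y \<in> V}"
    unfolding openin_J1
  proof (intro conjI ballI)
    fix y assume "y \<in> {y \<in> cadlag_paths. hat_dist z y \<in> V}"
    then obtain e where e: "0 < e" "cball (hat_dist z y) e \<subseteq> V"
      using V open_contains_cball by blast
    obtain \<eta> where \<eta>: "0 < \<eta>" "\<And>y'. y' \<in> J1_nbhd y 3 \<eta> \<Longrightarrow> \<bar>hat_dist z y' - hat_dist z y\<bar> \<le> e"
      using hat_dist_J1[OF z e(1)] by metis
    have "J1_nbhd y 3 \<eta> \<subseteq> {y \<in> cadlag_paths. hat_dist z y \<in> V}"
    proof
      fix y' assume y': "y' \<in> J1_nbhd y 3 \<eta>"
      then have "hat_dist z y' \<in> cball (hat_dist z y) e"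
        using \<eta>(2) by (simp add: dist_real_def abs_minus_commute)
      then show "y' \<in> {y \<in> cadlag_paths. hat_dist z y \<in> V}"
        using e(2) y' by (auto simp: J1_nbhd_def)
    qed
    then show "\<exists>T. \<exists>e>0. J1_nbhd y T e \<subseteq> {y \<in> cadlag_paths. hat_dist z y \<in> V}"
      using \<eta>(1) by blast
  qed blast
qed simp

lemma continuous_map_snd_J: "continuous_map (J_topology \<Omega>) J1_topology snd"
  unfolding J_topology_def by (intro continuous_map_from_subtopology continuous_map_snd)

lemma continuous_map_snd_U: "continuous_map (U_topology \<Omega>) local_uniform_topology snd"
  unfolding U_topology_def by (intro continuous_map_from_subtopology continuous_map_snd)

lemma finite_positive_lower_bound:
  assumes "finite K" "\<And>k. k \<in> K \<Longrightarrow> \<exists>r>0::real. \<forall>y. P k y \<longrightarrow> r \<le> f y"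
  shows "\<exists>r>0. \<forall>k\<in>K. \<forall>y. P k y \<longrightarrow> r \<le> f y"
  using assms
proof (induction K)
  case empty
  then show ?case by (auto intro: exI[of _ 1])
next
  case (insert k K)
  then obtain r r' where "0 < r" "\<forall>y. P k y \<longrightarrow> r \<le> f y" "0 < r'" "\<forall>k\<in>K. \<forall>y. P k y \<longrightarrow> r' \<le> f y"
    by (metis insertCI)
  then show ?case by (intro exI[of _ "min r r'"]) (auto simp: min_le_iff_disj)
qed

context partitions
begin

text \<open>
  A step function differs from a continuous path that is not constant, since the range of the latter
  is infinite; for all but finitely many step approximations of \<open>x\<close> the difference at \<open>s\<^sub>0\<close> is
  bounded below.
\<close>

lemma hat_dist_step_approx_pos:
  fixes x z :: "real \<Rightarrow> 'a::real_normed_vector"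
  assumes x: "x \<in> cadlag_paths" and z: "continuous_on {0..} z"
    and s0: "0 \<le> s0" "s0 < 1" "x s0 \<noteq> z s0"
    and s12: "0 \<le> s1" "s1 < s2" "s2 < 1" "z s1 \<noteq> z s2" and b: "0 < b"
  obtains r where "0 < r" "r < b"
    "\<And>y. (\<forall>s\<in>{0..<1}. y s = x s) \<or> (\<exists>k. \<forall>s\<in>{0..<1}. y s = step_approx \<pi> k x s) \<Longrightarrow> r \<le> hat_dist z y"
proof -
  define P where "P k y \<longleftrightarrow> (\<forall>s\<in>{0..<1}. y s = step_approx \<pi> k x s)" for k and y :: "real \<Rightarrow> 'a"
  define \<alpha> where "\<alpha> = norm (x s0 - z s0)"
  have \<alpha>: "0 < \<alpha>" using s0 by (simp add: \<alpha>_def)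
  have "\<forall>\<^sub>F k in sequentially. dist (step_approx \<pi> k x s0) (x s0) < \<alpha> / 2"
    using step_approx_tendsto[OF x s0(1)] \<alpha> unfolding tendsto_iff by (metis half_gt_zero)
  then obtain K where K: "\<And>k. K \<le> k \<Longrightarrow> dist (step_approx \<pi> k x s0) (x s0) < \<alpha> / 2"
    unfolding eventually_sequentially by blast
  have "\<exists>r>0. \<forall>y. P k y \<longrightarrow> r \<le> hat_dist z y" for k
  proof -
    have "\<exists>s\<in>{s1..s2}. step_approx \<pi> k x s \<noteq> z s"
    proof (rule ccontr)
      assume "\<not> ?thesis"
      \<comment> \<open>A finite connected set has at most one point, which contradicts the two
        distinct values of \<open>z\<close>.\<close>
      then have "z ` {s1..s2} = step_approx \<pi> k x ` {s1..s2}" by (auto intro!: image_cong)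
      then have "finite (z ` {s1..s2})"
        using finite_range_step_approx[of k x] by (metis finite_subset image_mono subset_UNIV)
      moreover have "connected (z ` {s1..s2})"
        using z s12 by (intro connected_continuous_image) (auto intro: continuous_on_subset)
      moreover have "z s1 \<in> z ` {s1..s2}" "z s2 \<in> z ` {s1..s2}" using s12 by auto
      ultimately show False
        using s12(4) connected_finite_iff_sing[of "z ` {s1..s2}"] by (metis empty_iff singletonD)
    qed
    then obtain s where s: "s1 \<le> s" "s \<le> s2" "step_approx \<pi> k x s \<noteq> z s" by auto
    then have "min 1 (norm (step_approx \<pi> k x s - z s)) \<le> hat_dist z y" if "P k y" for y
      using hat_dist_ge[of s y z] that s12 by (simp add: P_def)
    moreover have "0 < min 1 (norm (step_approx \<pi> k x s - z s))" using s(3) by simp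
    ultimately show ?thesis by blast
  qed
  then obtain r1 where r1: "0 < r1" "\<And>k y. k < K \<Longrightarrow> P k y \<Longrightarrow> r1 \<le> hat_dist z y"
    using finite_positive_lower_bound[of "{..<K}" P "hat_dist z"] by auto
  \<comment> \<open>\<open>b / 2\<close> gives the strict bound by \<open>b\<close>,
    \<open>r1\<close> covers the finitely many indices below \<open>K\<close>, and 1 and
    \<open>\<alpha> / 2\<close> cover x and the approximations close to it at
    \<open>s0\<close>.\<close>
  define r where "r = min (b / 2) (min r1 (min 1 (\<alpha> / 2)))"
  have r: "0 < r" "r \<le> b / 2" "r \<le> r1" "r \<le> 1" "r \<le> \<alpha> / 2"
    using r1(1) \<alpha> b by (auto simp: r_def)
  show ?thesis
  proof (rule that)
    show "0 < r" "r < b" using r b by auto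
    fix y assume "(\<forall>s\<in>{0..<1}. y s = x s) \<or> (\<exists>k. \<forall>s\<in>{0..<1}. y s = step_approx \<pi> k x s)"
    then have "y s0 = x s0 \<or> (\<exists>k. P k y)" using s0 by (auto simp: P_def)
    then consider "y s0 = x s0" | k where "P k y" "K \<le> k" | k where "P k y" "k < K"
      by (meson not_le)
    then show "r \<le> hat_dist z y"
    proof cases
      case 1
      then have "min 1 \<alpha> \<le> hat_dist z y" using hat_dist_ge[of s0 y z] s0 by (simp add: \<alpha>_def)
      then show ?thesis using r \<alpha> by auto
    next
      case 2
      then have "norm (y s0 - x s0) < \<alpha> / 2" using K s0 by (simp add: P_def dist_norm)
      then have "\<alpha> / 2 \<le> norm (y s0 - z s0)"
        using norm_triangle_ineq2[of "x s0 - z s0" "x s0 - y s0"]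
        by (simp add: \<alpha>_def norm_minus_commute)
      then show ?thesis using hat_dist_ge[of s0 y z] s0 r by auto
    next
      case 3
      then show ?thesis using r1(2) r(3) by force
    qed
  qed
qed

end

section \<open>The sum of bumps\<close>

context generic_paths
begin

definition bump :: "(real \<Rightarrow> real^'m) \<Rightarrow> real \<Rightarrow> real \<times> (real \<Rightarrow> real^'m) \<Rightarrow> real" where
  "bump z r q = max 0 (1 - hat_dist z (snd q) / r)"

lemma bump_in_pi_functionals:
  assumes "continuous_on {0..} z" "0 < r"
  shows "bump z r \<in> pi_functionals \<pi> \<Omega>"
proof (rule J1_continuous_in_pi_functionals)
  have "continuous_map (J_topology \<Omega>) euclideanreal (hat_dist z \<circ> snd)"
    by (intro continuous_map_compose[OF continuous_map_snd_J] continuous_map_hat_dist assms)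
  then show "continuous_map (J_topology \<Omega>) euclideanreal (bump z r)"
    unfolding bump_def[abs_def] o_def using assms(2)
    by (intro continuous_map_real_max continuous_map_const[THEN iffD2] continuous_map_diff
        continuous_map_real_divide) auto
qed

lemma bump_eq_0: "r \<le> hat_dist z (snd q) \<Longrightarrow> 0 < r \<Longrightarrow> bump z r q = 0"
  by (simp add: bump_def)

text \<open>The path of \<open>p\<close> is constant after its stopping time but agrees with x up to
  time 2, so that time is at least 2. The underlying path then equals x on [0,2) and the net is
  eventually frozen after time 1. With a mesh below 1, a step approximation at times before 1 reads
  the path only before 2.\<close>

lemma approaching_equal_on:
  assumes app: "approaching G p" and p: "\<And>s. 0 \<le> s \<Longrightarrow> s < 2 \<Longrightarrow> snd p s = x s"
    and nonconst: "\<And>t c. 0 \<le> t \<Longrightarrow> t < 2 \<Longrightarrow> \<exists>s\<ge>t. s < 2 \<and> x s \<noteq> c"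
  shows "\<forall>\<^sub>F q in G. (\<forall>s\<in>{0..<1}. snd q s = x s) \<or> (\<exists>k. \<forall>s\<in>{0..<1}. snd q s = step_approx \<pi> k x s)"
  using app
proof (cases rule: approaching_freeze)
  case (1 \<omega> t c S c')
  have t: "2 \<le> t"
  proof (rule ccontr)
    assume "\<not> 2 \<le> t"
    then obtain s where "t \<le> s" "s < 2" "x s \<noteq> c" using nonconst[of t c] 1(2) by auto
    then show False using p[of s] 1(2,3) by (simp add: freeze_def)
  qed
  then have \<omega>: "\<omega> s = x s" if "0 \<le> s" "s < 2" for s
    using p[OF that] 1(3) that by (simp add: freeze_def)
  have "\<forall>\<^sub>F s in at t within S. 1 < s"
    using tendsto_ident_at[of t S] by (rule order_tendstoD) (use t in simp)
  then show ?thesis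
    unfolding 1(4) eventually_filtermap
    by eventually_elim (use \<omega> in \<open>simp add: freeze_def\<close>)
next
  case (2 \<omega> t c \<tau> c')
  have t: "2 \<le> t"
  proof (rule ccontr)
    assume "\<not> 2 \<le> t"
    then obtain s where "t \<le> s" "s < 2" "x s \<noteq> c" using nonconst[of t c] 2(2) by auto
    then show False using p[of s] 2(2,3) by (simp add: freeze_def)
  qed
  then have \<omega>: "\<omega> s = x s" if "0 \<le> s" "s < 2" for s
    using p[OF that] 2(3) that by (simp add: freeze_def)
  have "\<forall>\<^sub>F n in sequentially. 1 < \<tau> n"
    using 2(4) by (rule order_tendstoD) (use t in simp)
  with eventually_next_after[OF zero_less_one, of 1] show ?thesis
    unfolding 2(5) eventually_filtermap
  proof eventually_elim
    case (elim n)
    have "freeze (step_approx \<pi> n \<omega>) (\<tau> n) (c' n) s = step_approx \<pi> n x s" if s: "s \<in> {0..<1}" for s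
    proof -
      have "s < last (\<pi> n)" "next_after \<pi> n s < s + 1" using elim(1) s by auto
      moreover from this have "s < next_after \<pi> n s" by (intro next_after_in)
      ultimately show ?thesis
        using s elim(2) \<omega>[of "next_after \<pi> n s"] by (simp add: freeze_def step_approx_eq)
    qed
    then show ?case by auto
  qed
qed

text \<open>Along every net the sum is eventually a fixed finite sum of members of
  \<open>pi_functionals\<close>. At points agreeing with x on [0,2) all bumps vanish by the
  separation; elsewhere the distance to x stays bounded below along the net, and only finitely many
  bumps reach that far.\<close>

lemma bump_sum:
  fixes z :: "nat \<Rightarrow> real \<Rightarrow> real^'m"
  assumes x: "x \<in> \<Omega>" "continuous_on {0..} x"
    and nonconst: "\<And>t c. 0 \<le> t \<Longrightarrow> t < 2 \<Longrightarrow> \<exists>s\<ge>t. s < 2 \<and> x s \<noteq> c"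
    and z: "\<And>n. z n \<in> \<Omega>" "\<And>n. continuous_on {0..} (z n)"
      "\<And>e. 0 < e \<Longrightarrow> \<forall>\<^sub>F n in sequentially. \<forall>s\<in>{0..2}. norm (z n s - x s) \<le> e"
    and r: "\<And>n. 0 < r n" "r \<longlonglongrightarrow> 0"
    and sep: "\<And>n y. (\<forall>s\<in>{0..<1}. y s = x s) \<or> (\<exists>k. \<forall>s\<in>{0..<1}. y s = step_approx \<pi> k x s) \<Longrightarrow>
      r n \<le> hat_dist (z n) y"
  shows "(\<lambda>q. \<Sum>n. bump (z n) (r n) q) \<in> pi_functionals \<pi> \<Omega>"
    and "\<not> continuous_map (U_topology \<Omega>) euclideanreal (\<lambda>q. \<Sum>n. bump (z n) (r n) q)"
proof -
  define F where "F q = (\<Sum>n. bump (z n) (r n) q)" for q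
  \<comment> \<open>If x is at distance at least \<open>c\<close>, then \<open>z n\<close> is
    eventually at distance at least \<open>c / 2\<close>, which exceeds the radius
    \<open>r n\<close>.\<close>
  have far: "\<exists>M. \<forall>n\<ge>M. \<forall>q. c \<le> hat_dist x (snd q) \<longrightarrow> bump (z n) (r n) q = 0" if "0 < c" for c
  proof -
    have "\<forall>\<^sub>F n in sequentially. r n < c / 2"
      using r(2) by (rule order_tendstoD) (use that in simp)
    moreover have "\<forall>\<^sub>F n in sequentially. \<forall>s\<in>{0..2}. norm (z n s - x s) \<le> c / 2"
      using that by (intro z) simp
    ultimately have "\<forall>\<^sub>F n in sequentially. \<forall>q. c \<le> hat_dist x (snd q) \<longrightarrow> bump (z n) (r n) q = 0"
    proof eventually_elim
      case (elim n)
      have "bump (z n) (r n) q = 0" if q: "c \<le> hat_dist x (snd q)" for q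
      proof (rule bump_eq_0)
        have "hat_dist x (snd q) \<le> hat_dist (z n) (snd q) + c / 2"
          using elim(2) \<open>0 < c\<close> by (intro hat_dist_triangle) auto
        then show "r n \<le> hat_dist (z n) (snd q)" using q elim(1) by linarith
      qed (rule r)
      then show ?case by blast
    qed
    then show ?thesis by (simp add: eventually_sequentially)
  qed
  have near: "bump (z n) (r n) q = 0"
    if "(\<forall>s\<in>{0..<1}. snd q s = x s) \<or> (\<exists>k. \<forall>s\<in>{0..<1}. snd q s = step_approx \<pi> k x s)" for n q
    using that by (intro bump_eq_0 sep r)
  have F_eq: "F q = (\<Sum>n<M. bump (z n) (r n) q)" if "\<And>n. M \<le> n \<Longrightarrow> bump (z n) (r n) q = 0" for q M
    unfolding F_def by (rule suminf_finite) (use that in \<open>auto simp: not_less\<close>)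
  have "F \<in> pi_functionals \<pi> \<Omega>"
    unfolding pi_functionals_iff
  proof (intro allI impI)
    fix G p assume app: "approaching G p"
    have "\<exists>M. (\<forall>n\<ge>M. bump (z n) (r n) p = 0) \<and> (\<forall>\<^sub>F q in G. \<forall>n\<ge>M. bump (z n) (r n) q = 0)"
    proof (cases "hat_dist x (snd p) = 0")
      case True
      have p: "snd p s = x s" if "0 \<le> s" "s < 2" for s using hat_dist_eq_0[OF True that] .
      have "\<forall>\<^sub>F q in G. \<forall>n\<ge>0. bump (z n) (r n) q = 0"
      proof (rule eventually_mono)
        show "\<forall>\<^sub>F q in G. (\<forall>s\<in>{0..<1}. snd q s = x s) \<or>
            (\<exists>k. \<forall>s\<in>{0..<1}. snd q s = step_approx \<pi> k x s)"
          using app p nonconst by (rule approaching_equal_on)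
      qed (use near in blast)
      moreover have "bump (z n) (r n) p = 0" for n using p by (intro near) auto
      ultimately show ?thesis by blast
    next
      case False
      define c where "c = hat_dist x (snd p) / 2"
      have c: "0 < c" "c < hat_dist x (snd p)"
        using False hat_dist_nonneg[of x "snd p"] by (auto simp: c_def)
      obtain M where M: "\<And>n q. M \<le> n \<Longrightarrow> c \<le> hat_dist x (snd q) \<Longrightarrow> bump (z n) (r n) q = 0"
        using far[OF c(1)] by blast
      have "limitin euclideanreal ((hat_dist x \<circ> snd) \<circ> (\<lambda>q. q)) ((hat_dist x \<circ> snd) p) G"
        by (intro continuous_map_limit[OF _ approaching_limitin_J[OF app]]
            continuous_map_compose[OF continuous_map_snd_J] continuous_map_hat_dist x)
      then have "((\<lambda>q. hat_dist x (snd q)) \<longlongrightarrow> hat_dist x (snd p)) G" by (simp add: o_def)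
      then have "\<forall>\<^sub>F q in G. c < hat_dist x (snd q)" using c(2) by (rule order_tendstoD)
      then have "\<forall>\<^sub>F q in G. \<forall>n\<ge>M. bump (z n) (r n) q = 0"
        by eventually_elim (use M in auto)
      then show ?thesis using M c(2) by (intro exI[of _ M]) auto
    qed
    then obtain M where M: "\<And>n. M \<le> n \<Longrightarrow> bump (z n) (r n) p = 0"
        "\<forall>\<^sub>F q in G. \<forall>n\<ge>M. bump (z n) (r n) q = 0" by blast
    have "((\<lambda>q. \<Sum>n<M. bump (z n) (r n) q) \<longlongrightarrow> (\<Sum>n<M. bump (z n) (r n) p)) G"
      using app bump_in_pi_functionals[OF z(2) r(1)] unfolding pi_functionals_iff
      by (intro tendsto_sum) blast
    moreover have "\<forall>\<^sub>F q in G. (\<Sum>n<M. bump (z n) (r n) q) = F q"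
      using M(2) by eventually_elim (simp add: F_eq[of M])
    ultimately have "(F \<longlongrightarrow> (\<Sum>n<M. bump (z n) (r n) p)) G" by (rule Lim_transform_eventually)
    then show "(F \<longlongrightarrow> F p) G" using F_eq[OF M(1)] by simp
  qed
  then show "(\<lambda>q. \<Sum>n. bump (z n) (r n) q) \<in> pi_functionals \<pi> \<Omega>" by (simp add: F_def[abs_def])
  show "\<not> continuous_map (U_topology \<Omega>) euclideanreal (\<lambda>q. \<Sum>n. bump (z n) (r n) q)"
  proof
    assume "continuous_map (U_topology \<Omega>) euclideanreal (\<lambda>q. \<Sum>n. bump (z n) (r n) q)"
    then have cont: "continuous_map (U_topology \<Omega>) euclideanreal F" by (simp add: F_def[abs_def])
    \<comment> \<open>Stopping at 2 turns uniform closeness on [0,2] into closeness on every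
      horizon, and the bumps do not see what happens after time 2.\<close>
    define p where "p n = (2::real, stop (z n) 2)" for n
    have in\<Omega>: "stop (z n) 2 \<in> \<Omega>" "stop x 2 \<in> \<Omega>" for n using x z stop_in by auto
    have "limitin local_uniform_topology (\<lambda>n. stop (z n) 2) (stop x 2) sequentially"
      unfolding limitin_def topspace_local_uniform
    proof (intro conjI allI impI)
      fix U assume "openin local_uniform_topology U \<and> stop x 2 \<in> U"
      then obtain T e where U: "0 < e" "lu_nbhd (stop x 2) T e \<subseteq> U"
        unfolding openin_local_uniform by blast
      have "\<forall>\<^sub>F n in sequentially. \<forall>s\<in>{0..2}. norm (z n s - x s) \<le> e / 2"
        using U(1) by (intro z) simp
      then show "\<forall>\<^sub>F n in sequentially. stop (z n) 2 \<in> U"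
      proof eventually_elim
        case (elim n)
        then have "\<forall>s\<in>{0..T}. norm (stop (z n) 2 s - stop x 2 s) \<le> e / 2"
          by (auto simp: stop_def)
        then have "stop (z n) 2 \<in> lu_nbhd (stop x 2) T e"
          using in\<Omega>(1) generic_cadlag U(1) unfolding lu_nbhd_def
          by (intro CollectI conjI exI[of _ "e / 2"]) auto
        then show ?case using U(2) by blast
      qed
    qed (use in\<Omega> generic_cadlag in auto)
    then have "limitin (U_topology \<Omega>) p (2, stop x 2) sequentially"
      using in\<Omega> by (auto simp: U_topology_def limitin_subtopology limitin_pairwise o_def p_def
          intro!: always_eventually stopped_pathsI)
    then have "limitin euclideanreal (F \<circ> p) (F (2, stop x 2)) sequentially"
      by (rule continuous_map_limit[OF cont])
    then have lim: "(\<lambda>n. F (p n)) \<longlonglongrightarrow> F (2, stop x 2)" by (simp add: o_def)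
    have "F (2, stop x 2) = 0"
      using F_eq[of 0 "(2, stop x 2)"] near[of "(2, stop x 2)"] by (auto simp: stop_def)
    moreover have "1 \<le> F (p n)" for n
    proof -
      have "hat_dist (z n) (stop (z n) 2) \<le> 0" by (rule hat_dist_le) (auto simp: stop_def)
      then have zero: "hat_dist (z n) (stop (z n) 2) = 0"
        using hat_dist_nonneg[of "z n" "stop (z n) 2"] by simp
      \<comment> \<open>This makes the series at \<open>p n\<close> a finite sum, so that its value
        is at least the single bump of height 1. Otherwise the stopped path would agree with x on
        [0,2), and the separation would give \<open>r n \<le> 0\<close>.\<close>
      have "hat_dist x (stop (z n) 2) \<noteq> 0"
      proof
        assume "hat_dist x (stop (z n) 2) = 0"
        then have "r n \<le> hat_dist (z n) (stop (z n) 2)"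
          using hat_dist_eq_0[of x "stop (z n) 2"] by (intro sep) auto
        then show False using zero r(1)[of n] by simp
      qed
      then have "0 < hat_dist x (stop (z n) 2)" using hat_dist_nonneg[of x "stop (z n) 2"] by simp
      then obtain M where M: "\<And>k. M \<le> k \<Longrightarrow> bump (z k) (r k) (p n) = 0"
        using far unfolding p_def by (metis order_refl snd_conv)
      have one: "bump (z n) (r n) (p n) = 1" using zero by (simp add: bump_def p_def)
      then have "n < M" using M[of n] by (auto simp: not_le[symmetric])
      then have "bump (z n) (r n) (p n) \<le> (\<Sum>k<M. bump (z k) (r k) (p n))"
        by (intro member_le_sum) (auto simp: bump_def)
      then show ?thesis using one F_eq[OF M] by simp
    qed
    ultimately show False
      using LIMSEQ_le_const[OF lim, of 1] by simp
  qed
qed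

end

section \<open>Left limits at time 1 as a U-continuous functional\<close>

lemma continuous_map_left_lim:
  "continuous_map local_uniform_topology euclideanreal (\<lambda>w :: real \<Rightarrow> 'a::real_inner. v \<bullet> left_lim w 1)"
  unfolding continuous_map_def topspace_local_uniform
proof (intro conjI allI impI)
  fix V :: "real set" assume "openin euclideanreal V"
  then have V: "open V" by simp
  show "openin local_uniform_topology {w \<in> cadlag_paths. v \<bullet> left_lim w 1 \<in> V}"
    unfolding openin_local_uniform
  proof (intro conjI ballI)
    fix w assume w: "w \<in> {w \<in> cadlag_paths. v \<bullet> left_lim w 1 \<in> V}"
    then obtain e where e: "0 < e" "cball (v \<bullet> left_lim w 1) e \<subseteq> V"
      using V open_contains_cball by blast
    \<comment> \<open>The summand 1 covers the case \<open>v = 0\<close>.\<close>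
    define \<eta> where "\<eta> = e / (norm v + 1)"
    have \<eta>: "0 < \<eta>" "norm v * \<eta> \<le> e"
      using e(1) norm_ge_zero[of v] by (auto simp: \<eta>_def field_simps add_pos_nonneg)
    have "lu_nbhd w 1 \<eta> \<subseteq> {w \<in> cadlag_paths. v \<bullet> left_lim w 1 \<in> V}"
    proof
      fix y assume "y \<in> lu_nbhd w 1 \<eta>"
      then obtain d where y: "y \<in> cadlag_paths" "d < \<eta>" "\<And>s. s \<in> {0..1} \<Longrightarrow> norm (y s - w s) \<le> d"
        by (auto simp: lu_nbhd_def)
      have "norm (left_lim y 1 - left_lim w 1) \<le> d"
      proof (rule tendsto_upperbound)
        show "((\<lambda>r. norm (y r - w r)) \<longlongrightarrow> norm (left_lim y 1 - left_lim w 1)) (at_left 1)"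
          using y(1) w by (intro tendsto_intros left_lim_tendsto) auto
        have "eventually (\<lambda>r. r \<in> {0<..<1}) (at_left (1::real))" by (rule eventually_at_left_real) simp
        then show "\<forall>\<^sub>F r in at_left 1. norm (y r - w r) \<le> d"
          by eventually_elim (use y(3) in auto)
      qed simp
      then have "norm v * norm (left_lim y 1 - left_lim w 1) \<le> norm v * \<eta>"
        using y(2) by (intro mult_left_mono) auto
      then have "\<bar>v \<bullet> left_lim y 1 - v \<bullet> left_lim w 1\<bar> \<le> e"
        using Cauchy_Schwarz_ineq2[of v "left_lim y 1 - left_lim w 1"] \<eta>(2)
        by (simp add: inner_diff_right)
      then have "v \<bullet> left_lim y 1 \<in> cball (v \<bullet> left_lim w 1) e"
        by (simp add: dist_real_def abs_minus_commute)
      then show "y \<in> {w \<in> cadlag_paths. v \<bullet> left_lim w 1 \<in> V}" using e(2) y(1) by auto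
    qed
    then show "\<exists>T. \<exists>e>0. lu_nbhd w T e \<subseteq> {w \<in> cadlag_paths. v \<bullet> left_lim w 1 \<in> V}"
      using \<eta>(1) by blast
  qed blast
qed simp

context generic_paths
begin

text \<open>Appending the jump 0 or \<open>\<rho> *\<^sub>R b\<close> at time 1 gives two different
  end values with the same left limit, so at least one of them differs from it.\<close>

lemma exists_path_with_jump:
  obtains y where "y \<in> \<Omega>" "left_lim y 1 \<noteq> y 1" "\<forall>s\<ge>1. y s = y 1"
proof -
  obtain x where x: "x \<in> \<Omega>" using generic by (auto simp: generic_set_def)
  obtain U where U: "0 \<in> interior U" "\<And>e. e \<in> U \<Longrightarrow> freeze x 1 (x 1 + e) \<in> \<Omega>"
    using append_jump_in[OF x, of 1] by auto
  obtain \<rho> where \<rho>: "0 < \<rho>" "cball 0 \<rho> \<subseteq> U"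
    using U(1) by (auto simp: mem_interior_cball)
  obtain b :: "real^'m" where b: "b \<in> Basis" using nonempty_Basis by blast
  have in_U: "0 \<in> U" "\<rho> *\<^sub>R b \<in> U" using \<rho> b by (auto simp: subset_iff)
  have "\<rho> *\<^sub>R b \<noteq> 0" using \<rho>(1) b nonzero_Basis by auto
  then obtain e where e: "e \<in> U" "x 1 + e \<noteq> left_lim x 1"
    using in_U by (metis add_left_cancel add.right_neutral)
  define y where "y = freeze x 1 (x 1 + e)"
  have "left_lim y 1 = left_lim x 1" unfolding y_def by (rule left_lim_freeze) auto
  moreover have "y s = x 1 + e" if "1 \<le> s" for s using that by (simp add: y_def freeze_def)
  ultimately show ?thesis using U(2)[OF e(1)] e(2) by (intro that[of y]) (auto simp: y_def)
qed

text \<open>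
  A jump of \<open>y\<close> at \<open>1\<close> is made by \<open>step_approx\<close> at \<open>last_before 1 < 1\<close>, so the left limits of the
  approximations at \<open>1\<close> tend to \<open>y 1\<close>.
\<close>

lemma exists_U_not_pi:
  "\<exists>F. continuous_map (U_topology \<Omega>) euclideanreal F \<and> F \<notin> pi_functionals \<pi> \<Omega>"
proof -
  obtain y where y: "y \<in> \<Omega>" "left_lim y 1 \<noteq> y 1" "\<forall>s\<ge>1. y s = y 1"
    by (rule exists_path_with_jump)
  define v where "v = y 1 - left_lim y 1"
  define F where "F q = v \<bullet> left_lim (snd q) 1" for q :: "real \<times> (real \<Rightarrow> real^'m)"
  have "continuous_map (U_topology \<Omega>) euclideanreal ((\<lambda>w. v \<bullet> left_lim w 1) \<circ> snd)"
    by (intro continuous_map_compose[OF continuous_map_snd_U] continuous_map_left_lim)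
  then have "continuous_map (U_topology \<Omega>) euclideanreal F" by (simp add: o_def F_def[abs_def])
  moreover have "F \<notin> pi_functionals \<pi> \<Omega>"
  proof
    assume F: "F \<in> pi_functionals \<pi> \<Omega>"
    \<comment> \<open>Stopping at the constant time 2 leaves the left limit at 1 untouched and keeps
      the net admissible, since 2 is never before \<open>last_before \<pi> n 2\<close>.\<close>
    have "approaching (filtermap (\<lambda>n. (2, stop (step_approx \<pi> n y) 2)) sequentially) (2, stop y 2)"
      using right3[OF y(1), of 2 "\<lambda>_. 2"] last_before_le[of 2] by simp
    then have "(F \<longlongrightarrow> F (2, stop y 2)) (filtermap (\<lambda>n. (2, stop (step_approx \<pi> n y) 2)) sequentially)"
      using F unfolding pi_functionals_iff by blast
    then have "(\<lambda>n. F (2, stop (step_approx \<pi> n y) 2)) \<longlonglongrightarrow> F (2, stop y 2)"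
      by (simp add: filterlim_filtermap)
    moreover have "F (2, stop y 2) = v \<bullet> left_lim y 1"
      by (simp add: F_def stop_eq_freeze left_lim_freeze)
    moreover have "\<forall>\<^sub>F n in sequentially. F (2, stop (step_approx \<pi> n y) 2) = v \<bullet> y 1"
      using eventually_next_after[OF zero_less_one, of 1]
    proof eventually_elim
      case (elim n)
      have "1 \<le> next_after \<pi> n (last_before \<pi> n 1)"
        using elim last_before_le[of 1 n] next_after_in[of "last_before \<pi> n 1" n]
        by (intro last_before_less_imp[of 1 _ n]) auto
      \<comment> \<open>As \<open>y\<close> is constant from time 1 on, the left limit of the
        approximation at 1 is exactly \<open>y 1\<close>.\<close>
      then have "y (next_after \<pi> n (last_before \<pi> n 1)) = y 1" using y(3) by blast
      then show ?case
        using elim by (simp add: F_def stop_eq_freeze left_lim_freeze left_lim_step_approx)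
    qed
    ultimately have "(\<lambda>n. v \<bullet> y 1) \<longlonglongrightarrow> v \<bullet> left_lim y 1"
      using Lim_transform_eventually by fastforce
    then have "v \<bullet> y 1 = v \<bullet> left_lim y 1" by (simp add: LIMSEQ_const_iff)
    then have "v \<bullet> v = 0" by (simp add: v_def inner_diff_right)
    then show False using y(2) by (simp add: v_def)
  qed
  ultimately show ?thesis by blast
qed

text \<open>Continuity of the quadratic variation gives uniform convergence of the interpolations;
  its strict growth makes them eventually nonconstant on [0,1) and different from x there. These are
  the hypotheses needed to choose the radii.\<close>

lemma exists_pi_not_U:
  assumes x: "x \<in> \<Omega>" "x \<in> qv_paths \<pi>" "continuous_on {0..} (qv \<pi> x)" "strictly_increasing (qv \<pi> x)"
    and lin: "\<exists>N. \<forall>n\<ge>N. linear_interpolation \<pi> n x \<in> \<Omega>"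
  shows "\<exists>F\<in>pi_functionals \<pi> \<Omega>. \<not> continuous_map (U_topology \<Omega>) euclideanreal F"
proof -
  have cad: "x \<in> cadlag_paths" using x(1) by (rule generic_cadlag)
  have cont: "continuous_on {0..} x" using x(2,3) by (rule continuous_of_qv_continuous)
  have nonconst: "\<exists>s\<ge>t. s < b \<and> x s \<noteq> c" if "0 \<le> t" "t < b" for t b c
    using not_affine[OF x(2-4) that, of c 0] by simp
  obtain s2 where s2: "0 < s2" "s2 < 1" "x s2 \<noteq> x 0"
    using nonconst[of 0 1 "x 0"] by (metis less_eq_real_def zero_less_one)
  \<comment> \<open>A third of the gap: interpolations within \<open>\<delta>\<close> of x at both 0
    and \<open>s2\<close> cannot take equal values there.\<close>
  define \<delta> where "\<delta> = norm (x s2 - x 0) / 3"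
  have \<delta>: "0 < \<delta>" using s2 by (simp add: \<delta>_def)
  have approx: "\<forall>\<^sub>F n in sequentially. \<forall>s\<in>{0..2}. norm (linear_interpolation \<pi> n x s - x s) \<le> e"
    if "0 < e" for e
    using linear_interpolation_approx[OF cont that] .
  have "\<forall>\<^sub>F n in sequentially. linear_interpolation \<pi> n x \<in> \<Omega>"
    using lin by (simp add: eventually_sequentially)
  then have "\<forall>\<^sub>F n in sequentially. linear_interpolation \<pi> n x \<in> \<Omega> \<and>
      (\<exists>s0. 0 \<le> s0 \<and> s0 < 1 \<and> x s0 \<noteq> linear_interpolation \<pi> n x s0) \<and>
      linear_interpolation \<pi> n x 0 \<noteq> linear_interpolation \<pi> n x s2"
    using approx[OF \<delta>] eventually_next_after[OF zero_less_one, of 0]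
  proof eventually_elim
    case (elim n)
    \<comment> \<open>On the cell starting at 0 the interpolation is affine and x is not, so they
      differ at some \<open>s0\<close> in that cell before time 1.\<close>
    obtain i where i: "Suc i < length (\<pi> n)" "\<pi> n ! i \<le> 0" "0 < \<pi> n ! Suc i"
      using partition_index[of 0 n] elim(3) by auto
    define w where "w = (1 / (\<pi> n ! Suc i - \<pi> n ! i)) *\<^sub>R (x (\<pi> n ! Suc i) - x (\<pi> n ! i))"
    define c where "c = x (\<pi> n ! i) - (\<pi> n ! i) *\<^sub>R w"
    have aff: "linear_interpolation \<pi> n x s = c + s *\<^sub>R w" if "0 \<le> s" "s < \<pi> n ! Suc i" for s
      using linear_interpolation_eq[OF i(1) _ that(2), of x] i(2) that(1)
      by (simp add: c_def w_def diff_divide_distrib scaleR_diff_left)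
    obtain s0 where "0 \<le> s0" "s0 < min 1 (\<pi> n ! Suc i)" "x s0 \<noteq> c + s0 *\<^sub>R w"
      using not_affine[OF x(2-4), of 0 "min 1 (\<pi> n ! Suc i)" c w] i(3) by auto
    then have "\<exists>s0. 0 \<le> s0 \<and> s0 < 1 \<and> x s0 \<noteq> linear_interpolation \<pi> n x s0"
      using aff by (intro exI[of _ s0]) auto
    moreover have "linear_interpolation \<pi> n x 0 \<noteq> linear_interpolation \<pi> n x s2"
    proof
      assume eq: "linear_interpolation \<pi> n x 0 = linear_interpolation \<pi> n x s2"
      have "norm (linear_interpolation \<pi> n x 0 - x 0) \<le> \<delta>" "norm (linear_interpolation \<pi> n x s2 - x s2) \<le> \<delta>"
        using elim(2) s2 by auto
      then have "norm (x s2 - x 0) \<le> 2 * \<delta>"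
        using norm_triangle_ineq4[of "linear_interpolation \<pi> n x 0 - x 0"
            "linear_interpolation \<pi> n x s2 - x s2"] eq by simp
      then show False using \<delta> by (simp add: \<delta>_def)
    qed
    ultimately show ?case using elim(1) by blast
  qed
  then obtain N where N: "\<And>n. N \<le> n \<Longrightarrow> linear_interpolation \<pi> n x \<in> \<Omega>"
      "\<And>n. N \<le> n \<Longrightarrow> \<exists>s0. 0 \<le> s0 \<and> s0 < 1 \<and> x s0 \<noteq> linear_interpolation \<pi> n x s0"
      "\<And>n. N \<le> n \<Longrightarrow> linear_interpolation \<pi> n x 0 \<noteq> linear_interpolation \<pi> n x s2"
    unfolding eventually_sequentially by blast
  \<comment> \<open>The shift by \<open>N\<close> makes all required properties hold for every
    index.\<close>
  define z where "z n = linear_interpolation \<pi> (n + N) x" for n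
  \<comment> \<open>The bound \<open>1 / real (Suc n)\<close> forces the radii to 0, as local
    finiteness of the sum requires.\<close>
  have "\<exists>r. 0 < r \<and> r < 1 / real (Suc n) \<and> (\<forall>y. (\<forall>s\<in>{0..<1}. y s = x s) \<or>
      (\<exists>k. \<forall>s\<in>{0..<1}. y s = step_approx \<pi> k x s) \<longrightarrow> r \<le> hat_dist (z n) y)" for n
  proof -
    obtain s0 where s0: "0 \<le> s0" "s0 < 1" "x s0 \<noteq> z n s0" using N(2)[of "n + N"] by (auto simp: z_def)
    show ?thesis
    proof (rule hat_dist_step_approx_pos[of x "z n" s0 0 s2 "1 / real (Suc n)"])
      show "continuous_on {0..} (z n)" "z n 0 \<noteq> z n s2"
        using N(3) continuous_linear_interpolation by (auto simp: z_def)
    qed (use cad s0 s2 in auto)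
  qed
  then obtain r where r: "\<And>n. 0 < r n" "\<And>n. r n < 1 / real (Suc n)"
      "\<And>n y. (\<forall>s\<in>{0..<1}. y s = x s) \<or> (\<exists>k. \<forall>s\<in>{0..<1}. y s = step_approx \<pi> k x s) \<Longrightarrow>
        r n \<le> hat_dist (z n) y"
    by metis
  have "r \<longlonglongrightarrow> 0"
  proof (rule tendsto_sandwich[of "\<lambda>_. 0" _ _ "\<lambda>n. 1 / real (Suc n)"])
    show "(\<lambda>n. 1 / real (Suc n)) \<longlonglongrightarrow> 0" using LIMSEQ_inverse_real_of_nat by (simp add: inverse_eq_divide)
  qed (use r(1,2) in \<open>auto intro!: always_eventually less_imp_le\<close>)
  have z: "z n \<in> \<Omega>" "continuous_on {0..} (z n)" for n
    using N(1) continuous_linear_interpolation by (auto simp: z_def)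
  have z_approx: "\<forall>\<^sub>F n in sequentially. \<forall>s\<in>{0..2}. norm (z n s - x s) \<le> e" if "0 < e" for e
    unfolding z_def using sequentially_offset[OF approx[OF that]] .
  have "(\<lambda>q. \<Sum>n. bump (z n) (r n) q) \<in> pi_functionals \<pi> \<Omega>"
    "\<not> continuous_map (U_topology \<Omega>) euclideanreal (\<lambda>q. \<Sum>n. bump (z n) (r n) q)"
    by (rule bump_sum[of x]; (fact | rule nonconst z_approx r(3); assumption))+
  then show ?thesis by blast
qed

end

theorem theorem3p19:
  fixes \<pi> :: "nat \<Rightarrow> real list" and \<Omega> :: "(real \<Rightarrow> real^'m) set" and x :: "real \<Rightarrow> real^'m"
  assumes "partition_sequence \<pi>"
    and "generic_set \<pi> \<Omega>"
    and "x \<in> \<Omega>" and "x \<in> qv_paths \<pi>"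
    and "continuous_on {0..} (qv \<pi> x)" and "strictly_increasing (qv \<pi> x)"
    and "\<exists>N. \<forall>n\<ge>N. linear_interpolation \<pi> n x \<in> \<Omega>"
  shows "(\<forall>F. continuous_map (J_topology \<Omega>) euclideanreal F
             \<longrightarrow> continuous_map (pi_topology \<pi> \<Omega>) euclideanreal F)
       \<and> (\<exists>F. continuous_map (pi_topology \<pi> \<Omega>) euclideanreal F
             \<and> \<not> continuous_map (U_topology \<Omega>) euclideanreal F)
       \<and> (\<exists>F. continuous_map (U_topology \<Omega>) euclideanreal F
             \<and> \<not> continuous_map (pi_topology \<pi> \<Omega>) euclideanreal F)"
proof -
  interpret generic_paths \<pi> \<Omega>
    by unfold_locales (fact assms)+
  show ?thesis
    unfolding pi_continuous_iff
    using J1_continuous_in_pi_functionals exists_pi_not_U[OF assms(3-7)] exists_U_not_pi by blast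
qed

end
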